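(* Let $\psi_1,\dots,\psi_m\in H_0^1(\Omega)$ be a set of basis functions, and let $\phi_1,\dots,\phi_n\in H_0^1(\Omega)$ be a set of multi-scale basis functions with respect to the coarse mesh $\{D_j\}_{j=1}^N$ of size $H$. For $f\in L^2(\Omega)$ let $u\in H_0^1(\Omega)$ be the weak solution of $-\mathrm{div}(a\nabla u)=f$ in $\Omega$, $u=0$ on $\partial\Omega$; let $u_h$ be the Galerkin solution in $\mathrm{span}\{\psi_1,\dots,\psi_m\}$ and let $u_h^{MS}$ be the Galerkin solution in $\mathrm{span}\{\phi_1,\dots,\phi_n\}$. If $$\mathrm{span}\{\phi_1|_\Gamma,\dots,\phi_n|_\Gamma\}=\mathrm{span}\{\psi_1|_\Gamma,\dots,\psi_m|_\Gamma\},$$ then $$\|u-u_h^{MS}\|_a^2\le \|u-u_h\|_a^2+C\,\|f\|_{L^2(\Omega)}^2\,H^2,$$ where $C$ is a constant independent of $f$, $H$ and the choice of the basis functions (it may depend on $\lambda_{\min},\lambda_{\max}$).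
   Context: $\Omega=(0,1)^2$, discretized by a uniform coarse square mesh of side length $H$: $\overline\Omega=\bigcup_{j=1}^N D_j$, where the $D_j$ are closed squares of side $H$ with disjoint interiors. The coefficient $a\in L^\infty(\Omega)$ is scalar and satisfies $a(x)\in[\lambda_{\min},\lambda_{\max}]$ for a.e. $x$, with $0<\lambda_{\min}\le\lambda_{\max}<\infty$; no further regularity is assumed. Bilinear form and energy norm: $a(u,v)=\int_\Omega \nabla u^t\, a(x)\nabla v\,dx$ and $\|u\|_a^2=a(u,u)$ for $u,v\in H_0^1(\Omega)$. The Galerkin solution in a finite-dimensional subspace $V\subset H_0^1(\Omega)$ is the unique $u_V\in V$ with $a(u_V,v)=\int_\Omega f v\,dx$ for all $v\in V$. $\Gamma=\bigcup_{j=1}^N\partial D_j$, and $w|_\Gamma$ denotes the trace of $w\in H_0^1(\Omega)$ on $\Gamma$. Functions $\phi_1,\dots,\phi_n\in H_0^1(\Omega)$ are called multi-scale basis functions if each of them is $a(x)$-harmonic on each coarse element, i.e. $-\mathrm{div}(a(x)\nabla\phi_i(x))=0$ in the interior of $D_j$ in the weak sense, for all $i$ and all $j$ (but not necessarily across the boundaries of the $D_j$). *)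

theory Defs
  imports "HOL-Analysis.Analysis"
begin

subsection \<open>Sobolev spaces on an open set\<close>

text \<open>Elements of $L^2$ and $H^1$ are represented by functions on the whole space; only their
  values almost everywhere on the domain \<open>S\<close> matter.\<close>

definition sq_integrable :: "'a::euclidean_space set \<Rightarrow> ('a \<Rightarrow> 'b::euclidean_space) \<Rightarrow> bool" where
  "sq_integrable S f \<longleftrightarrow>
     f \<in> borel_measurable (lebesgue_on S) \<and> integrable (lebesgue_on S) (\<lambda>x. (norm (f x))\<^sup>2)"

definition L2_norm :: "'a::euclidean_space set \<Rightarrow> ('a \<Rightarrow> 'b::euclidean_space) \<Rightarrow> real" where
  "L2_norm S f = sqrt (\<integral>x. (norm (f x))\<^sup>2 \<partial>lebesgue_on S)"

primrec Ck :: "nat \<Rightarrow> ('a::euclidean_space \<Rightarrow> real) \<Rightarrow> bool" where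
  "Ck 0 f \<longleftrightarrow> continuous_on UNIV f"
| "Ck (Suc k) f \<longleftrightarrow> (\<exists>g. (\<forall>x. GDERIV f x :> g x) \<and> (\<forall>b\<in>Basis. Ck k (\<lambda>x. g x \<bullet> b)))"

definition test_function :: "'a::euclidean_space set \<Rightarrow> ('a \<Rightarrow> real) \<Rightarrow> bool" where
  "test_function S \<phi> \<longleftrightarrow>
     (\<forall>k. Ck k \<phi>) \<and> compact (closure {x. \<phi> x \<noteq> 0}) \<and> closure {x. \<phi> x \<noteq> 0} \<subseteq> S"

definition has_weak_gradient ::
    "'a::euclidean_space set \<Rightarrow> ('a \<Rightarrow> real) \<Rightarrow> ('a \<Rightarrow> 'a) \<Rightarrow> bool" where
  "has_weak_gradient S u g \<longleftrightarrow>
     (\<forall>\<phi> d\<phi>. test_function S \<phi> \<and> (\<forall>x. GDERIV \<phi> x :> d\<phi> x) \<longrightarrow>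
        (\<integral>x. u x *\<^sub>R d\<phi> x \<partial>lebesgue_on S) = - (\<integral>x. \<phi> x *\<^sub>R g x \<partial>lebesgue_on S))"

definition H1 :: "'a::euclidean_space set \<Rightarrow> ('a \<Rightarrow> real) set" where
  "H1 S = {u. sq_integrable S u \<and> (\<exists>g. sq_integrable S g \<and> has_weak_gradient S u g)}"

text \<open>The weak gradient is unique only up to a null set; a representative is chosen.\<close>

definition weak_grad :: "'a::euclidean_space set \<Rightarrow> ('a \<Rightarrow> real) \<Rightarrow> 'a \<Rightarrow> 'a" where
  "weak_grad S u = (SOME g. sq_integrable S g \<and> has_weak_gradient S u g)"

definition H1_norm :: "'a::euclidean_space set \<Rightarrow> ('a \<Rightarrow> real) \<Rightarrow> real" where
  "H1_norm S u = sqrt ((L2_norm S u)\<^sup>2 + (L2_norm S (weak_grad S u))\<^sup>2)"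

definition H1_approx :: "'a::euclidean_space set \<Rightarrow> (nat \<Rightarrow> 'a \<Rightarrow> real) \<Rightarrow> ('a \<Rightarrow> real) \<Rightarrow> bool" where
  "H1_approx S \<phi> u \<longleftrightarrow>
     (\<forall>k. test_function S (\<phi> k)) \<and> (\<lambda>k. H1_norm S (\<lambda>x. \<phi> k x - u x)) \<longlonglongrightarrow> 0"

definition H10 :: "'a::euclidean_space set \<Rightarrow> ('a \<Rightarrow> real) set" where
  "H10 S = {u \<in> H1 S. \<exists>\<phi>. H1_approx S \<phi> u}"


subsection \<open>The elliptic problem\<close>

definition unit_square :: "(real \<times> real) set" where
  "unit_square = box (0, 0) (1, 1)"

definition coefficient :: "real \<Rightarrow> real \<Rightarrow> (real \<times> real \<Rightarrow> real) \<Rightarrow> bool" where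
  "coefficient l\<^sub>m\<^sub>i\<^sub>n l\<^sub>m\<^sub>a\<^sub>x a \<longleftrightarrow>
     a \<in> borel_measurable (lebesgue_on unit_square) \<and>
     (AE x in lebesgue_on unit_square. l\<^sub>m\<^sub>i\<^sub>n \<le> a x \<and> a x \<le> l\<^sub>m\<^sub>a\<^sub>x)"

definition bilin ::
    "('a::euclidean_space \<Rightarrow> real) \<Rightarrow> 'a set \<Rightarrow> ('a \<Rightarrow> real) \<Rightarrow> ('a \<Rightarrow> real) \<Rightarrow> real" where
  "bilin a S u v = (\<integral>x. weak_grad S u x \<bullet> (a x *\<^sub>R weak_grad S v x) \<partial>lebesgue_on S)"

definition energy_norm ::
    "('a::euclidean_space \<Rightarrow> real) \<Rightarrow> 'a set \<Rightarrow> ('a \<Rightarrow> real) \<Rightarrow> real" where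
  "energy_norm a S u = sqrt (bilin a S u u)"

text \<open>$-\mathrm{div}(a \nabla u) = f$ in \<open>S\<close> in the weak sense; no boundary condition on \<open>u\<close>.\<close>

definition weakly_solves ::
    "('a::euclidean_space \<Rightarrow> real) \<Rightarrow> 'a set \<Rightarrow> ('a \<Rightarrow> real) \<Rightarrow> ('a \<Rightarrow> real) \<Rightarrow> bool" where
  "weakly_solves a S f u \<longleftrightarrow>
     (\<forall>v\<in>H10 S. bilin a S u v = (\<integral>x. f x * v x \<partial>lebesgue_on S))"

definition lin_span :: "nat \<Rightarrow> (nat \<Rightarrow> 'a \<Rightarrow> real) \<Rightarrow> ('a \<Rightarrow> real) set" where
  "lin_span n \<phi> = {(\<lambda>x. \<Sum>i<n. \<alpha> i * \<phi> i x) | \<alpha>. True}"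

definition galerkin_solution ::
    "('a::euclidean_space \<Rightarrow> real) \<Rightarrow> 'a set \<Rightarrow> ('a \<Rightarrow> real) \<Rightarrow> ('a \<Rightarrow> real) set \<Rightarrow> ('a \<Rightarrow> real) \<Rightarrow> bool"
  where
  "galerkin_solution a S f V w \<longleftrightarrow>
     w \<in> V \<and> (\<forall>v\<in>V. bilin a S w v = (\<integral>x. f x * v x \<partial>lebesgue_on S))"


subsection \<open>The coarse mesh and traces on its skeleton\<close>

definition coarse_square :: "real \<Rightarrow> real \<times> real \<Rightarrow> (real \<times> real) set" where
  "coarse_square H c = cbox c (c + (H, H))"

text \<open>The mesh is given by the lower left corners \<open>c 0, \<dots>, c (N - 1)\<close> of its elements.\<close>

definition coarse_mesh :: "real \<Rightarrow> nat \<Rightarrow> (nat \<Rightarrow> real \<times> real) \<Rightarrow> bool" where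
  "coarse_mesh H N c \<longleftrightarrow>
     0 < H \<and>
     (\<Union>j<N. coarse_square H (c j)) = closure unit_square \<and>
     (\<forall>i<N. \<forall>j<N. i \<noteq> j \<longrightarrow>
        interior (coarse_square H (c i)) \<inter> interior (coarse_square H (c j)) = {})"

definition edges :: "real \<Rightarrow> real \<times> real \<Rightarrow> ((real \<times> real) \<times> (real \<times> real)) set" where
  "edges H c =
     {(c, c + (H, 0)), (c, c + (0, H)), (c + (H, 0), c + (H, H)), (c + (0, H), c + (H, H))}"

text \<open>The skeleton, i.e. the union of the boundaries of all elements, is represented by the finite
  set \<open>E\<close> of its edges; an edge common to two elements occurs only once. Functions on the skeleton
  are again represented by functions on the plane, and integrals with respect to arc length are
  computed by parametrizing each edge over $[0,1]$.\<close>

definition skeleton :: "real \<Rightarrow> nat \<Rightarrow> (nat \<Rightarrow> real \<times> real) \<Rightarrow> ((real \<times> real) \<times> (real \<times> real)) set" where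
  "skeleton H N c = (\<Union>j<N. edges H (c j))"

definition skel_sq_integrable ::
    "((real \<times> real) \<times> (real \<times> real)) set \<Rightarrow> (real \<times> real \<Rightarrow> real) \<Rightarrow> bool" where
  "skel_sq_integrable E g \<longleftrightarrow> (\<forall>(p, q)\<in>E. sq_integrable {0..1} (g \<circ> linepath p q))"

definition skel_L2_norm ::
    "((real \<times> real) \<times> (real \<times> real)) set \<Rightarrow> (real \<times> real \<Rightarrow> real) \<Rightarrow> real" where
  "skel_L2_norm E g = sqrt (\<Sum>(p, q)\<in>E. dist p q * (L2_norm {0..1} (g \<circ> linepath p q))\<^sup>2)"

definition skel_AE_eq ::
    "((real \<times> real) \<times> (real \<times> real)) set \<Rightarrow> (real \<times> real \<Rightarrow> real) \<Rightarrow> (real \<times> real \<Rightarrow> real) \<Rightarrow> bool"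
  where
  "skel_AE_eq E g h \<longleftrightarrow>
     (\<forall>(p, q)\<in>E. AE t in lebesgue_on {0..1}. g (linepath p q t) = h (linepath p q t))"

text \<open>The trace operator on $H^1_0$ of the unit square is the continuous extension, with values in
  $L^2$ of the skeleton, of the restriction of test functions. Its values are determined up to
  equality almost everywhere on the skeleton; a representative is chosen.\<close>

definition is_trace ::
    "((real \<times> real) \<times> (real \<times> real)) set \<Rightarrow> (real \<times> real \<Rightarrow> real) \<Rightarrow> (real \<times> real \<Rightarrow> real) \<Rightarrow> bool"
  where
  "is_trace E w g \<longleftrightarrow>
     skel_sq_integrable E g \<and>
     (\<exists>\<phi>. H1_approx unit_square \<phi> w \<and> (\<lambda>k. skel_L2_norm E (\<lambda>x. \<phi> k x - g x)) \<longlonglongrightarrow> 0)"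

definition skel_trace ::
    "((real \<times> real) \<times> (real \<times> real)) set \<Rightarrow> (real \<times> real \<Rightarrow> real) \<Rightarrow> real \<times> real \<Rightarrow> real" where
  "skel_trace E w = (SOME g. is_trace E w g)"

text \<open>The span of the traces as a subspace of $L^2$ of the skeleton: the set of all representatives
  of all linear combinations, so that equality of such sets is equality of the subspaces.\<close>

definition trace_span ::
    "((real \<times> real) \<times> (real \<times> real)) set \<Rightarrow> nat \<Rightarrow> (nat \<Rightarrow> real \<times> real \<Rightarrow> real) \<Rightarrow>
     (real \<times> real \<Rightarrow> real) set" where
  "trace_span E n \<phi> = {g. \<exists>h\<in>lin_span n (\<lambda>i. skel_trace E (\<phi> i)). skel_AE_eq E g h}"

definition multiscale_basis ::
    "(real \<times> real \<Rightarrow> real) \<Rightarrow> real \<Rightarrow> nat \<Rightarrow> (nat \<Rightarrow> real \<times> real) \<Rightarrow>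
     nat \<Rightarrow> (nat \<Rightarrow> real \<times> real \<Rightarrow> real) \<Rightarrow> bool" where
  "multiscale_basis a H N c n \<phi> \<longleftrightarrow>
     (\<forall>i<n. \<phi> i \<in> H10 unit_square \<and>
        (\<forall>j<N. weakly_solves a (interior (coarse_square H (c j))) (\<lambda>_. 0) (\<phi> i)))"

end

theory Submission
  imports Defs
begin

text \<open>
  Let \<open>p\<close> be an element of the multiscale space with the same trace on the skeleton as the Galerkin
  solution \<open>u\<^sub>h\<close>. The difference \<open>w = u\<^sub>h - p\<close> vanishes on the skeleton, so it belongs to $H^1_0$ of each
  mesh square (\<open>zero_trace_imp_H10\<close>). Since \<open>p\<close> is $a$-harmonic there, $a(p, w) = 0$
  (\<open>multiscale_orthogonal\<close>) and therefore $a(u_h, w) = a(w, w)$. Expanding the square of $u - p = (u - u_h) + w$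
  and testing the equation of \<open>u\<close> with \<open>w\<close> gives
  $$\|u - p\|_a^2 = \|u - u_h\|_a^2 + 2 \int f w - a(w, w).$$
  On squares of side \<open>H\<close> the Poincare inequality gives $\|w\|^2 \le 8 H^2 \|\nabla w\|^2 \le (8 H^2/\lambda)\, a(w,w)$ with
  the ellipticity constant $\lambda$ (\<open>mesh_Poincare\<close>), and Young's inequality turns this into
  $2 \int f w \le (8 H^2/\lambda) \|f\|^2 + a(w, w)$. The energy of \<open>w\<close> cancels. Finally the multiscale Galerkin
  solution is at least as close to \<open>u\<close> as \<open>p\<close> (\<open>galerkin_optimal\<close>), so $C = 8/\lambda$ works.

  The analytic core is that trace zero implies membership in $H^1_0$ of the mesh squares. If test functions
  $\eta_k$ approximate \<open>w\<close> and have small traces, they are multiplied by cutoffs that vanish near the boundary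
  of the square. The gradient of a cutoff is of order $1/\delta$ in a frame of width proportional to $\delta$;
  there $\eta_k$ is controlled, along lines orthogonal to the nearest edge, by its values on this edge and
  by $\delta$ times its gradient (\<open>frame_L2_norm_le\<close>). The error of the cutoff (\<open>cutoff_estimate\<close>) is thus
  bounded by the gradient of $\eta_k$ in a thin frame and by the trace divided by $\delta$, and both are small if
  $\delta$ is chosen before \<open>k\<close>.

  Two further facts make the definitions usable. Weak gradients are unique up to null sets
  (\<open>AE_eq_0_of_test_functions\<close>), so they are linear and compatible with restriction to mesh squares. Traces
  exist (\<open>is_trace_exists\<close>), because the gradient of a test function controls its values on every edge
  (\<open>test_function_edge_le\<close>).
\<close>

section \<open>Smooth functions and cutoffs\<close>

lemma GDERIV_unique:
  assumes "GDERIV f x :> d" "GDERIV f x :> e"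
  shows "d = e"
proof -
  have "(\<lambda>h. h \<bullet> d) = (\<lambda>h. h \<bullet> e)"
    using assms unfolding gderiv_def by (rule has_derivative_unique)
  then have "(d - e) \<bullet> d = (d - e) \<bullet> e" by metis
  then have "(d - e) \<bullet> (d - e) = 0" by (simp add: inner_diff_right)
  then show ?thesis by simp
qed

text \<open>A total function, in contrast to the relation \<open>GDERIV\<close>, so that gradients can be integrated; its
  values carry information only at points of differentiability.\<close>

definition grad :: "('a::euclidean_space \<Rightarrow> real) \<Rightarrow> 'a \<Rightarrow> 'a" where
  "grad f x = (THE g. GDERIV f x :> g)"

lemma grad_eqI: "GDERIV f x :> g \<Longrightarrow> grad f x = g"
  unfolding grad_def by (rule the_equality) (auto intro: GDERIV_unique)

lemma Ck_Suc_imp_Ck: "Ck (Suc k) f \<Longrightarrow> Ck k f"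
proof (induction k arbitrary: f)
  case 0
  then have "\<forall>x. f differentiable (at x)"
    by (auto simp: gderiv_def differentiable_def)
  then have "continuous_on UNIV f"
    by (meson continuous_at_imp_continuous_on differentiable_imp_continuous_within)
  then show ?case by simp
next
  case (Suc k)
  then show ?case using Ck.simps(2) by blast
qed

lemma Ck_const: "Ck k (\<lambda>x. c)"
proof (induction k arbitrary: c)
  case (Suc k)
  then show ?case by (auto intro!: exI[of _ "\<lambda>x. 0"] GDERIV_const)
qed auto

lemma Ck_inner: "Ck k (\<lambda>x. x \<bullet> v)"
proof (cases k)
  case (Suc k)
  then show ?thesis
    by (auto intro!: exI[of _ "\<lambda>x. v"] Ck_const has_derivative_inner_left has_derivative_ident simp: gderiv_def)
qed (auto intro!: continuous_intros)

lemma Ck_add: "Ck k f \<Longrightarrow> Ck k g \<Longrightarrow> Ck k (\<lambda>x. f x + g x)"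
proof (induction k arbitrary: f g)
  case 0
  then show ?case by (auto intro: continuous_on_add)
next
  case (Suc k)
  from Suc.prems obtain f' g' where
    f: "\<forall>x. GDERIV f x :> f' x" "\<forall>b\<in>Basis. Ck k (\<lambda>x. f' x \<bullet> b)" and
    g: "\<forall>x. GDERIV g x :> g' x" "\<forall>b\<in>Basis. Ck k (\<lambda>x. g' x \<bullet> b)"
    by auto
  have "\<forall>x. GDERIV (\<lambda>x. f x + g x) x :> f' x + g' x" using f g by (auto intro: GDERIV_add)
  moreover have "\<forall>b\<in>Basis. Ck k (\<lambda>x. (f' x + g' x) \<bullet> b)"
    using f g by (auto simp: inner_add_left intro: Suc.IH)
  ultimately show ?case by auto
qed

lemma Ck_mult: "Ck k f \<Longrightarrow> Ck k g \<Longrightarrow> Ck k (\<lambda>x. f x * g x)"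
proof (induction k arbitrary: f g)
  case 0
  then show ?case by (auto intro: continuous_on_mult)
next
  case (Suc k)
  from Suc.prems obtain f' g' where
    f: "\<forall>x. GDERIV f x :> f' x" "\<forall>b\<in>Basis. Ck k (\<lambda>x. f' x \<bullet> b)" and
    g: "\<forall>x. GDERIV g x :> g' x" "\<forall>b\<in>Basis. Ck k (\<lambda>x. g' x \<bullet> b)"
    by auto
  have "\<forall>x. GDERIV (\<lambda>x. f x * g x) x :> f x *\<^sub>R g' x + g x *\<^sub>R f' x"
    using f g by (auto intro: GDERIV_mult)
  moreover have "\<forall>b\<in>Basis. Ck k (\<lambda>x. (f x *\<^sub>R g' x + g x *\<^sub>R f' x) \<bullet> b)"
    using f g Suc.prems[THEN Ck_Suc_imp_Ck] by (auto simp: inner_add_left intro!: Ck_add Suc.IH)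
  ultimately show ?case by auto
qed

lemma Ck_compose:
  fixes F :: "real \<Rightarrow> real"
  shows "Ck k F \<Longrightarrow> Ck k u \<Longrightarrow> Ck k (\<lambda>x. F (u x))"
proof (induction k arbitrary: F u)
  case 0
  then show ?case using continuous_on_compose2[of UNIV F UNIV u] by auto
next
  case (Suc k)
  from Suc.prems obtain F' u' where
    F: "\<forall>x. GDERIV F x :> F' x" "Ck k F'" and
    u: "\<forall>x. GDERIV u x :> u' x" "\<forall>b\<in>Basis. Ck k (\<lambda>x. u' x \<bullet> b)"
    by auto
  have "GDERIV (\<lambda>x. F (u x)) x :> F' (u x) *\<^sub>R u' x" for x
    by (rule GDERIV_DERIV_compose[where f = u and g = F]) (simp_all only: F(1)[unfolded gderiv_deriv] u(1))
  then have "\<forall>x. GDERIV (\<lambda>x. F (u x)) x :> F' (u x) *\<^sub>R u' x" ..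
  moreover have "\<forall>b\<in>Basis. Ck k (\<lambda>x. (F' (u x) *\<^sub>R u' x) \<bullet> b)"
    using Ck_mult[OF Suc.IH[OF F(2) Ck_Suc_imp_Ck[OF Suc.prems(2)]]] u(2) by simp
  ultimately show ?case
    unfolding Ck.simps by (intro exI[of _ "\<lambda>x. F' (u x) *\<^sub>R u' x"] conjI)
qed

lemma Ck_prod: "finite I \<Longrightarrow> \<forall>i\<in>I. Ck k (f i) \<Longrightarrow> Ck k (\<lambda>x. \<Prod>i\<in>I. f i x)"
  by (induction I rule: finite_induct) (auto intro: Ck_const Ck_mult)

text \<open>For a family of functions that is closed under differentiation, smoothness of all members needs no
  formula for higher derivatives.\<close>

lemma Ck_realI:
  fixes F :: "nat \<Rightarrow> real \<Rightarrow> real"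
  assumes "\<And>n x. (F n has_real_derivative F (Suc n) x) (at x)"
  shows "Ck k (F n)"
proof (induction k arbitrary: n)
  case 0
  then show ?case using assms by (auto intro!: DERIV_continuous_on)
next
  case (Suc k)
  then show ?case using assms by (auto intro!: exI[of _ "F (Suc n)"])
qed

text \<open>The polynomial factor \<open>p (1 / t)\<close> in front of the classical flat function $e^{-1/t}$ makes the
  family closed under differentiation.\<close>

definition exp_recip :: "real poly \<Rightarrow> real \<Rightarrow> real" where
  "exp_recip p t = (if 0 < t then poly p (1 / t) * exp (- (1 / t)) else 0)"

text \<open>The exponential beats every polynomial in \<open>1 / t\<close>. Applied to \<open>[:0, 1:] * p\<close> this also says that
  the difference quotient of \<open>exp_recip p\<close> at \<open>0\<close> tends to \<open>0\<close>.\<close>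

lemma exp_recip_tendsto_0: "(exp_recip p \<longlongrightarrow> 0) (at_right 0)"
proof -
  have "((\<lambda>y. \<Sum>i\<le>degree p. coeff p i * (y ^ i / exp y)) \<longlongrightarrow> (\<Sum>i\<le>degree p. coeff p i * 0)) at_top"
    by (intro tendsto_intros tendsto_power_div_exp_0)
  then have "((\<lambda>y. poly p y * exp (- y)) \<longlongrightarrow> 0) at_top"
    by (simp add: poly_altdef sum_distrib_right exp_minus divide_inverse mult.assoc)
  then have "((\<lambda>t::real. poly p (1/t) * exp (- (1/t))) \<longlongrightarrow> 0) (at_right 0)"
    by (rule filterlim_compose) (use filterlim_inverse_at_top_right in \<open>simp add: inverse_eq_divide\<close>)
  then show ?thesis
    by (rule Lim_transform_eventually)
       (auto simp: eventually_at_right_field exp_recip_def intro!: exI[of _ 1])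
qed

text \<open>By the chain rule the derivative of $p(1/t)\,e^{-1/t}$ is $t^{-2}(p - p')(1/t)\,e^{-1/t}$, and
  \<open>[:0, 0, 1:]\<close> stands for the factor $t^{-2}$.\<close>

lemma DERIV_exp_recip:
  "(exp_recip p has_real_derivative exp_recip ([:0, 0, 1:] * (p - pderiv p)) t) (at t)"
proof -
  let ?q = "[:0, 0, 1:] * (p - pderiv p)"
  consider "0 < t" | "t < 0" | "t = 0" by linarith
  then show ?thesis
  proof cases
    case 1
    have "((\<lambda>t. poly p (1/t) * exp (- (1/t))) has_real_derivative exp_recip ?q t) (at t)"
      using 1 by (auto intro!: derivative_eq_intros simp: exp_recip_def)
         (simp add: divide_inverse algebra_simps)
    then show ?thesis
      by (rule has_field_derivative_transform_within_open[of _ _ _ "{0<..}"])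
         (use 1 in \<open>auto simp: exp_recip_def\<close>)
  next
    case 2
    have "((\<lambda>t. 0) has_real_derivative exp_recip ?q t) (at t)"
      using 2 by (auto simp: exp_recip_def)
    then show ?thesis
      by (rule has_field_derivative_transform_within_open[of _ _ _ "{..<0}"]) (use 2 in \<open>auto simp: exp_recip_def\<close>)
  next
    case 3
    have "exp_recip ([:0, 1:] * p) h = (exp_recip p (0 + h) - exp_recip p 0) / h" if "0 < h" for h
      using that by (simp add: exp_recip_def)
    then have "\<forall>\<^sub>F h in at_right 0. exp_recip ([:0, 1:] * p) h = (exp_recip p (0 + h) - exp_recip p 0) / h"
      by (simp add: eventually_at_right_less eventually_mono[OF eventually_at_right_less])
    from Lim_transform_eventually[OF exp_recip_tendsto_0 this]
    have r: "((\<lambda>h. (exp_recip p (0 + h) - exp_recip p 0) / h) \<longlongrightarrow> 0) (at_right 0)" .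
    have "(exp_recip p (0 + h) - exp_recip p 0) / h = 0" if "h < 0" for h
      using that by (simp add: exp_recip_def)
    moreover have "\<forall>\<^sub>F h in at_left (0::real). h < 0"
      by (simp add: eventually_at_filter)
    ultimately have l: "((\<lambda>h. (exp_recip p (0 + h) - exp_recip p 0) / h) \<longlongrightarrow> 0) (at_left 0)"
      by (intro tendsto_eventually) (auto elim: eventually_mono)
    have "((\<lambda>h. (exp_recip p (0 + h) - exp_recip p 0) / h) \<longlongrightarrow> 0) (at 0)"
      using l r by (simp add: filterlim_split_at)
    then show ?thesis using 3 by (simp add: DERIV_def exp_recip_def)
  qed
qed

lemma Ck_exp_recip: "Ck k (exp_recip p)"
proof -
  define F where "F = rec_nat p (\<lambda>_ p. [:0, 0, 1:] * (p - pderiv p))"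
  have "Ck k (exp_recip (F 0))"
    by (rule Ck_realI[of "\<lambda>n. exp_recip (F n)"]) (auto simp: F_def simp del: mult_pCons_left intro!: DERIV_exp_recip)
  then show ?thesis by (simp add: F_def)
qed

text \<open>Write $h(t) = e^{-1/t}$ for positive $t$ and $h = 0$ elsewhere. The inner function
  $e^{-1} - h(1-t)$ is at most $0$ for $t \le 0$, because $h(1-t) \ge h(1) = e^{-1}$ there, and is the
  constant $e^{-1}$ for $t \ge 1$. A second application of $h$ therefore produces a smooth function that
  is exactly constant on both sides of $[0,1]$.\<close>

definition smooth_step :: "real \<Rightarrow> real" where
  "smooth_step t = exp_recip 1 (exp (-1) - exp_recip 1 (1 - t)) / exp_recip 1 (exp (-1))"

lemma Ck_smooth_step: "Ck k smooth_step"
proof -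
  have "Ck k (\<lambda>t. exp_recip 1 (exp (-1) + (-1) * exp_recip 1 (1 + t \<bullet> (-1))) * inverse (exp_recip 1 (exp (-1))))"
    by (intro Ck_mult Ck_const Ck_compose[OF Ck_exp_recip] Ck_add Ck_inner)
  also have "(\<lambda>t. exp_recip 1 (exp (-1) + (-1) * exp_recip 1 (1 + t \<bullet> (-1))) * inverse (exp_recip 1 (exp (-1)))) = smooth_step"
    by (simp add: smooth_step_def fun_eq_iff divide_inverse)
  finally show ?thesis .
qed

lemma exp_recip_1_mono:
  assumes "s \<le> t"
  shows "exp_recip 1 s \<le> exp_recip 1 t"
proof (cases "0 < s")
  case True
  then have "1 / t \<le> 1 / s" using assms by (intro frac_le) auto
  then show ?thesis using True assms by (simp add: exp_recip_def)
qed (simp add: exp_recip_def)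

lemma smooth_step_eq_0:
  assumes "t \<le> 0"
  shows "smooth_step t = 0"
proof -
  have "exp (-1) \<le> exp_recip 1 (1 - t)"
    using exp_recip_1_mono[of 1 "1 - t"] assms by (simp add: exp_recip_def)
  then show ?thesis by (simp add: smooth_step_def exp_recip_def[of _ "_ - _"])
qed

lemma smooth_step_eq_1: "1 \<le> t \<Longrightarrow> smooth_step t = 1"
  by (simp add: smooth_step_def exp_recip_def)

lemma smooth_step_bounds: "0 \<le> smooth_step t" "smooth_step t \<le> 1"
proof -
  have nn: "0 \<le> exp_recip 1 s" for s by (simp add: exp_recip_def)
  then have "exp_recip 1 (exp (-1) - exp_recip 1 (1 - t)) \<le> exp_recip 1 (exp (-1))"
    by (intro exp_recip_1_mono) simp
  moreover have "0 < exp_recip 1 (exp (-1))" by (simp add: exp_recip_def)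
  ultimately show "smooth_step t \<le> 1" by (simp add: smooth_step_def)
  show "0 \<le> smooth_step t" by (simp add: smooth_step_def nn)
qed


lemma Ck_imp_GDERIV:
  assumes "\<And>k. Ck k f"
  shows "GDERIV f x :> grad f x"
proof -
  obtain g where "\<forall>x. GDERIV f x :> g x" using assms[of "Suc 0"] by auto
  then show ?thesis by (metis grad_eqI)
qed

lemma continuous_grad:
  assumes "\<And>k. Ck k f"
  shows "continuous_on UNIV (grad f)"
proof -
  obtain g where g: "\<forall>x. GDERIV f x :> g x" "\<forall>b\<in>Basis. Ck 0 (\<lambda>x. g x \<bullet> b)"
    using assms[of "Suc 0"] by (auto simp del: Ck.simps(1))
  then have "grad f = g" by (metis grad_eqI ext)
  then show ?thesis using g(2) by (subst continuous_on_componentwise) simp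
qed

lemma test_functionD:
  assumes "test_function S \<phi>"
  shows "\<And>x. GDERIV \<phi> x :> grad \<phi> x" "continuous_on UNIV (grad \<phi>)" "continuous_on UNIV \<phi>"
    "\<And>x. x \<notin> S \<Longrightarrow> \<phi> x = 0" "\<And>k. Ck k \<phi>"
proof -
  have C: "Ck k \<phi>" for k using assms by (simp add: test_function_def)
  show "GDERIV \<phi> x :> grad \<phi> x" for x using C by (rule Ck_imp_GDERIV)
  show "continuous_on UNIV (grad \<phi>)" using C by (rule continuous_grad)
  show "continuous_on UNIV \<phi>" using C[of 0] by simp
  show "\<And>x. x \<notin> S \<Longrightarrow> \<phi> x = 0" using assms closure_subset[of "{x. \<phi> x \<noteq> 0}"] by (auto simp: test_function_def)
  show "\<And>k. Ck k \<phi>" by (rule C)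
qed

lemma test_functionI:
  assumes "\<And>k. Ck k \<phi>" "compact K" "K \<subseteq> S" "\<And>x. x \<notin> K \<Longrightarrow> \<phi> x = 0"
  shows "test_function S \<phi>"
proof -
  have "closure {x. \<phi> x \<noteq> 0} \<subseteq> K"
    using assms by (intro closure_minimal) (auto intro: compact_imp_closed)
  then show ?thesis
    using assms bounded_subset[OF compact_imp_bounded[OF \<open>compact K\<close>], of "{x. \<phi> x \<noteq> 0}"]
    by (auto simp: test_function_def)
qed

lemma test_functionE:
  assumes "test_function S \<phi>"
  obtains K where "compact K" "K \<subseteq> S" "\<And>x. x \<notin> K \<Longrightarrow> \<phi> x = 0"
proof
  show "compact (closure {x. \<phi> x \<noteq> 0})" "closure {x. \<phi> x \<noteq> 0} \<subseteq> S"
    using assms by (simp_all add: test_function_def)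
  show "\<phi> x = 0" if "x \<notin> closure {x. \<phi> x \<noteq> 0}" for x
    using that closure_subset[of "{x. \<phi> x \<noteq> 0}"] by blast
qed

lemma test_function_mult:
  assumes "test_function S \<phi>" "\<And>k. Ck k \<eta>"
  shows "test_function S (\<lambda>x. \<phi> x * \<eta> x)"
proof -
  obtain K where "compact K" "K \<subseteq> S" "\<And>x. x \<notin> K \<Longrightarrow> \<phi> x = 0"
    using test_functionE[OF assms(1)] by blast
  moreover have "Ck k (\<lambda>x. \<phi> x * \<eta> x)" for k
    by (rule Ck_mult[OF test_functionD(5)[OF assms(1)] assms(2)])
  ultimately show ?thesis by (intro test_functionI[of "\<lambda>x. \<phi> x * \<eta> x" K]) simp_all
qed

lemma test_function_cmult:
  assumes "test_function S \<phi>"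
  shows "test_function S (\<lambda>x. c * \<phi> x)"
  using test_function_mult[OF assms Ck_const[of _ c]] by (simp only: mult.commute[of _ c])

lemma test_function_add:
  assumes "test_function S \<phi>" "test_function S \<eta>"
  shows "test_function S (\<lambda>x. \<phi> x + \<eta> x)"
proof -
  obtain K where "compact K" "K \<subseteq> S" "\<And>x. x \<notin> K \<Longrightarrow> \<phi> x = 0"
    using test_functionE[OF assms(1)] by blast
  moreover obtain L where "compact L" "L \<subseteq> S" "\<And>x. x \<notin> L \<Longrightarrow> \<eta> x = 0"
    using test_functionE[OF assms(2)] by blast
  moreover have "Ck k (\<lambda>x. \<phi> x + \<eta> x)" for k
    by (rule Ck_add[OF assms[THEN test_functionD(5)]])
  ultimately show ?thesis by (intro test_functionI[of "\<lambda>x. \<phi> x + \<eta> x" "K \<union> L"]) auto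
qed

lemma test_function_zero: "test_function S (\<lambda>x. 0)"
  by (rule test_functionI[of _ "{}"]) (auto intro: Ck_const)

lemma test_function_mono: "test_function S \<phi> \<Longrightarrow> S \<subseteq> T \<Longrightarrow> test_function T \<phi>"
  by (auto simp: test_function_def)

text \<open>Zero up to distance \<open>\<delta>\<close> from the end points and one from distance \<open>2 * \<delta>\<close> on: the support stays
  inside the open interval and the slope is of order \<open>1 / \<delta>\<close>.\<close>

definition interval_cutoff :: "real \<Rightarrow> real \<Rightarrow> real \<Rightarrow> real \<Rightarrow> real" where
  "interval_cutoff \<delta> a b s = smooth_step ((s - a) / \<delta> - 1) * smooth_step ((b - s) / \<delta> - 1)"

definition box_cutoff :: "real \<Rightarrow> 'a::euclidean_space \<Rightarrow> 'a \<Rightarrow> 'a \<Rightarrow> real" where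
  "box_cutoff \<delta> a b x = (\<Prod>i\<in>Basis. interval_cutoff \<delta> (a \<bullet> i) (b \<bullet> i) (x \<bullet> i))"

lemma Ck_interval_cutoff: "Ck k (interval_cutoff \<delta> a b)"
proof -
  have "Ck k (\<lambda>s. smooth_step ((- a / \<delta> - 1) + s \<bullet> (1 / \<delta>)) * smooth_step ((b / \<delta> - 1) + s \<bullet> (- 1 / \<delta>)))"
    by (intro Ck_mult Ck_compose[OF Ck_smooth_step] Ck_add Ck_const Ck_inner)
  also have "(\<lambda>s. smooth_step ((- a / \<delta> - 1) + s \<bullet> (1 / \<delta>)) * smooth_step ((b / \<delta> - 1) + s \<bullet> (- 1 / \<delta>)))
     = interval_cutoff \<delta> a b"
    by (simp add: fun_eq_iff interval_cutoff_def diff_divide_distrib algebra_simps)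
  finally show ?thesis .
qed

lemma interval_cutoff_bounds: "0 \<le> interval_cutoff \<delta> a b s" "interval_cutoff \<delta> a b s \<le> 1"
  by (auto simp: interval_cutoff_def smooth_step_bounds mult_le_one)

lemma interval_cutoff_eq_0:
  assumes "0 < \<delta>" "s \<le> a + \<delta> \<or> b - \<delta> \<le> s"
  shows "interval_cutoff \<delta> a b s = 0"
proof -
  have "(s - a) / \<delta> \<le> 1 \<or> (b - s) / \<delta> \<le> 1" using assms by (auto simp: divide_le_eq)
  then show ?thesis unfolding interval_cutoff_def by (auto simp: smooth_step_eq_0)
qed

lemma interval_cutoff_eq_1:
  assumes "0 < \<delta>" "a + 2 * \<delta> \<le> s" "s \<le> b - 2 * \<delta>"
  shows "interval_cutoff \<delta> a b s = 1"
proof -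
  have "2 \<le> (s - a) / \<delta>" "2 \<le> (b - s) / \<delta>" using assms by (auto simp: le_divide_eq)
  then show ?thesis unfolding interval_cutoff_def by (auto simp: smooth_step_eq_1)
qed

lemma Ck_box_cutoff: "Ck k (box_cutoff \<delta> a b)"
  unfolding box_cutoff_def
  by (intro Ck_prod ballI Ck_compose[OF Ck_interval_cutoff] Ck_inner) auto

lemma box_cutoff_bounds: "0 \<le> box_cutoff \<delta> a b x" "box_cutoff \<delta> a b x \<le> 1"
  by (auto simp: box_cutoff_def interval_cutoff_bounds intro!: prod_nonneg prod_le_1)

lemma box_cutoff_eq_0:
  assumes "0 < \<delta>" "i \<in> Basis" "x \<bullet> i \<le> a \<bullet> i + \<delta> \<or> b \<bullet> i - \<delta> \<le> x \<bullet> i"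
  shows "box_cutoff \<delta> a b x = 0"
proof -
  have "interval_cutoff \<delta> (a \<bullet> i) (b \<bullet> i) (x \<bullet> i) = 0" using assms by (intro interval_cutoff_eq_0)
  then show ?thesis using assms(2) by (auto simp: box_cutoff_def)
qed

lemma box_cutoff_eq_1:
  assumes "0 < \<delta>" "\<And>i. i \<in> Basis \<Longrightarrow> a \<bullet> i + 2 * \<delta> \<le> x \<bullet> i \<and> x \<bullet> i \<le> b \<bullet> i - 2 * \<delta>"
  shows "box_cutoff \<delta> a b x = 1"
  using assms interval_cutoff_eq_1 unfolding box_cutoff_def by (intro prod.neutral) auto

lemma test_function_box_cutoff:
  assumes "0 < \<delta>"
  shows "test_function (box a b) (box_cutoff \<delta> a b)"
proof (rule test_functionI[OF Ck_box_cutoff compact_cbox[of "a + \<delta> *\<^sub>R One" "b - \<delta> *\<^sub>R One"]])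
  show "cbox (a + \<delta> *\<^sub>R One) (b - \<delta> *\<^sub>R One) \<subseteq> box a b"
    using assms by (force simp: mem_box inner_simps)
next
  fix x assume "x \<notin> cbox (a + \<delta> *\<^sub>R One) (b - \<delta> *\<^sub>R One)"
  then obtain i where "i \<in> Basis" "x \<bullet> i < a \<bullet> i + \<delta> \<or> b \<bullet> i - \<delta> < x \<bullet> i"
    by (force simp: mem_box inner_simps)
  then show "box_cutoff \<delta> a b x = 0" using assms by (intro box_cutoff_eq_0) auto
qed


section \<open>Square-integrable functions\<close>

lemma norm_add_sq_le: "(norm (x + y :: 'a::real_inner))\<^sup>2 \<le> 2 * (norm x)\<^sup>2 + 2 * (norm y)\<^sup>2"
proof -
  have "0 \<le> (norm (x - y))\<^sup>2" by simp
  then show ?thesis by (simp add: power2_norm_eq_inner inner_add inner_diff inner_commute)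
qed

lemma two_inner_le:
  fixes x y :: "'a::real_inner"
  assumes "0 < t"
  shows "2 * (x \<bullet> y) \<le> t * (norm x)\<^sup>2 + (norm y)\<^sup>2 / t"
proof -
  define s where "s = sqrt t"
  have s: "0 < s" "t = s\<^sup>2" using assms by (auto simp: s_def)
  have "0 \<le> (norm (s *\<^sub>R x - (1 / s) *\<^sub>R y))\<^sup>2" by simp
  also have "\<dots> = s\<^sup>2 * (norm x)\<^sup>2 - 2 * (x \<bullet> y) + (norm y)\<^sup>2 / s\<^sup>2"
    unfolding power2_norm_eq_inner using s(1)
    by (simp add: inner_diff inner_commute[of y x] power2_eq_square right_diff_distrib diff_divide_distrib)
  finally show ?thesis unfolding s(2) by simp
qed

lemma L2_norm_sq: "(L2_norm S f)\<^sup>2 = (\<integral>x. (norm (f x))\<^sup>2 \<partial>lebesgue_on S)"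
  by (simp add: L2_norm_def)

text \<open>This weak form of the triangle inequality is all that convergence proofs need, and it stays within
  squared norms, which are integrals.\<close>

lemma sq_integrable_add:
  assumes "sq_integrable S f" "sq_integrable S g"
  shows "sq_integrable S (\<lambda>x. f x + g x)"
    and "(L2_norm S (\<lambda>x. f x + g x))\<^sup>2 \<le> 2 * (L2_norm S f)\<^sup>2 + 2 * (L2_norm S g)\<^sup>2"
proof -
  have [measurable]: "f \<in> borel_measurable (lebesgue_on S)" "g \<in> borel_measurable (lebesgue_on S)"
    and i: "integrable (lebesgue_on S) (\<lambda>x. 2 * (norm (f x))\<^sup>2 + 2 * (norm (g x))\<^sup>2)"
    using assms by (auto simp: sq_integrable_def)
  have j: "integrable (lebesgue_on S) (\<lambda>x. (norm (f x + g x))\<^sup>2)"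
    by (rule Bochner_Integration.integrable_bound[OF i]) (auto intro!: AE_I2 norm_add_sq_le)
  then show "sq_integrable S (\<lambda>x. f x + g x)" by (simp add: sq_integrable_def)
  show "(L2_norm S (\<lambda>x. f x + g x))\<^sup>2 \<le> 2 * (L2_norm S f)\<^sup>2 + 2 * (L2_norm S g)\<^sup>2"
    using integral_mono[OF j i] assms by (simp add: L2_norm_sq norm_add_sq_le sq_integrable_def)
qed

lemma sq_integrable_scaleR:
  assumes "sq_integrable S f"
  shows "sq_integrable S (\<lambda>x. c *\<^sub>R f x)" "(L2_norm S (\<lambda>x. c *\<^sub>R f x))\<^sup>2 = c\<^sup>2 * (L2_norm S f)\<^sup>2"
  using assms by (auto simp: sq_integrable_def L2_norm_sq power_mult_distrib)

lemma sq_integrable_diff: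
  assumes "sq_integrable S f" "sq_integrable S g"
  shows "sq_integrable S (\<lambda>x. f x - g x)"
    and "(L2_norm S (\<lambda>x. f x - g x))\<^sup>2 \<le> 2 * (L2_norm S f)\<^sup>2 + 2 * (L2_norm S g)\<^sup>2"
  using sq_integrable_add[OF assms(1) sq_integrable_scaleR(1)[OF assms(2), of "-1"]]
    sq_integrable_scaleR(2)[OF assms(2), of "-1"] by auto

lemma integrable_inner_L2:
  assumes "sq_integrable S f" "sq_integrable S g"
  shows "integrable (lebesgue_on S) (\<lambda>x. f x \<bullet> g x)"
proof (rule Bochner_Integration.integrable_bound)
  show "integrable (lebesgue_on S) (\<lambda>x. (norm (f x))\<^sup>2 + (norm (g x))\<^sup>2)"
    using assms by (simp add: sq_integrable_def)
  show "(\<lambda>x. f x \<bullet> g x) \<in> borel_measurable (lebesgue_on S)"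
    using assms by (auto simp: sq_integrable_def)
  have "norm (f x \<bullet> g x) \<le> norm ((norm (f x))\<^sup>2 + (norm (g x))\<^sup>2)" for x
  proof -
    have "\<bar>f x \<bullet> g x\<bar> \<le> norm (f x) * norm (g x)" by (rule Cauchy_Schwarz_ineq2)
    also have "2 * (norm (f x) * norm (g x)) \<le> (norm (f x))\<^sup>2 + (norm (g x))\<^sup>2"
      using sum_squares_bound[of "norm (f x)" "norm (g x)"] by simp
    finally show ?thesis by simp
  qed
  then show "AE x in lebesgue_on S. norm (f x \<bullet> g x) \<le> norm ((norm (f x))\<^sup>2 + (norm (g x))\<^sup>2)" by simp
qed

text \<open>Young's inequality. The free weight \<open>t\<close> is chosen in the main estimate so that the second term is
  absorbed by the energy.\<close>

lemma integral_two_inner_le: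
  assumes "sq_integrable S f" "sq_integrable S g" "0 < t"
  shows "2 * (\<integral>x. f x \<bullet> g x \<partial>lebesgue_on S) \<le> t * (L2_norm S f)\<^sup>2 + (L2_norm S g)\<^sup>2 / t"
proof -
  have "(\<integral>x. 2 * (f x \<bullet> g x) \<partial>lebesgue_on S) \<le> (\<integral>x. t * (norm (f x))\<^sup>2 + (norm (g x))\<^sup>2 / t \<partial>lebesgue_on S)"
    using assms by (intro integral_mono two_inner_le integrable_mult_right integrable_inner_L2
        Bochner_Integration.integrable_add integrable_divide) (auto simp: sq_integrable_def)
  then show ?thesis using assms by (simp add: L2_norm_sq sq_integrable_def)
qed

lemma integrable_lebesgue_on_subset:
  fixes f :: "'a::euclidean_space \<Rightarrow> 'b::euclidean_space"
  assumes "integrable (lebesgue_on S) f" "T \<subseteq> S" "S \<in> sets lebesgue" "T \<in> sets lebesgue"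
  shows "integrable (lebesgue_on T) f"
proof -
  have "integrable lebesgue (\<lambda>x. indicator T x *\<^sub>R (if x \<in> S then f x else 0))"
    using assms Lebesgue_Measure.integrable_restrict_UNIV[of S f] by (intro integrable_mult_indicator) auto
  also have "(\<lambda>x. indicator T x *\<^sub>R (if x \<in> S then f x else 0)) = (\<lambda>x. if x \<in> T then f x else 0)"
    using assms by (auto simp: indicator_def fun_eq_iff)
  finally show ?thesis using assms by (simp add: Lebesgue_Measure.integrable_restrict_UNIV)
qed

lemma AE_lebesgue_on_subset:
  assumes "AE x in lebesgue_on S. P x" "T \<subseteq> S" "S \<in> sets lebesgue" "T \<in> sets lebesgue"
  shows "AE x in lebesgue_on T. P x"
proof -
  have "AE x in lebesgue. x \<in> S \<longrightarrow> P x" using assms by (simp add: AE_restrict_space_iff)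
  then have "AE x in lebesgue. x \<in> T \<longrightarrow> P x" by eventually_elim (use assms in auto)
  then show ?thesis using assms by (simp add: AE_restrict_space_iff)
qed

lemma sq_integrable_subset:
  assumes "sq_integrable S f" "T \<subseteq> S" "S \<in> sets lebesgue" "T \<in> sets lebesgue"
  shows "sq_integrable T f" "(L2_norm T f)\<^sup>2 \<le> (L2_norm S f)\<^sup>2"
proof -
  show "sq_integrable T f"
    using integrable_lebesgue_on_subset[OF _ assms(2-4)] measurable_restrict_mono[OF _ assms(2)] assms(1)
    unfolding sq_integrable_def by blast
  show "(L2_norm T f)\<^sup>2 \<le> (L2_norm S f)\<^sup>2"
    unfolding L2_norm_sq using assms by (intro integral_mono_lebesgue_on_AE) (auto simp: sq_integrable_def)
qed

lemma sq_integrable_bounded_scaleR: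
  assumes "sq_integrable S f" "c \<in> borel_measurable (lebesgue_on S)" "AE x in lebesgue_on S. \<bar>c x\<bar> \<le> M"
  shows "sq_integrable S (\<lambda>x. c x *\<^sub>R f x)" "(L2_norm S (\<lambda>x. c x *\<^sub>R f x))\<^sup>2 \<le> M\<^sup>2 * (L2_norm S f)\<^sup>2"
proof -
  have i: "integrable (lebesgue_on S) (\<lambda>x. M\<^sup>2 * (norm (f x))\<^sup>2)"
    using assms by (simp add: sq_integrable_def)
  have b: "AE x in lebesgue_on S. (norm (c x *\<^sub>R f x))\<^sup>2 \<le> M\<^sup>2 * (norm (f x))\<^sup>2"
    using assms(3) by eventually_elim (auto simp: power_mult_distrib abs_le_square_iff[symmetric] intro!: mult_right_mono)
  have m: "(\<lambda>x. c x *\<^sub>R f x) \<in> borel_measurable (lebesgue_on S)"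
    using assms by (auto simp: sq_integrable_def)
  have j: "integrable (lebesgue_on S) (\<lambda>x. (norm (c x *\<^sub>R f x))\<^sup>2)"
  proof (rule Bochner_Integration.integrable_bound[OF i])
    show "(\<lambda>x. (norm (c x *\<^sub>R f x))\<^sup>2) \<in> borel_measurable (lebesgue_on S)"
      by (intro borel_measurable_power measurable_compose[OF m borel_measurable_norm])
    show "AE x in lebesgue_on S. norm ((norm (c x *\<^sub>R f x))\<^sup>2) \<le> norm (M\<^sup>2 * (norm (f x))\<^sup>2)"
      using b by eventually_elim simp
  qed
  show "sq_integrable S (\<lambda>x. c x *\<^sub>R f x)" using m j unfolding sq_integrable_def by blast
  show "(L2_norm S (\<lambda>x. c x *\<^sub>R f x))\<^sup>2 \<le> M\<^sup>2 * (L2_norm S f)\<^sup>2"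
    using integral_mono_AE[OF j i b] by (simp add: L2_norm_sq)
qed

lemma sq_integrable_continuous:
  fixes f :: "'a::euclidean_space \<Rightarrow> 'b::euclidean_space"
  assumes "continuous_on UNIV f" "bounded S" "S \<in> sets lebesgue"
  shows "sq_integrable S f"
proof -
  obtain a b where S: "S \<subseteq> cbox a b" using assms(2) bounded_subset_cbox_symmetric by blast
  have "integrable (lebesgue_on (cbox a b)) (\<lambda>x. (norm (f x))\<^sup>2)"
    using assms(1) by (intro continuous_imp_integrable continuous_intros) (auto intro: continuous_on_subset)
  then have "integrable (lebesgue_on S) (\<lambda>x. (norm (f x))\<^sup>2)"
    by (rule integrable_lebesgue_on_subset[OF _ S _ assms(3)]) simp
  moreover have "f \<in> borel_measurable (lebesgue_on S)"
    using assms by (intro continuous_imp_measurable_on_sets_lebesgue) (auto intro: continuous_on_subset)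
  ultimately show ?thesis
    unfolding sq_integrable_def by blast
qed

lemma sq_integrable_imp_integrable:
  fixes f :: "'a::euclidean_space \<Rightarrow> 'b::euclidean_space"
  assumes "sq_integrable S f" "bounded S" "S \<in> sets lebesgue"
  shows "integrable (lebesgue_on S) f"
proof (rule Bochner_Integration.integrable_bound)
  have "sq_integrable S (\<lambda>x. 1::real)" using assms by (intro sq_integrable_continuous) auto
  then show "integrable (lebesgue_on S) (\<lambda>x. 1 + (norm (f x))\<^sup>2)"
    using assms(1) by (simp add: sq_integrable_def)
  show "f \<in> borel_measurable (lebesgue_on S)" using assms by (simp add: sq_integrable_def)
  have "norm (f x) \<le> 1 + (norm (f x))\<^sup>2" for x
    using sum_squares_bound[of 1 "norm (f x)"] zero_le_power2[of "norm (f x)"] norm_ge_zero[of "f x"]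
    unfolding power_one by linarith
  then show "AE x in lebesgue_on S. norm (f x) \<le> norm (1 + (norm (f x))\<^sup>2)" by simp
qed

lemma L2_norm_cong_AE:
  assumes "AE x in lebesgue_on S. f x = g x" "sq_integrable S f" "sq_integrable S g"
  shows "L2_norm S f = L2_norm S g"
  unfolding L2_norm_def using assms by (intro arg_cong[where f = sqrt] integral_cong_AE) (auto simp: sq_integrable_def)

section \<open>Integration by parts\<close>

lemma GDERIV_along_line:
  assumes "GDERIV f (x + t *\<^sub>R v) :> g"
  shows "((\<lambda>t. f (x + t *\<^sub>R v)) has_real_derivative (g \<bullet> v)) (at t)"
proof -
  have "((\<lambda>t. f (x + t *\<^sub>R v)) has_derivative (\<lambda>s. (s *\<^sub>R v) \<bullet> g)) (at t)"
    using assms unfolding gderiv_def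
    by (intro has_derivative_compose[of "\<lambda>t. x + t *\<^sub>R v" _ _ _ f]) (auto intro!: derivative_eq_intros)
  also have "(\<lambda>s. (s *\<^sub>R v) \<bullet> g) = (*) (g \<bullet> v)"
    by (auto simp: inner_commute mult.commute)
  finally show ?thesis by (simp add: has_field_derivative_def)
qed

lemma integrable_compact_support:
  fixes f :: "'a::euclidean_space \<Rightarrow> 'b::euclidean_space"
  assumes "continuous_on UNIV f" "compact K" "\<And>x. x \<notin> K \<Longrightarrow> f x = 0"
  shows "integrable lborel f"
proof -
  have "integrable lborel (\<lambda>x. indicator K x *\<^sub>R f x)"
    using assms by (intro borel_integrable_compact) (auto intro: continuous_on_subset)
  also have "(\<lambda>x. indicator K x *\<^sub>R f x) = f"
    using assms(3) by (auto simp: indicator_def fun_eq_iff)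
  finally show ?thesis .
qed

text \<open>By translation invariance the difference quotients of \<open>f\<close> in direction \<open>v\<close> have integral zero. They are
  bounded and live on a common ball, so dominated convergence passes this on to the derivative.\<close>

lemma integral_directional_derivative_eq_0:
  fixes f :: "'a::euclidean_space \<Rightarrow> real"
  assumes der: "\<And>x. GDERIV f x :> g x" and cont: "continuous_on UNIV g"
    and K: "compact K" "\<And>x. x \<notin> K \<Longrightarrow> f x = 0"
  shows "(\<integral>x. g x \<bullet> v \<partial>lborel) = 0"
proof -
  have cf: "continuous_on UNIV f"
    using der by (intro has_derivative_continuous_on[where f' = "\<lambda>x h. h \<bullet> g x"]) (auto simp: gderiv_def)
  have int_f: "integrable lborel f" using integrable_compact_support[OF cf K] .
  obtain R where R: "K \<subseteq> cball 0 R"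
    using compact_imp_bounded[OF K(1)] unfolding bounded_iff by (auto simp: subset_iff)
  have "compact ((\<lambda>x. g x \<bullet> v) ` cball 0 (R + 2 * norm v))"
    using cont by (intro compact_continuous_image continuous_intros) (auto intro: continuous_on_subset)
  then obtain M where M: "\<forall>x\<in>cball 0 (R + 2 * norm v). \<bar>g x \<bullet> v\<bar> \<le> M"
    unfolding compact_eq_bounded_closed bounded_iff by auto
  define h where "h n = inverse (real (Suc n))" for n
  have h: "0 < h n" "h n \<le> 1" for n by (auto simp: h_def divide_simps)
  define q where "q n x = (f (x + h n *\<^sub>R v) - f x) / h n" for n x
  \<comment> \<open>as \<open>h n \<le> 1\<close>, the quotient is zero off the ball of radius \<open>R + norm v\<close>; on it the mean value
    theorem evaluates \<open>g\<close> at distance at most \<open>R + 2 * norm v\<close> from the origin\<close>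
  have bound: "norm (q n x) \<le> M * indicator (cball 0 (R + norm v)) x" for n x
  proof (cases "x \<in> cball 0 (R + norm v)")
    case True
    have "\<exists>z>0. z < h n \<and> f (x + h n *\<^sub>R v) - f (x + 0 *\<^sub>R v) = (h n - 0) * (g (x + z *\<^sub>R v) \<bullet> v)"
      using h der by (intro MVT2 GDERIV_along_line) auto
    then obtain z where z: "0 < z" "z < h n" "q n x = g (x + z *\<^sub>R v) \<bullet> v"
      using h[of n] by (auto simp: q_def)
    have "norm (z *\<^sub>R v) \<le> norm v" using z h[of n] by (simp add: mult_left_le_one_le)
    then have "x + z *\<^sub>R v \<in> cball 0 (R + 2 * norm v)"
      using True norm_triangle_ineq[of x "z *\<^sub>R v"] by simp
    then show ?thesis using M z True by simp
  next
    case False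
    have "norm (h n *\<^sub>R v) \<le> norm v" using h[of n] by (simp add: mult_left_le_one_le)
    moreover have "R + norm v < norm x" using False by simp
    ultimately have "R < norm x" "R < norm (x + h n *\<^sub>R v)"
      using norm_diff_ineq[of x "h n *\<^sub>R v"] norm_ge_zero[of v] by linarith+
    then have "x \<notin> cball 0 R" "x + h n *\<^sub>R v \<notin> cball 0 R" by simp_all
    then have "x \<notin> K" "x + h n *\<^sub>R v \<notin> K" using R by auto
    then show ?thesis using False K(2) by (simp add: q_def)
  qed
  have lim: "(\<lambda>n. q n x) \<longlonglongrightarrow> g x \<bullet> v" for x
  proof -
    have "((\<lambda>t. f (x + t *\<^sub>R v)) has_real_derivative (g (x + 0 *\<^sub>R v) \<bullet> v)) (at 0)"
      using der by (intro GDERIV_along_line)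
    then have "((\<lambda>t. (f (x + t *\<^sub>R v) - f x) / t) \<longlongrightarrow> g x \<bullet> v) (at 0)"
      by (simp add: DERIV_def)
    moreover have "filterlim h (at 0) sequentially"
    proof -
      have "h \<longlonglongrightarrow> 0" unfolding h_def by (rule LIMSEQ_inverse_real_of_nat)
      moreover have "h n \<noteq> 0" for n using h(1)[of n] by simp
      ultimately show ?thesis by (simp add: filterlim_at)
    qed
    ultimately show ?thesis unfolding q_def by (rule filterlim_compose)
  qed
  have shift: "integrable lborel (\<lambda>x. f (x + c))" "(\<integral>x. f (x + c) \<partial>lborel) = (\<integral>x. f x \<partial>lborel)" for c
  proof -
    have d: "distr lborel borel (\<lambda>x. x + c) = lborel"
    proof -
      have "(+) c = (\<lambda>x. x + c)" by (simp add: fun_eq_iff add.commute)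
      then show ?thesis using lborel_distr_plus[of c] by (simp only:)
    qed
    have "integrable (distr lborel borel (\<lambda>x. x + c)) f" using int_f unfolding d .
    then show "integrable lborel (\<lambda>x. f (x + c))" by (subst (asm) integrable_distr_eq) (use int_f in auto)
    show "(\<integral>x. f (x + c) \<partial>lborel) = (\<integral>x. f x \<partial>lborel)"
      using integral_distr[of "\<lambda>x. x + c" lborel borel f] int_f unfolding d by simp
  qed
  have int_q: "(\<integral>x. q n x \<partial>lborel) = 0" for n
    using shift int_f by (simp add: q_def)
  have "(\<lambda>n. \<integral>x. q n x \<partial>lborel) \<longlonglongrightarrow> (\<integral>x. g x \<bullet> v \<partial>lborel)"
  proof (rule integral_dominated_convergence)
    show "(\<lambda>x. g x \<bullet> v) \<in> borel_measurable lborel"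
      using cont by (auto intro!: borel_measurable_continuous_onI continuous_intros)
    show "q n \<in> borel_measurable lborel" for n
      unfolding q_def using shift(1) int_f by measurable
    show "integrable lborel (\<lambda>x. M * indicator (cball 0 (R + norm v)) x)"
      by (intro integrable_mult_right integrable_real_indicator) (simp_all add: emeasure_bounded_finite[unfolded infinity_ennreal_def])
    show "AE x in lborel. (\<lambda>n. q n x) \<longlonglongrightarrow> g x \<bullet> v" using lim by simp
    show "AE x in lborel. norm (q n x) \<le> M * indicator (cball 0 (R + norm v)) x" for n using bound by simp
  qed
  then show ?thesis unfolding int_q by (simp add: LIMSEQ_const_iff)
qed

lemma grad_eq_0_outside:
  assumes "closed K" "\<And>x. x \<notin> K \<Longrightarrow> f x = 0" "x \<notin> K"
  shows "grad f x = 0"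
proof -
  have "(f has_derivative (\<lambda>h. 0)) (at x)"
    by (rule has_derivative_transform_within_open[OF has_derivative_const[of 0], where s = "- K"]) (use assms in auto)
  then have "GDERIV f x :> 0" by (simp add: gderiv_def)
  then show ?thesis by (rule grad_eqI)
qed

lemma test_function_grad_eq_0:
  assumes "test_function S \<phi>" "x \<notin> S"
  shows "grad \<phi> x = 0"
proof -
  obtain K where "compact K" "K \<subseteq> S" "\<And>x. x \<notin> K \<Longrightarrow> \<phi> x = 0" using test_functionE[OF assms(1)] by blast
  then show ?thesis using assms(2) by (intro grad_eq_0_outside[of K]) (auto intro: compact_imp_closed)
qed

lemma integral_lebesgue_on_support:
  fixes f :: "'a::euclidean_space \<Rightarrow> 'b::euclidean_space"
  assumes "S \<in> sets lebesgue" "\<And>x. x \<notin> S \<Longrightarrow> f x = 0"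
  shows "integral\<^sup>L (lebesgue_on S) f = integral\<^sup>L lebesgue f"
proof -
  have "(\<lambda>x. if x \<in> S then f x else 0) = f" using assms(2) by auto
  then show ?thesis using Lebesgue_Measure.integral_restrict_UNIV[OF assms(1), of f] by simp
qed

lemma grad_mult:
  assumes "\<And>k. Ck k f" "\<And>k. Ck k g"
  shows "grad (\<lambda>x. f x * g x) x = f x *\<^sub>R grad g x + g x *\<^sub>R grad f x"
  using assms by (intro grad_eqI GDERIV_mult Ck_imp_GDERIV)

lemma grad_add:
  assumes "\<And>k. Ck k f" "\<And>k. Ck k g"
  shows "grad (\<lambda>x. f x + g x) x = grad f x + grad g x"
  using assms by (intro grad_eqI GDERIV_add Ck_imp_GDERIV)

lemma grad_cmult:
  assumes "\<And>k. Ck k f"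
  shows "grad (\<lambda>x. c * f x) x = c *\<^sub>R grad f x"
proof -
  have "grad (\<lambda>x. c) x = 0" by (intro grad_eqI GDERIV_const)
  then show ?thesis using grad_mult[OF Ck_const[of _ c] assms, of x] by simp
qed

lemma has_weak_gradient_iff:
  "has_weak_gradient S u g \<longleftrightarrow>
     (\<forall>\<phi>. test_function S \<phi> \<longrightarrow>
        (\<integral>x. u x *\<^sub>R grad \<phi> x \<partial>lebesgue_on S) = - (\<integral>x. \<phi> x *\<^sub>R g x \<partial>lebesgue_on S))"
proof -
  have "(\<forall>x. GDERIV \<phi> x :> d\<phi> x) \<longleftrightarrow> d\<phi> = grad \<phi>" if "test_function S \<phi>" for \<phi> d\<phi>
    using test_functionD(1)[OF that] GDERIV_unique[of \<phi>] by blast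
  then show ?thesis unfolding has_weak_gradient_def by metis
qed

text \<open>Integration by parts: the sum of both integrands is the gradient of \<open>\<eta> * \<phi>\<close>, a function with compact
  support in \<open>S\<close>.\<close>

lemma has_weak_gradient_smooth:
  assumes eta: "\<And>k. Ck k \<eta>" and S: "bounded S" "S \<in> sets lebesgue"
  shows "has_weak_gradient S \<eta> (grad \<eta>)"
  unfolding has_weak_gradient_iff
proof (intro allI impI)
  fix \<phi> assume phi: "test_function S \<phi>"
  obtain K where K: "compact K" "K \<subseteq> S" "\<And>x. x \<notin> K \<Longrightarrow> \<phi> x = 0" using test_functionE[OF phi] by blast
  note C = test_functionD(5)[OF phi]
  have CC: "Ck k (\<lambda>x. \<eta> x * \<phi> x)" for k using eta C by (rule Ck_mult)
  have ce: "continuous_on UNIV \<eta>" using eta[of 0] by simp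
  have G: "grad (\<lambda>x. \<eta> x * \<phi> x) x = \<eta> x *\<^sub>R grad \<phi> x + \<phi> x *\<^sub>R grad \<eta> x" for x
    by (rule grad_mult[OF eta C])
  have z: "grad (\<lambda>x. \<eta> x * \<phi> x) x = 0" if "x \<notin> K" for x
    using that K by (intro grad_eq_0_outside[of K]) (auto intro: compact_imp_closed)
  have I1: "integrable (lebesgue_on S) (\<lambda>x. \<eta> x *\<^sub>R grad \<phi> x)"
    and I2: "integrable (lebesgue_on S) (\<lambda>x. \<phi> x *\<^sub>R grad \<eta> x)"
    using S ce continuous_grad[OF eta] test_functionD[OF phi]
    by (auto intro!: sq_integrable_imp_integrable sq_integrable_continuous continuous_intros)
  have int: "integrable lborel (grad (\<lambda>x. \<eta> x * \<phi> x))"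
    by (rule integrable_compact_support[OF continuous_grad[OF CC] K(1) z])
  have "(\<integral>x. \<eta> x *\<^sub>R grad \<phi> x \<partial>lebesgue_on S) + (\<integral>x. \<phi> x *\<^sub>R grad \<eta> x \<partial>lebesgue_on S)
      = (\<integral>x. grad (\<lambda>x. \<eta> x * \<phi> x) x \<partial>lebesgue_on S)"
    using I1 I2 by (simp add: G)
  also have "\<dots> = (\<integral>x. grad (\<lambda>x. \<eta> x * \<phi> x) x \<partial>lebesgue)"
    using z K(2) S(2) by (intro integral_lebesgue_on_support) auto
  also have "\<dots> = (\<integral>x. grad (\<lambda>x. \<eta> x * \<phi> x) x \<partial>lborel)"
    using int by (intro integral_completion) auto
  also have "\<dots> = 0"
  proof (rule euclidean_eqI)
    fix b :: 'a
    have "(\<integral>x. grad (\<lambda>x. \<eta> x * \<phi> x) x \<partial>lborel) \<bullet> b = (\<integral>x. grad (\<lambda>x. \<eta> x * \<phi> x) x \<bullet> b \<partial>lborel)"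
      using int by simp
    also have "\<dots> = 0"
      using integral_directional_derivative_eq_0[OF Ck_imp_GDERIV[OF CC] continuous_grad[OF CC] K(1)] K(3) by simp
    finally show "(\<integral>x. grad (\<lambda>x. \<eta> x * \<phi> x) x \<partial>lborel) \<bullet> b = 0 \<bullet> b" by simp
  qed
  finally show "(\<integral>x. \<eta> x *\<^sub>R grad \<phi> x \<partial>lebesgue_on S) = - (\<integral>x. \<phi> x *\<^sub>R grad \<eta> x \<partial>lebesgue_on S)"
    by (simp add: eq_neg_iff_add_eq_0)
qed


section \<open>Weak gradients\<close>

lemma open_in_sets_lebesgue: "open S \<Longrightarrow> S \<in> sets lebesgue"
  by (metis borel_open sets_completionI_sets sets_lborel)

text \<open>Cutoffs of the box with margins \<open>1 / (n + 1)\<close> are test functions and converge boundedly to its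
  indicator function.\<close>

lemma integral_box_eq_0_of_test_functions:
  fixes h :: "'a::euclidean_space \<Rightarrow> 'b::euclidean_space"
  assumes h: "integrable (lebesgue_on S) h" and S: "S \<in> sets lebesgue"
    and zero: "\<And>\<phi>. test_function S \<phi> \<Longrightarrow> (\<integral>x. \<phi> x *\<^sub>R h x \<partial>lebesgue_on S) = 0"
    and sub: "box a b \<subseteq> S"
  shows "integral (cbox a b) h = 0"
proof -
  define d where "d n = inverse (real (Suc n))" for n
  have d: "0 < d n" for n by (simp add: d_def)
  have d0: "d \<longlonglongrightarrow> 0" unfolding d_def by (rule LIMSEQ_inverse_real_of_nat)
  define \<phi> where "\<phi> n = box_cutoff (d n) a b" for n
  have test: "test_function S (\<phi> n)" for n
    unfolding \<phi>_def using test_function_mono[OF test_function_box_cutoff[OF d] sub] .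
  have lim: "(\<lambda>n. \<phi> n x) \<longlonglongrightarrow> indicator (box a b) x" for x
  proof (cases "x \<in> box a b")
    case True
    have "\<forall>\<^sub>F n in sequentially. a \<bullet> i + 2 * d n \<le> x \<bullet> i \<and> x \<bullet> i \<le> b \<bullet> i - 2 * d n" if "i \<in> Basis" for i
    proof -
      have "(\<lambda>n. a \<bullet> i + 2 * d n) \<longlonglongrightarrow> a \<bullet> i + 2 * 0" and
        "(\<lambda>n. b \<bullet> i - 2 * d n) \<longlonglongrightarrow> b \<bullet> i - 2 * 0"
        by (intro tendsto_intros d0)+
      moreover have "a \<bullet> i + 2 * 0 < x \<bullet> i" and "x \<bullet> i < b \<bullet> i - 2 * 0"
        using True that by (simp_all add: mem_box)
      ultimately have "\<forall>\<^sub>F n in sequentially. a \<bullet> i + 2 * d n < x \<bullet> i" and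
          "\<forall>\<^sub>F n in sequentially. x \<bullet> i < b \<bullet> i - 2 * d n"
        using order_tendstoD by metis+
      then show ?thesis by eventually_elim simp
    qed
    then have "\<forall>\<^sub>F n in sequentially. \<forall>i\<in>Basis. a \<bullet> i + 2 * d n \<le> x \<bullet> i \<and> x \<bullet> i \<le> b \<bullet> i - 2 * d n"
      by (intro eventually_ball_finite) auto
    then have "\<forall>\<^sub>F n in sequentially. \<phi> n x = indicator (box a b) x"
    proof eventually_elim
      case (elim n)
      then have "box_cutoff (d n) a b x = 1" using d by (intro box_cutoff_eq_1) auto
      then show ?case using True by (simp add: \<phi>_def)
    qed
    then show ?thesis by (rule tendsto_eventually)
  next
    case False
    then have "\<phi> n x = 0" for n
      using test_functionD(4)[OF test_function_box_cutoff[OF d]] by (auto simp: \<phi>_def)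
    then show ?thesis using False by simp
  qed
  have "(\<lambda>n. \<integral>x. \<phi> n x *\<^sub>R h x \<partial>lebesgue_on S) \<longlonglongrightarrow> (\<integral>x. indicator (box a b) x *\<^sub>R h x \<partial>lebesgue_on S)"
  proof (rule integral_dominated_convergence[where w = "\<lambda>x. norm (h x)"])
    have hm [measurable]: "h \<in> borel_measurable (lebesgue_on S)" using h by (rule borel_measurable_integrable)
    have "box a b \<in> sets (lebesgue_on S)" using sub S by (simp add: sets_restrict_space_iff)
    then show "(\<lambda>x. indicator (box a b) x *\<^sub>R h x) \<in> borel_measurable (lebesgue_on S)" by measurable
    show "(\<lambda>x. \<phi> n x *\<^sub>R h x) \<in> borel_measurable (lebesgue_on S)" for n
    proof (rule borel_measurable_scaleR[OF _ hm])
      show "\<phi> n \<in> borel_measurable (lebesgue_on S)"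
        using test_functionD(3)[OF test] S
        by (intro continuous_imp_measurable_on_sets_lebesgue) (auto intro: continuous_on_subset)
    qed
    show "integrable (lebesgue_on S) (\<lambda>x. norm (h x))" using h by (rule integrable_norm)
    show "AE x in lebesgue_on S. (\<lambda>n. \<phi> n x *\<^sub>R h x) \<longlonglongrightarrow> indicator (box a b) x *\<^sub>R h x"
      using lim by (intro AE_I2 tendsto_scaleR) auto
    show "AE x in lebesgue_on S. norm (\<phi> n x *\<^sub>R h x) \<le> norm (h x)" for n
      using box_cutoff_bounds[of "d n" a b] by (intro AE_I2) (auto simp: \<phi>_def mult_left_le_one_le)
  qed
  then have "(\<integral>x. indicator (box a b) x *\<^sub>R h x \<partial>lebesgue_on S) = 0"
    unfolding zero[OF test] by (simp add: LIMSEQ_const_iff)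
  then have "(\<integral>x. h x \<partial>lebesgue_on (box a b)) = 0"
    using integral_restrict[OF sub, of h] S by (simp add: indicator_scaleR_eq_if)
  then have "integral (box a b) h = 0"
    using lebesgue_integral_eq_integral[OF integrable_lebesgue_on_subset[OF h sub S]] by simp
  then show ?thesis by (simp add: integral_open_interval)
qed

text \<open>The fundamental lemma of the calculus of variations. All cubes inside \<open>S\<close> have integral zero, and at
  almost every point the function is the limit of its mean values over small cubes.\<close>

lemma AE_eq_0_of_test_functions:
  fixes h :: "'a::euclidean_space \<Rightarrow> 'b::euclidean_space"
  assumes h: "integrable (lebesgue_on S) h" and S: "open S"
    and zero: "\<And>\<phi>. test_function S \<phi> \<Longrightarrow> (\<integral>x. \<phi> x *\<^sub>R h x \<partial>lebesgue_on S) = 0"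
  shows "AE x in lebesgue_on S. h x = 0"
proof -
  have S': "S \<in> sets lebesgue" by (rule open_in_sets_lebesgue[OF S])
  define f where "f x = (if x \<in> S then h x else 0)" for x
  have f: "integrable lebesgue f"
    using h S' unfolding f_def by (simp add: Lebesgue_Measure.integrable_restrict_UNIV)
  have "f integrable_on cbox a b" for a b
    using integrable_on_lebesgue[OF f] by (rule integrable_on_subcbox) auto
  then obtain N where N: "negligible N" and
    lim: "\<And>x e. x \<notin> N \<Longrightarrow> 0 < e \<Longrightarrow> \<exists>d>0. \<forall>k. 0 < k \<and> k < d \<longrightarrow>
        norm (integral (cbox x (x + k *\<^sub>R One)) f /\<^sub>R k ^ DIM('a) - f x) < e"
    using integrable_ccontinuous_explicit[of f] by metis
  have "h x = 0" if x: "x \<in> S" "x \<notin> N" for x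
  proof (rule ccontr)
    assume "h x \<noteq> 0"
    then have "0 < norm (f x)" using x by (simp add: f_def)
    from lim[OF x(2) this] obtain d where d: "0 < d" "\<And>k. 0 < k \<Longrightarrow> k < d \<Longrightarrow>
        norm (integral (cbox x (x + k *\<^sub>R One)) f /\<^sub>R k ^ DIM('a) - f x) < norm (f x)" by blast
    obtain r where r: "0 < r" "ball x r \<subseteq> S" using S x(1) open_contains_ball by blast
    define k where "k = min (d / 2) (r / (2 * norm (One::'a)))"
    have k: "0 < k" "k < d" "k * norm (One::'a) < r"
      using d(1) r(1) by (auto simp: k_def min_def field_simps)
    have sub: "cbox x (x + k *\<^sub>R One) \<subseteq> S"
    proof -
      have "cbox x (x + k *\<^sub>R One) \<subseteq> ball x r"
      proof
        fix y assume y: "y \<in> cbox x (x + k *\<^sub>R One)"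
        have "norm (y - x) \<le> norm (k *\<^sub>R (One::'a))"
          using y k(1) by (intro norm_le_componentwise) (auto simp: mem_box inner_simps)
        then show "y \<in> ball x r" using k by (simp add: dist_norm norm_minus_commute)
      qed
      then show ?thesis using r(2) by blast
    qed
    have "integral (cbox x (x + k *\<^sub>R One)) f = integral (cbox x (x + k *\<^sub>R One)) h"
      using sub by (intro integral_cong) (auto simp: f_def)
    also have "\<dots> = 0"
      using sub box_subset_cbox by (intro integral_box_eq_0_of_test_functions[OF h S' zero]) auto
    finally show False using d(2)[OF k(1,2)] by simp
  qed
  note off_N = this
  have "AE x in lebesgue. x \<notin> N"
    using N by (intro AE_not_in) (simp add: negligible_iff_null_sets)
  then have "AE x in lebesgue. x \<in> S \<longrightarrow> h x = 0"
    by eventually_elim (use off_N in blast)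
  then show ?thesis using S' by (simp add: AE_restrict_space_iff)
qed

lemma sq_integrable_test_function:
  assumes "test_function T \<phi>" "bounded S" "S \<in> sets lebesgue"
  shows "sq_integrable S \<phi>" "sq_integrable S (grad \<phi>)"
  by (intro sq_integrable_continuous test_functionD[OF assms(1)] assms(2,3))+

lemma integrable_scaleR_L2:
  fixes f :: "'a::euclidean_space \<Rightarrow> real"
  assumes "sq_integrable S f" "sq_integrable S g"
  shows "integrable (lebesgue_on S) (\<lambda>x. f x *\<^sub>R g x)"
proof (rule Bochner_Integration.integrable_bound)
  have n: "sq_integrable S (\<lambda>x. norm (f x))" "sq_integrable S (\<lambda>x. norm (g x))"
    using assms by (auto simp: sq_integrable_def)
  show "integrable (lebesgue_on S) (\<lambda>x. norm (f x) \<bullet> norm (g x))"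
    by (rule integrable_inner_L2[OF n])
  show "(\<lambda>x. f x *\<^sub>R g x) \<in> borel_measurable (lebesgue_on S)"
    using assms by (auto simp: sq_integrable_def)
  show "AE x in lebesgue_on S. norm (f x *\<^sub>R g x) \<le> norm (norm (f x) \<bullet> norm (g x))" by simp
qed

text \<open>Pairing a function with an explicit weak gradient keeps the representative selected by
  \<open>weak_grad\<close> out of all computations; any two choices agree almost everywhere.\<close>

definition H1_gradient :: "'a::euclidean_space set \<Rightarrow> ('a \<Rightarrow> real) \<Rightarrow> ('a \<Rightarrow> 'a) \<Rightarrow> bool" where
  "H1_gradient S u g \<longleftrightarrow> sq_integrable S u \<and> sq_integrable S g \<and> has_weak_gradient S u g"

lemma H1_gradient_weak_grad: "u \<in> H1 S \<Longrightarrow> H1_gradient S u (weak_grad S u)"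
  using someI_ex[of "\<lambda>g. sq_integrable S g \<and> has_weak_gradient S u g"]
  by (auto simp: H1_def H1_gradient_def weak_grad_def)

lemma H1_gradient_imp_H1: "H1_gradient S u g \<Longrightarrow> u \<in> H1 S"
  by (auto simp: H1_def H1_gradient_def)

locale bounded_open =
  fixes S :: "'a::euclidean_space set"
  assumes open_S: "open S" and bounded_S: "bounded S"
begin

lemma S_lebesgue: "S \<in> sets lebesgue" using open_S by (rule open_in_sets_lebesgue)

text \<open>The difference of two weak gradients is orthogonal to every test function.\<close>

lemma H1_gradient_unique:
  assumes "H1_gradient S u g" "H1_gradient S u g'"
  shows "AE x in lebesgue_on S. g x = g' x"
proof -
  have sq: "sq_integrable S (\<lambda>x. g x - g' x)"
    using assms by (auto simp: H1_gradient_def intro: sq_integrable_diff)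
  have "(\<integral>x. \<phi> x *\<^sub>R (g x - g' x) \<partial>lebesgue_on S) = 0" if \<phi>: "test_function S \<phi>" for \<phi>
  proof -
    note s = sq_integrable_test_function[OF \<phi> bounded_S S_lebesgue]
    have "integrable (lebesgue_on S) (\<lambda>x. \<phi> x *\<^sub>R g x)" "integrable (lebesgue_on S) (\<lambda>x. \<phi> x *\<^sub>R g' x)"
      using assms s by (auto simp: H1_gradient_def intro: integrable_scaleR_L2)
    moreover have "(\<integral>x. \<phi> x *\<^sub>R g x \<partial>lebesgue_on S) = (\<integral>x. \<phi> x *\<^sub>R g' x \<partial>lebesgue_on S)"
      using assms \<phi> unfolding H1_gradient_def has_weak_gradient_iff by (metis add.inverse_inverse)
    ultimately show ?thesis by (simp add: scaleR_diff_right)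
  qed
  from AE_eq_0_of_test_functions[OF sq_integrable_imp_integrable[OF sq bounded_S S_lebesgue] open_S this]
  show ?thesis by simp
qed

lemma weak_grad_AE_eq:
  assumes "H1_gradient S u g"
  shows "AE x in lebesgue_on S. weak_grad S u x = g x"
  using H1_gradient_unique[OF H1_gradient_weak_grad[OF H1_gradient_imp_H1[OF assms]] assms] .

lemma H1_gradient_add:
  assumes "H1_gradient S u g" "H1_gradient S v h"
  shows "H1_gradient S (\<lambda>x. u x + v x) (\<lambda>x. g x + h x)"
proof -
  have "has_weak_gradient S (\<lambda>x. u x + v x) (\<lambda>x. g x + h x)"
    unfolding has_weak_gradient_iff
  proof (intro allI impI)
    fix \<phi> assume \<phi>: "test_function S \<phi>"
    note s = sq_integrable_test_function[OF \<phi> bounded_S S_lebesgue]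
    have "integrable (lebesgue_on S) (\<lambda>x. \<phi> x *\<^sub>R g x)" "integrable (lebesgue_on S) (\<lambda>x. \<phi> x *\<^sub>R h x)"
      "integrable (lebesgue_on S) (\<lambda>x. u x *\<^sub>R grad \<phi> x)" "integrable (lebesgue_on S) (\<lambda>x. v x *\<^sub>R grad \<phi> x)"
      using assms s by (auto simp: H1_gradient_def intro: integrable_scaleR_L2)
    then show "(\<integral>x. (u x + v x) *\<^sub>R grad \<phi> x \<partial>lebesgue_on S) = - (\<integral>x. \<phi> x *\<^sub>R (g x + h x) \<partial>lebesgue_on S)"
      using assms \<phi> by (simp add: scaleR_add_left scaleR_add_right H1_gradient_def has_weak_gradient_iff)
  qed
  then show ?thesis using assms by (simp add: H1_gradient_def sq_integrable_add)
qed

lemma H1_gradient_scale: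
  assumes "H1_gradient S u g"
  shows "H1_gradient S (\<lambda>x. c * u x) (\<lambda>x. c *\<^sub>R g x)"
proof -
  have "has_weak_gradient S (\<lambda>x. c * u x) (\<lambda>x. c *\<^sub>R g x)"
    unfolding has_weak_gradient_iff
  proof (intro allI impI)
    fix \<phi> assume \<phi>: "test_function S \<phi>"
    have e: "(c * u x) *\<^sub>R grad \<phi> x = c *\<^sub>R (u x *\<^sub>R grad \<phi> x)" "\<phi> x *\<^sub>R c *\<^sub>R g x = c *\<^sub>R (\<phi> x *\<^sub>R g x)" for x
      by simp_all
    show "(\<integral>x. (c * u x) *\<^sub>R grad \<phi> x \<partial>lebesgue_on S) = - (\<integral>x. \<phi> x *\<^sub>R c *\<^sub>R g x \<partial>lebesgue_on S)"
      unfolding e integral_scaleR_right using assms \<phi> by (simp add: H1_gradient_def has_weak_gradient_iff)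
  qed
  then show ?thesis
    using assms sq_integrable_scaleR(1)[of S u c] by (simp add: H1_gradient_def sq_integrable_scaleR)
qed

lemma H1_gradient_diff:
  assumes "H1_gradient S u g" "H1_gradient S v h"
  shows "H1_gradient S (\<lambda>x. u x - v x) (\<lambda>x. g x - h x)"
  using H1_gradient_add[OF assms(1) H1_gradient_scale[OF assms(2), of "-1"]] by simp

lemma H1_gradient_smooth: "(\<And>k. Ck k \<eta>) \<Longrightarrow> H1_gradient S \<eta> (grad \<eta>)"
  unfolding H1_gradient_def
  using Ck.simps(1)[of \<eta>]
  by (simp add: has_weak_gradient_smooth sq_integrable_continuous continuous_grad bounded_S S_lebesgue)

text \<open>Test functions of the smaller set are test functions of the larger one, with the same integrals.\<close>

lemma H1_gradient_restrict:
  assumes T: "T \<subseteq> S" "open T" and u: "H1_gradient S u g"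
  shows "H1_gradient T u g"
proof -
  have T': "T \<in> sets lebesgue" using T(2) by (rule open_in_sets_lebesgue)
  have "has_weak_gradient T u g"
    unfolding has_weak_gradient_iff
  proof (intro allI impI)
    fix \<phi> assume \<phi>: "test_function T \<phi>"
    have glob: "(\<integral>x. u x *\<^sub>R grad \<phi> x \<partial>lebesgue_on S) = - (\<integral>x. \<phi> x *\<^sub>R g x \<partial>lebesgue_on S)"
      using u test_function_mono[OF \<phi> T(1)] by (simp add: H1_gradient_def has_weak_gradient_iff)
    have loc: "integral\<^sup>L (lebesgue_on S) f = integral\<^sup>L (lebesgue_on T) f"
      if "\<And>x. x \<notin> T \<Longrightarrow> f x = 0" for f :: "'a \<Rightarrow> 'a"
    proof -
      have "f x = 0" if "x \<notin> S" for x using that T(1) \<open>\<And>x. x \<notin> T \<Longrightarrow> f x = 0\<close> by blast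
      then show ?thesis
        using integral_lebesgue_on_support[OF S_lebesgue, of f] integral_lebesgue_on_support[OF T' that] by simp
    qed
    have "(\<integral>x. u x *\<^sub>R grad \<phi> x \<partial>lebesgue_on S) = (\<integral>x. u x *\<^sub>R grad \<phi> x \<partial>lebesgue_on T)"
      by (rule loc) (simp add: test_function_grad_eq_0[OF \<phi>])
    moreover have "(\<integral>x. \<phi> x *\<^sub>R g x \<partial>lebesgue_on S) = (\<integral>x. \<phi> x *\<^sub>R g x \<partial>lebesgue_on T)"
      by (rule loc) (simp add: test_functionD(4)[OF \<phi>])
    ultimately show "(\<integral>x. u x *\<^sub>R grad \<phi> x \<partial>lebesgue_on T) = - (\<integral>x. \<phi> x *\<^sub>R g x \<partial>lebesgue_on T)"
      using glob by simp
  qed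
  then show ?thesis
    using u by (simp add: H1_gradient_def sq_integrable_subset(1)[OF _ T(1) S_lebesgue T'])
qed

lemma H1_norm_sq:
  assumes "H1_gradient S u g"
  shows "(H1_norm S u)\<^sup>2 = (L2_norm S u)\<^sup>2 + (L2_norm S g)\<^sup>2"
proof -
  have "L2_norm S (weak_grad S u) = L2_norm S g"
    using weak_grad_AE_eq[OF assms] H1_gradient_weak_grad[OF H1_gradient_imp_H1[OF assms]] assms
    by (intro L2_norm_cong_AE) (auto simp: H1_gradient_def)
  then show ?thesis by (simp add: H1_norm_def)
qed

text \<open>For test functions the classical gradient can be used, and for the limit any weak gradient.\<close>

lemma H1_approx_iff:
  assumes u: "H1_gradient S u g"
  shows "H1_approx S \<phi> u \<longleftrightarrow> (\<forall>k. test_function S (\<phi> k)) \<and>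
    (\<lambda>k. (L2_norm S (\<lambda>x. \<phi> k x - u x))\<^sup>2 + (L2_norm S (\<lambda>x. grad (\<phi> k) x - g x))\<^sup>2) \<longlonglongrightarrow> 0"
proof (cases "\<forall>k. test_function S (\<phi> k)")
  case True
  have "(H1_norm S (\<lambda>x. \<phi> k x - u x))\<^sup>2 = (L2_norm S (\<lambda>x. \<phi> k x - u x))\<^sup>2 + (L2_norm S (\<lambda>x. grad (\<phi> k) x - g x))\<^sup>2" for k
    using True by (intro H1_norm_sq H1_gradient_diff H1_gradient_smooth u) (auto dest: test_functionD(5))
  then have "(\<lambda>k. H1_norm S (\<lambda>x. \<phi> k x - u x)) \<longlonglongrightarrow> 0 \<longleftrightarrow>
      (\<lambda>k. (L2_norm S (\<lambda>x. \<phi> k x - u x))\<^sup>2 + (L2_norm S (\<lambda>x. grad (\<phi> k) x - g x))\<^sup>2) \<longlonglongrightarrow> 0"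
    using power_tendsto_0_iff[of 2 "\<lambda>k. H1_norm S (\<lambda>x. \<phi> k x - u x)" sequentially] by simp
  then show ?thesis using True by (simp add: H1_approx_def)
qed (auto simp: H1_approx_def)

end


text \<open>The integral of the square of \<open>L * f x - I\<close> is nonnegative, where \<open>L\<close> is the length of the interval and
  \<open>I\<close> the integral of \<open>f\<close>.\<close>

section \<open>Estimates along coordinate lines\<close>

lemma integral_sq_le:
  fixes f :: "real \<Rightarrow> real"
  assumes "continuous_on {s..t} f" "s \<le> t"
  shows "(integral {s..t} f)\<^sup>2 \<le> (t - s) * integral {s..t} (\<lambda>x. (f x)\<^sup>2)"
proof (cases "s = t")
  case False
  define L where "L = t - s"
  define I where "I = integral {s..t} f"
  have L: "0 < L" using False assms by (simp add: L_def)
  have i: "f integrable_on {s..t}" "(\<lambda>x. (f x)\<^sup>2) integrable_on {s..t}"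
    using assms by (auto intro!: integrable_continuous_interval continuous_intros)
  have h: "((\<lambda>x. L\<^sup>2 * (f x)\<^sup>2 - 2 * L * I * f x + I\<^sup>2) has_integral
      L\<^sup>2 * integral {s..t} (\<lambda>x. (f x)\<^sup>2) - 2 * L * I * I + I\<^sup>2 * L) {s..t}"
    using i[THEN integrable_integral] has_integral_const_real[of "I\<^sup>2" s t] assms(2)
    by (intro has_integral_add has_integral_diff has_integral_mult_right) (auto simp: I_def L_def mult.commute)
  have e: "L\<^sup>2 * (f x)\<^sup>2 - 2 * L * I * f x + I\<^sup>2 = (L * f x - I)\<^sup>2" for x
    by (simp add: power2_eq_square algebra_simps)
  have "0 \<le> L\<^sup>2 * integral {s..t} (\<lambda>x. (f x)\<^sup>2) - 2 * L * I * I + I\<^sup>2 * L"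
    by (rule has_integral_nonneg[OF h]) (simp only: e zero_le_power2)
  also have "\<dots> = L * (L * integral {s..t} (\<lambda>x. (f x)\<^sup>2) - I\<^sup>2)"
    by (simp add: power2_eq_square algebra_simps)
  finally show ?thesis using L by (simp add: zero_le_mult_iff I_def L_def)
qed simp

text \<open>The one estimate from which the bounds on traces, on boundary strips and the Poincare inequality
  follow by integration in the other coordinate.\<close>

lemma increment_sq_le:
  fixes f f' :: "real \<Rightarrow> real"
  assumes der: "\<And>t. (f has_real_derivative f' t) (at t)" and cont: "continuous_on UNIV f'"
    and "s \<in> {a..b}" "t \<in> {a..b}"
  shows "(f t - f s)\<^sup>2 \<le> (b - a) * integral {a..b} (\<lambda>x. (f' x)\<^sup>2)"
proof -
  have *: "(f t - f s)\<^sup>2 \<le> (b - a) * integral {a..b} (\<lambda>x. (f' x)\<^sup>2)"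
    if st: "s \<le> t" "a \<le> s" "t \<le> b" for s t
  proof -
    have c: "continuous_on A f'" "continuous_on A (\<lambda>x. (f' x)\<^sup>2)" for A
      using cont by (auto intro: continuous_on_subset continuous_intros)
    have "(f' has_integral (f t - f s)) {s..t}"
      using der st(1) by (intro fundamental_theorem_of_calculus)
        (auto simp: has_real_derivative_iff_has_vector_derivative[symmetric] intro: has_field_derivative_at_within)
    then have "(f t - f s)\<^sup>2 \<le> (t - s) * integral {s..t} (\<lambda>x. (f' x)\<^sup>2)"
      using integral_sq_le[OF c(1) st(1)] by (simp add: integral_unique)
    also have "\<dots> \<le> (b - a) * integral {a..b} (\<lambda>x. (f' x)\<^sup>2)"
      using st c by (intro mult_mono integral_subset_le integral_nonneg integrable_continuous_interval) auto
    finally show ?thesis .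
  qed
  show ?thesis
    using *[of s t] *[of t s] assms(3,4) by (cases "s \<le> t") (auto simp: power2_commute[of "f t"])
qed

lemma L2_norm_box_HK:
  fixes f :: "'a::euclidean_space \<Rightarrow> 'b::euclidean_space"
  assumes "continuous_on UNIV f"
  shows "(L2_norm (box a b) f)\<^sup>2 = integral (cbox a b) (\<lambda>x. (norm (f x))\<^sup>2)"
proof -
  have "integrable (lebesgue_on (box a b)) (\<lambda>x. (norm (f x))\<^sup>2)"
    using sq_integrable_continuous[OF assms bounded_box, of a b] by (simp add: sq_integrable_def)
  then show ?thesis
    by (simp add: L2_norm_sq lebesgue_integral_eq_integral integral_open_interval)
qed

lemma integral_cbox_iterated:
  fixes F :: "real \<times> real \<Rightarrow> real"
  assumes "continuous_on UNIV F"
  shows "integral (cbox (a1, a2) (b1, b2)) F = integral {a1..b1} (\<lambda>x. integral {a2..b2} (\<lambda>y. F (x, y)))"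
    and "integral (cbox (a1, a2) (b1, b2)) F = integral {a2..b2} (\<lambda>y. integral {a1..b1} (\<lambda>x. F (x, y)))"
    and "(\<lambda>y. integral {a1..b1} (\<lambda>x. F (x, y))) integrable_on {a2..b2}"
proof -
  have c: "continuous_on (cbox (a1, a2) (b1, b2)) F" using assms by (rule continuous_on_subset) simp
  have c2: "continuous_on A (\<lambda>(y, x). F (x, y))" for A
    using assms by (auto intro!: continuous_on_compose2[of UNIV F] continuous_intros simp: case_prod_unfold)
  show 1: "integral (cbox (a1, a2) (b1, b2)) F = integral {a1..b1} (\<lambda>x. integral {a2..b2} (\<lambda>y. F (x, y)))"
    using integral_prod_continuous[OF c] by simp
  have "integral (cbox a1 b1) (\<lambda>x. integral (cbox a2 b2) (\<lambda>y. F (x, y))) =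
      integral (cbox a2 b2) (\<lambda>y. integral (cbox a1 b1) (\<lambda>x. F (x, y)))"
    using c by (intro integral_swap_continuous) simp
  then show "integral (cbox (a1, a2) (b1, b2)) F = integral {a2..b2} (\<lambda>y. integral {a1..b1} (\<lambda>x. F (x, y)))"
    using 1 by simp
  show "(\<lambda>y. integral {a1..b1} (\<lambda>x. F (x, y))) integrable_on {a2..b2}"
    using integral_integrable_2dim[OF c2, where a = a2 and b = b2 and c = a1 and d = b1] by simp
qed

lemma L2_norm_box_swap:
  fixes F :: "real \<times> real \<Rightarrow> 'b::euclidean_space"
  assumes "continuous_on UNIV F"
  shows "(L2_norm (box (a1, a2) (b1, b2)) F)\<^sup>2 = (L2_norm (box (a2, a1) (b2, b1)) (F \<circ> prod.swap))\<^sup>2"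
proof -
  have c: "continuous_on UNIV (F \<circ> prod.swap)"
    using assms by (auto intro!: continuous_on_compose2[of UNIV F] continuous_intros simp: prod.swap_def o_def)
  have n: "continuous_on UNIV (\<lambda>x. (norm (F x))\<^sup>2)" "continuous_on UNIV (\<lambda>x. (norm ((F \<circ> prod.swap) x))\<^sup>2)"
    using assms c by (auto intro!: continuous_on_power continuous_on_norm)
  show ?thesis
    unfolding L2_norm_box_HK[OF assms] L2_norm_box_HK[OF c] integral_cbox_iterated(1)[OF n(1)]
      integral_cbox_iterated(2)[OF n(2)] by simp
qed

locale C1_plane =
  fixes \<eta> :: "real \<times> real \<Rightarrow> real" and g :: "real \<times> real \<Rightarrow> real \<times> real"
  assumes der: "\<And>x. GDERIV \<eta> x :> g x" and cont: "continuous_on UNIV g"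
begin

lemma continuous_fun: "continuous_on A \<eta>"
  using der by (intro has_derivative_continuous_on[where f' = "\<lambda>x h. h \<bullet> g x"])
    (auto simp: gderiv_def intro: has_derivative_at_withinI)

lemma slice_increment_sq_le:
  assumes "s \<in> {a..b}" "x \<in> {a..b}"
  shows "(\<eta> (x, y) - \<eta> (s, y))\<^sup>2 \<le> (b - a) * integral {a..b} (\<lambda>t. (norm (g (t, y)))\<^sup>2)"
proof -
  have cg: "continuous_on UNIV (\<lambda>t. g (t, y))"
    using cont by (auto intro!: continuous_on_compose2[of UNIV g] continuous_intros)
  have "((\<lambda>t. \<eta> ((0, y) + t *\<^sub>R (1, 0))) has_real_derivative (g (t, y) \<bullet> (1, 0))) (at t)" for t
    using der[of "(t, y)"] by (intro GDERIV_along_line) simp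
  then have "(\<eta> (x, y) - \<eta> (s, y))\<^sup>2 \<le> (b - a) * integral {a..b} (\<lambda>t. (g (t, y) \<bullet> (1, 0))\<^sup>2)"
    using assms cg by (intro increment_sq_le[of "\<lambda>t. \<eta> (t, y)"]) (auto intro!: continuous_intros)
  also have "\<dots> \<le> (b - a) * integral {a..b} (\<lambda>t. (norm (g (t, y)))\<^sup>2)"
  proof (intro mult_left_mono integral_le integrable_continuous_interval)
    show "continuous_on {a..b} (\<lambda>t. (g (t, y) \<bullet> (1, 0))\<^sup>2)" "continuous_on {a..b} (\<lambda>t. (norm (g (t, y)))\<^sup>2)"
      using continuous_on_subset[OF cg] by (auto intro!: continuous_intros)
    show "(g (t, y) \<bullet> (1, 0))\<^sup>2 \<le> (norm (g (t, y)))\<^sup>2" for t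
      by (simp add: inner_prod_def norm_prod_def)
    show "0 \<le> b - a" using assms by simp
  qed
  finally show ?thesis .
qed

lemma integrable_slice:
  "(\<lambda>y. (\<eta> (s, y))\<^sup>2) integrable_on {a..b}"
  "(\<lambda>y. (\<eta> (s, y) - \<eta> (r, y))\<^sup>2) integrable_on {a..b}" "(\<lambda>x. (\<eta> (x, y))\<^sup>2) integrable_on {a..b}"
  by (intro integrable_continuous_interval continuous_intros
      continuous_on_compose2[OF continuous_fun[of UNIV]]; simp)+

lemma continuous_norm_sq: "continuous_on UNIV (\<lambda>x. (norm (\<eta> x))\<^sup>2)" "continuous_on UNIV (\<lambda>x. (norm (g x))\<^sup>2)"
  using continuous_fun[of UNIV] cont by (auto intro!: continuous_intros)

text \<open>Two parallel lines: the change of \<open>\<eta>\<close> from one to the other is controlled by the gradient in between.\<close>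

lemma slice_trace_le:
  assumes "s \<in> {a1..b1}" "r \<in> {a1..b1}"
  shows "integral {a2..b2} (\<lambda>y. (\<eta> (s, y) - \<eta> (r, y))\<^sup>2) \<le> (b1 - a1) * (L2_norm (box (a1, a2) (b1, b2)) g)\<^sup>2"
proof -
  have "integral {a2..b2} (\<lambda>y. (\<eta> (s, y) - \<eta> (r, y))\<^sup>2)
      \<le> integral {a2..b2} (\<lambda>y. (b1 - a1) * integral {a1..b1} (\<lambda>t. (norm (g (t, y)))\<^sup>2))"
  proof (rule integral_le)
    show "(\<lambda>y. (\<eta> (s, y) - \<eta> (r, y))\<^sup>2) integrable_on {a2..b2}" by (rule integrable_slice)
    show "(\<lambda>y. (b1 - a1) * integral {a1..b1} (\<lambda>t. (norm (g (t, y)))\<^sup>2)) integrable_on {a2..b2}"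
      by (rule integrable_on_mult_right[OF integral_cbox_iterated(3)[OF continuous_norm_sq(2)]])
    show "(\<eta> (s, y) - \<eta> (r, y))\<^sup>2 \<le> (b1 - a1) * integral {a1..b1} (\<lambda>t. (norm (g (t, y)))\<^sup>2)" for y
      by (rule slice_increment_sq_le[OF assms(2,1)])
  qed
  then show ?thesis
    by (simp add: L2_norm_box_HK[OF cont] integral_cbox_iterated(2)[OF continuous_norm_sq(2)])
qed

text \<open>Each value is compared with the value of \<open>\<eta>\<close> at abscissa \<open>s\<close> on the same horizontal line. The gradient
  term carries the square of the width of the strip, the boundary term only its first power: after
  division by the square of the width, as a cutoff requires, the gradient term remains bounded.\<close>

lemma strip_L2_norm_le:
  assumes s: "s \<in> {a1..b1}"
  shows "(L2_norm (box (a1, a2) (b1, b2)) \<eta>)\<^sup>2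
    \<le> 2 * (b1 - a1) * integral {a2..b2} (\<lambda>y. (\<eta> (s, y))\<^sup>2)
      + 2 * (b1 - a1)\<^sup>2 * (L2_norm (box (a1, a2) (b1, b2)) g)\<^sup>2"
proof -
  have w: "0 \<le> b1 - a1" using s by simp
  define G where "G y = integral {a1..b1} (\<lambda>t. (norm (g (t, y)))\<^sup>2)" for y
  have G: "G integrable_on {a2..b2}" "(L2_norm (box (a1, a2) (b1, b2)) g)\<^sup>2 = integral {a2..b2} G"
    using integral_cbox_iterated(2)[OF continuous_norm_sq(2), of a1 a2 b1 b2]
      integral_cbox_iterated(3)[OF continuous_norm_sq(2), of a1 b1 a2 b2]
    by (auto simp: G_def[abs_def] L2_norm_box_HK[OF cont])
  have 1: "integral {a1..b1} (\<lambda>x. (norm (\<eta> (x, y)))\<^sup>2) \<le> 2 * (b1 - a1) * (\<eta> (s, y))\<^sup>2 + 2 * (b1 - a1)\<^sup>2 * G y" for y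
  proof -
    have "(norm (\<eta> (x, y)))\<^sup>2 \<le> 2 * (\<eta> (s, y))\<^sup>2 + 2 * ((b1 - a1) * G y)" if "x \<in> {a1..b1}" for x
      using norm_add_sq_le[of "\<eta> (s, y)" "\<eta> (x, y) - \<eta> (s, y)"] slice_increment_sq_le[OF s that, of y]
      by (simp add: G_def)
    then have "integral {a1..b1} (\<lambda>x. (norm (\<eta> (x, y)))\<^sup>2) \<le> integral {a1..b1} (\<lambda>x. 2 * (\<eta> (s, y))\<^sup>2 + 2 * ((b1 - a1) * G y))"
      using integrable_slice(3) by (intro integral_le) auto
    also have "\<dots> = 2 * (b1 - a1) * (\<eta> (s, y))\<^sup>2 + 2 * (b1 - a1)\<^sup>2 * G y"
      using w by (simp add: power2_eq_square algebra_simps)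
    finally show ?thesis .
  qed
  have "(L2_norm (box (a1, a2) (b1, b2)) \<eta>)\<^sup>2 = integral {a2..b2} (\<lambda>y. integral {a1..b1} (\<lambda>x. (norm (\<eta> (x, y)))\<^sup>2))"
    by (simp only: L2_norm_box_HK[OF continuous_fun] integral_cbox_iterated(2)[OF continuous_norm_sq(1)])
  also have "\<dots> \<le> integral {a2..b2} (\<lambda>y. 2 * (b1 - a1) * (\<eta> (s, y))\<^sup>2 + 2 * (b1 - a1)\<^sup>2 * G y)"
  proof (rule integral_le[OF _ _ 1])
    show "(\<lambda>y. integral {a1..b1} (\<lambda>x. (norm (\<eta> (x, y)))\<^sup>2)) integrable_on {a2..b2}"
      by (rule integral_cbox_iterated(3)[OF continuous_norm_sq(1)])
    show "(\<lambda>y. 2 * (b1 - a1) * (\<eta> (s, y))\<^sup>2 + 2 * (b1 - a1)\<^sup>2 * G y) integrable_on {a2..b2}"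
      by (intro integrable_add integrable_on_mult_right integrable_slice G(1))
  qed
  also have "\<dots> = 2 * (b1 - a1) * integral {a2..b2} (\<lambda>y. (\<eta> (s, y))\<^sup>2) + 2 * (b1 - a1)\<^sup>2 * integral {a2..b2} G"
    by (simp add: integral_add[OF integrable_on_mult_right[OF integrable_slice(1)] integrable_on_mult_right[OF G(1)]])
  finally show ?thesis by (simp add: G(2))
qed

text \<open>Exchanging the coordinates turns statements about vertical lines into statements about horizontal ones.\<close>

lemma C1_plane_swap: "C1_plane (\<eta> \<circ> prod.swap) (prod.swap \<circ> g \<circ> prod.swap)"
proof
  fix x :: "real \<times> real"
  have "(prod.swap has_derivative prod.swap) (at x)"
    by (intro bounded_linear_imp_has_derivative) (auto intro!: bounded_linear_Pair bounded_linear_fst bounded_linear_snd simp: prod.swap_def[abs_def])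
  then have "((\<eta> \<circ> prod.swap) has_derivative (\<lambda>h. prod.swap h \<bullet> g (prod.swap x))) (at x)"
    using der[of "prod.swap x"] has_derivative_compose[of prod.swap prod.swap x UNIV \<eta>] by (simp add: gderiv_def o_def)
  also have "(\<lambda>h. prod.swap h \<bullet> g (prod.swap x)) = (\<lambda>h. h \<bullet> (prod.swap \<circ> g \<circ> prod.swap) x)"
    by (auto simp: inner_prod_def)
  finally show "GDERIV (\<eta> \<circ> prod.swap) x :> (prod.swap \<circ> g \<circ> prod.swap) x" by (simp only: gderiv_def)
next
  have s: "continuous_on UNIV (prod.swap :: real \<times> real \<Rightarrow> real \<times> real)"
    by (auto intro!: continuous_intros simp: prod.swap_def[abs_def])
  then show "continuous_on UNIV (prod.swap \<circ> g \<circ> prod.swap)"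
    using cont by (intro continuous_on_compose) (auto intro: continuous_on_subset)
qed

lemma L2_norm_swap_gradient:
  "(L2_norm (box (a2, a1) (b2, b1)) (prod.swap \<circ> g \<circ> prod.swap))\<^sup>2 = (L2_norm (box (a1, a2) (b1, b2)) g)\<^sup>2"
proof -
  have "norm ((prod.swap \<circ> g \<circ> prod.swap) x) = norm ((g \<circ> prod.swap) x)" for x
    by (simp add: norm_prod_def add.commute)
  then show ?thesis unfolding L2_norm_box_swap[OF cont, of a1 a2 b1 b2] by (simp only: L2_norm_sq)
qed

end


text \<open>Edges are parametrized over $[0,1]$, so the integral over arc length has the additional factor \<open>H\<close>.\<close>

section \<open>Edges and boundary frames of a square\<close>

lemma edge_L2_norm:
  fixes f :: "real \<Rightarrow> real"
  assumes f: "continuous_on UNIV f" and H: "0 < H"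
  shows "H * (L2_norm {0..1} (\<lambda>t. f (x + t * H)))\<^sup>2 = integral {x..x + H} (\<lambda>t. (f t)\<^sup>2)"
proof -
  have c: "continuous_on A (\<lambda>t. f (x + t * H))" for A
    using f by (auto intro!: continuous_on_compose2[of UNIV f] continuous_intros)
  have "integrable (lebesgue_on {0..1}) (\<lambda>t. (norm (f (x + t * H)))\<^sup>2)"
    using c by (intro continuous_imp_integrable_real continuous_intros)
  then have "(L2_norm {0..1} (\<lambda>t. f (x + t * H)))\<^sup>2 = integral {0..1} (\<lambda>t. (f (x + t * H))\<^sup>2)"
    by (simp add: L2_norm_sq lebesgue_integral_eq_integral)
  moreover have "((\<lambda>t. H *\<^sub>R (\<lambda>t. (f t)\<^sup>2) (x + t * H)) has_integral
      integral {x + 0 * H..x + 1 * H} (\<lambda>t. (f t)\<^sup>2)) {0..1}"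
  proof (rule has_integral_substitution)
    show "(\<lambda>t. x + t * H) ` {0..1} \<subseteq> {x..x + H}" using H by (auto simp: mult_left_le_one_le)
    show "continuous_on {x..x + H} (\<lambda>t. (f t)\<^sup>2)"
      using f by (auto intro!: continuous_intros intro: continuous_on_subset)
    show "((\<lambda>t. x + t * H) has_real_derivative H) (at t within {0..1})" for t
      by (auto intro!: derivative_eq_intros)
  qed (use H in auto)
  ultimately show ?thesis
    by (simp add: integral_unique flip: integral_mult_right)
qed

lemma linepath_axis:
  "linepath (x, y) (x, y + H) = (\<lambda>t. (x, y + t * H))"
  "linepath (x, y) (x + H, y) = (\<lambda>t. (x + t * H, y))"
  for x y H :: real
  by (auto simp: linepath_def fun_eq_iff algebra_simps)

lemma edges_Pair: "edges H (x, y) =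
  {((x, y), (x + H, y)), ((x, y), (x, y + H)), ((x + H, y), (x + H, y + H)), ((x, y + H), (x + H, y + H))}"
  by (simp add: edges_def)

lemma L2_norm_mono:
  assumes "sq_integrable S f" "sq_integrable S g" "\<And>x. x \<in> S \<Longrightarrow> norm (f x) \<le> norm (g x)"
  shows "(L2_norm S f)\<^sup>2 \<le> (L2_norm S g)\<^sup>2"
  unfolding L2_norm_sq using assms
  by (intro integral_mono) (auto simp: sq_integrable_def intro: power_mono)

lemma L2_norm_support:
  assumes "T \<subseteq> S" "S \<in> sets lebesgue" "T \<in> sets lebesgue" "\<And>x. x \<in> S - T \<Longrightarrow> f x = 0"
  shows "L2_norm S f = L2_norm T f"
proof -
  have "(\<integral>x. (norm (f x))\<^sup>2 \<partial>lebesgue_on S) = (\<integral>x. (if x \<in> T then (norm (f x))\<^sup>2 else 0) \<partial>lebesgue_on S)"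
    using assms(4) by (intro Bochner_Integration.integral_cong) auto
  also have "\<dots> = (\<integral>x. (norm (f x))\<^sup>2 \<partial>lebesgue_on T)"
    using assms(1-3) by (intro integral_restrict) auto
  finally show ?thesis by (simp add: L2_norm_def)
qed

lemma L2_norm_Un_le:
  assumes "sq_integrable (A \<union> B) f" "A \<in> sets lebesgue" "B \<in> sets lebesgue"
  shows "(L2_norm (A \<union> B) f)\<^sup>2 \<le> (L2_norm A f)\<^sup>2 + (L2_norm B f)\<^sup>2"
proof -
  let ?n = "\<lambda>x. (norm (f x))\<^sup>2"
  have AB: "A \<union> B \<in> sets lebesgue" using assms by blast
  have i: "integrable lebesgue (\<lambda>x. if x \<in> T then ?n x else 0)" if "T \<subseteq> A \<union> B" "T \<in> sets lebesgue" for T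
    using sq_integrable_subset(1)[OF assms(1) that(1) AB that(2)] that(2)
    by (simp add: Lebesgue_Measure.integrable_restrict_UNIV sq_integrable_def)
  have "(\<integral>x. (if x \<in> A \<union> B then ?n x else 0) \<partial>lebesgue)
      \<le> (\<integral>x. (if x \<in> A then ?n x else 0) + (if x \<in> B then ?n x else 0) \<partial>lebesgue)"
    using i[of A] i[of B] i[of "A \<union> B"] AB assms by (intro integral_mono) auto
  also have "\<dots> = (\<integral>x. (if x \<in> A then ?n x else 0) \<partial>lebesgue) + (\<integral>x. (if x \<in> B then ?n x else 0) \<partial>lebesgue)"
    using i[of A] i[of B] assms by (intro Bochner_Integration.integral_add) auto
  finally show ?thesis
    unfolding L2_norm_sq Lebesgue_Measure.integral_restrict_UNIV[OF AB] Lebesgue_Measure.integral_restrict_UNIV[OF assms(2)]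
      Lebesgue_Measure.integral_restrict_UNIV[OF assms(3)] .
qed

lemma C1_plane_smooth: "(\<And>k. Ck k \<eta>) \<Longrightarrow> C1_plane \<eta> (grad \<eta>)"
  by standard (auto intro: Ck_imp_GDERIV continuous_grad)

lemma box_real_Pair: "box (a1, a2) (b1, b2) = {a1<..<b1} \<times> {a2<..<b2 :: real}" for a1 b1 :: real
  by (auto simp: box_def Basis_prod_def ball_Un)

text \<open>The points of the open square that are closer than \<open>d\<close> to its boundary.\<close>

definition square_frame :: "real \<Rightarrow> real \<times> real \<Rightarrow> real \<Rightarrow> (real \<times> real) set" where
  "square_frame H c d = box c (c + (H, H)) - cbox (c + (d, d)) (c + (H - d, H - d))"

context C1_plane
begin

lemma sq_integrable_fun: "bounded S \<Longrightarrow> S \<in> sets lebesgue \<Longrightarrow> sq_integrable S \<eta>"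
  "bounded S \<Longrightarrow> S \<in> sets lebesgue \<Longrightarrow> sq_integrable S g"
  using continuous_fun cont by (auto intro: sq_integrable_continuous)

lemma vertical_edge:
  assumes "0 < H"
  shows "H * (L2_norm {0..1} (\<eta> \<circ> linepath (x, y) (x, y + H)))\<^sup>2 = integral {y..y + H} (\<lambda>t. (\<eta> (x, t))\<^sup>2)"
proof -
  have "continuous_on UNIV (\<lambda>t. \<eta> (x, t))"
    by (intro continuous_intros continuous_on_compose2[OF continuous_fun[of UNIV]]) auto
  from edge_L2_norm[OF this assms] show ?thesis by (simp add: linepath_axis o_def)
qed

lemma horizontal_edge:
  "L2_norm {0..1} (\<eta> \<circ> linepath (x, y) (x + H, y)) = L2_norm {0..1} ((\<eta> \<circ> prod.swap) \<circ> linepath (y, x) (y, x + H))"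
  by (simp add: linepath_axis o_def)

lemma vertical_strip:
  assumes "0 < H" "s \<in> {a..b}" "(L2_norm {0..1} (\<eta> \<circ> linepath (s, y) (s, y + H)))\<^sup>2 \<le> \<tau>"
  shows "(L2_norm (box (a, y) (b, y + H)) \<eta>)\<^sup>2
     \<le> 2 * (b - a) * H * \<tau> + 2 * (b - a)\<^sup>2 * (L2_norm (box (a, y) (b, y + H)) g)\<^sup>2"
proof -
  have "2 * (b - a) * integral {y..y + H} (\<lambda>t. (\<eta> (s, t))\<^sup>2) \<le> 2 * (b - a) * (H * \<tau>)"
    unfolding vertical_edge[OF assms(1), symmetric] using assms by (intro mult_left_mono) auto
  then show ?thesis using strip_L2_norm_le[OF assms(2), of y "y + H"] by (simp add: mult.assoc)
qed

lemma vertical_edge_diff: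
  assumes "0 < H" "s \<in> {a..b}" "r \<in> {a..b}" "\<And>t. t \<in> {y..y + H} \<Longrightarrow> \<eta> (r, t) = 0"
  shows "H * (L2_norm {0..1} (\<eta> \<circ> linepath (s, y) (s, y + H)))\<^sup>2 \<le> (b - a) * (L2_norm (box (a, y) (b, y + H)) g)\<^sup>2"
proof -
  have "integral {y..y + H} (\<lambda>t. (\<eta> (s, t))\<^sup>2) = integral {y..y + H} (\<lambda>t. (\<eta> (s, t) - \<eta> (r, t))\<^sup>2)"
    using assms(4) by (intro integral_cong) auto
  then show ?thesis using vertical_edge[OF assms(1), of s y] slice_trace_le[OF assms(2,3), of y "y + H"] by simp
qed

end

context C1_plane
begin

interpretation swap: C1_plane "\<eta> \<circ> prod.swap" "prod.swap \<circ> g \<circ> prod.swap"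
  by (rule C1_plane_swap)

lemma horizontal_strip:
  assumes "0 < H" "s \<in> {a..b}" "(L2_norm {0..1} (\<eta> \<circ> linepath (x, s) (x + H, s)))\<^sup>2 \<le> \<tau>"
  shows "(L2_norm (box (x, a) (x + H, b)) \<eta>)\<^sup>2
     \<le> 2 * (b - a) * H * \<tau> + 2 * (b - a)\<^sup>2 * (L2_norm (box (x, a) (x + H, b)) g)\<^sup>2"
  using swap.vertical_strip[OF assms(1,2), of x \<tau>] assms(3)
  unfolding horizontal_edge L2_norm_swap_gradient L2_norm_box_swap[OF continuous_fun, of x a "x + H" b] by simp

lemma horizontal_edge_diff:
  assumes "0 < H" "s \<in> {a..b}" "r \<in> {a..b}" "\<And>t. t \<in> {x..x + H} \<Longrightarrow> \<eta> (t, r) = 0"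
  shows "H * (L2_norm {0..1} (\<eta> \<circ> linepath (x, s) (x + H, s)))\<^sup>2 \<le> (b - a) * (L2_norm (box (x, a) (x + H, b)) g)\<^sup>2"
  using swap.vertical_edge_diff[OF assms(1-3), of x] assms(4)
  unfolding horizontal_edge L2_norm_swap_gradient by simp

text \<open>The frame is the union of four overlapping strips of width \<open>d\<close>, and each of them has one edge of the
  square as a long side.\<close>

lemma frame_L2_norm_le:
  assumes d: "0 < d" "d \<le> H"
    and \<tau>: "\<And>p q. (p, q) \<in> edges H c \<Longrightarrow> (L2_norm {0..1} (\<eta> \<circ> linepath p q))\<^sup>2 \<le> \<tau>"
  shows "(L2_norm (square_frame H c d) \<eta>)\<^sup>2
    \<le> 8 * d * H * \<tau> + 8 * d\<^sup>2 * (L2_norm (square_frame H c d) g)\<^sup>2"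
proof -
  obtain x y where c: "c = (x, y)" by force
  have H: "0 < H" using d by simp
  note t = \<tau>[unfolded c edges_Pair]
  let ?F = "square_frame H c d"
  let ?L = "box (x, y) (x + d, y + H)" and ?R = "box (x + H - d, y) (x + H, y + H)"
  let ?B = "box (x, y) (x + H, y + d)" and ?T = "box (x, y + H - d) (x + H, y + H)"
  have F: "?F = ?L \<union> (?R \<union> (?B \<union> ?T))"
    unfolding square_frame_def c using d by (auto simp: box_real_Pair cbox_Pair_eq)
  have bF: "bounded ?F" "?F \<in> sets lebesgue"
    unfolding square_frame_def by (auto intro: bounded_subset[OF bounded_box])
  have s: "sq_integrable T \<eta>" "(L2_norm T g)\<^sup>2 \<le> (L2_norm ?F g)\<^sup>2" if "T \<subseteq> ?F" "T \<in> sets lebesgue" for T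
    using that bF sq_integrable_subset[OF sq_integrable_fun(1)[OF bF] that(1) bF(2) that(2)]
      sq_integrable_subset[OF sq_integrable_fun(2)[OF bF] that(1) bF(2) that(2)] by auto
  have e: "a * X \<le> a * (L2_norm ?F g)\<^sup>2" if "X \<le> (L2_norm ?F g)\<^sup>2" "0 \<le> a" for a X
    using that by (rule mult_left_mono)
  have S: "(L2_norm ?L \<eta>)\<^sup>2 \<le> 2 * d * H * \<tau> + 2 * d\<^sup>2 * (L2_norm ?L g)\<^sup>2"
    "(L2_norm ?R \<eta>)\<^sup>2 \<le> 2 * d * H * \<tau> + 2 * d\<^sup>2 * (L2_norm ?R g)\<^sup>2"
    "(L2_norm ?B \<eta>)\<^sup>2 \<le> 2 * d * H * \<tau> + 2 * d\<^sup>2 * (L2_norm ?B g)\<^sup>2"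
    "(L2_norm ?T \<eta>)\<^sup>2 \<le> 2 * d * H * \<tau> + 2 * d\<^sup>2 * (L2_norm ?T g)\<^sup>2"
    using vertical_strip[OF H, of x x "x + d" y \<tau>] vertical_strip[OF H, of "x + H" "x + H - d" "x + H" y \<tau>]
      horizontal_strip[OF H, of y y "y + d" x \<tau>] horizontal_strip[OF H, of "y + H" "y + H - d" "y + H" x \<tau>] t d
    by auto
  have T: "(L2_norm X g)\<^sup>2 \<le> (L2_norm ?F g)\<^sup>2" if "X \<in> {?L, ?R, ?B, ?T}" for X
    using that by (intro s) (auto simp: F)
  have "(L2_norm ?F \<eta>)\<^sup>2 \<le> (L2_norm ?L \<eta>)\<^sup>2 + ((L2_norm ?R \<eta>)\<^sup>2 + ((L2_norm ?B \<eta>)\<^sup>2 + (L2_norm ?T \<eta>)\<^sup>2))"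
    unfolding F
    by (intro order_trans[OF L2_norm_Un_le] add_left_mono L2_norm_Un_le s(1)) (auto simp: F)
  also have "\<dots> \<le> 4 * (2 * d * H * \<tau>) + 4 * (2 * d\<^sup>2 * (L2_norm ?F g)\<^sup>2)"
    using S e[OF T, of ?L "2 * d\<^sup>2"] e[OF T, of ?R "2 * d\<^sup>2"] e[OF T, of ?B "2 * d\<^sup>2"] e[OF T, of ?T "2 * d\<^sup>2"]
    by simp
  finally show ?thesis by simp
qed

end


section \<open>Cutting off near the boundary of a square\<close>

text \<open>The derivative is continuous, hence bounded on $[0,1]$, and it vanishes elsewhere because the step is
  constant there.\<close>

lemma smooth_step_deriv_bounded: "\<exists>M. \<forall>t. \<bar>grad smooth_step t\<bar> \<le> M"
proof -
  have "continuous_on {0..1} (grad smooth_step)"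
    using continuous_grad[OF Ck_smooth_step] by (rule continuous_on_subset) simp
  then have "compact (grad smooth_step ` {0..1})" by (intro compact_continuous_image) auto
  then obtain M where M: "\<forall>t\<in>{0..1}. \<bar>grad smooth_step t\<bar> \<le> M"
    using compact_imp_bounded[of "grad smooth_step ` {0..1}"] unfolding bounded_iff by auto
  have "grad smooth_step t = 0" if "t \<notin> {0..1}" for t
  proof -
    \<comment> \<open>the added constant makes the function itself vanish near \<open>t\<close>\<close>
    have "grad (\<lambda>s. smooth_step s + (if t < 0 then 0 else -1)) t = 0"
    proof (rule grad_eq_0_outside)
      show "closed (if t < 0 then {0..} else {..1::real})" by simp
      show "t \<notin> (if t < 0 then {0..} else {..1})" using that by auto
    qed (auto simp: smooth_step_eq_0 smooth_step_eq_1 split: if_splits)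
    moreover have "grad (\<lambda>s. smooth_step s + (if t < 0 then 0 else -1)) t = grad smooth_step t + grad (\<lambda>s. if t < 0 then 0 else -1) t"
      by (rule grad_add[OF Ck_smooth_step Ck_const])
    moreover have "grad (\<lambda>s::real. if t < 0 then 0 else -1) t = 0" by (intro grad_eqI GDERIV_const)
    ultimately show ?thesis by simp
  qed
  moreover have "0 \<le> M" using M[THEN bspec, of 0] abs_ge_zero[of "grad smooth_step 0"] by simp
  ultimately have "\<bar>grad smooth_step t\<bar> \<le> M" for t
    using M by (cases "t \<in> {0..1}") auto
  then show ?thesis by blast
qed

lemma interval_cutoff_deriv_le:
  assumes M: "\<forall>t. \<bar>grad smooth_step t\<bar> \<le> M" and d: "0 < \<delta>"
  shows "\<bar>grad (interval_cutoff \<delta> a b) s\<bar> \<le> 2 * M / \<delta>"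
proof -
  have D: "(smooth_step has_real_derivative grad smooth_step t) (at t)" for t
    using Ck_imp_GDERIV[OF Ck_smooth_step, of t] by (simp only: gderiv_deriv)
  have M0: "0 \<le> M" using M abs_ge_zero order_trans by blast
  define u where "u = (s - a) / \<delta> - 1"
  define v where "v = (b - s) / \<delta> - 1"
  have "((\<lambda>s. smooth_step ((s - a) / \<delta> - 1)) has_real_derivative grad smooth_step u * (1 / \<delta>)) (at s)"
    unfolding u_def by (rule DERIV_chain2[OF D]) (use d in \<open>auto intro!: derivative_eq_intros\<close>)
  moreover have "((\<lambda>s. smooth_step ((b - s) / \<delta> - 1)) has_real_derivative grad smooth_step v * (- 1 / \<delta>)) (at s)"
    unfolding v_def by (rule DERIV_chain2[OF D]) (use d in \<open>auto intro!: derivative_eq_intros\<close>)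
  ultimately have "(interval_cutoff \<delta> a b has_real_derivative
      grad smooth_step u * (1 / \<delta>) * smooth_step v + grad smooth_step v * (- 1 / \<delta>) * smooth_step u) (at s)"
    unfolding interval_cutoff_def[abs_def] u_def v_def by (rule DERIV_mult)
  then have "grad (interval_cutoff \<delta> a b) s
      = grad smooth_step u * (1 / \<delta>) * smooth_step v + grad smooth_step v * (- 1 / \<delta>) * smooth_step u"
    by (intro grad_eqI) (simp only: gderiv_deriv)
  also have "\<bar>\<dots>\<bar> \<le> \<bar>grad smooth_step u * (1 / \<delta>) * smooth_step v\<bar> + \<bar>grad smooth_step v * (- 1 / \<delta>) * smooth_step u\<bar>"
    by (rule abs_triangle_ineq)
  also have "\<dots> \<le> M * (1 / \<delta>) * 1 + M * (1 / \<delta>) * 1"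
    unfolding abs_mult using M M0 d smooth_step_bounds by (intro add_mono mult_mono) auto
  finally show ?thesis by simp
qed

lemma box_cutoff_prod:
  "box_cutoff \<delta> a b x = interval_cutoff \<delta> (fst a) (fst b) (fst x) * interval_cutoff \<delta> (snd a) (snd b) (snd x)"
  for a b x :: "real \<times> real"
proof -
  have B: "Basis = {(1, 0), (0, 1) :: real \<times> real}" by (auto simp: Basis_prod_def)
  show ?thesis unfolding box_cutoff_def B by (simp add: inner_prod_def)
qed

lemma box_cutoff_grad_le:
  fixes a b x :: "real \<times> real"
  assumes M: "\<forall>t. \<bar>grad smooth_step t\<bar> \<le> M" and d: "0 < \<delta>"
  shows "norm (grad (box_cutoff \<delta> a b) x) \<le> 4 * M / \<delta>"
proof -
  let ?f = "interval_cutoff \<delta> (fst a) (fst b)" and ?g = "interval_cutoff \<delta> (snd a) (snd b)"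
  have D: "(interval_cutoff \<delta> \<alpha> \<beta> has_real_derivative grad (interval_cutoff \<delta> \<alpha> \<beta>) t) (at t)" for \<alpha> \<beta> t
    using Ck_imp_GDERIV[OF Ck_interval_cutoff, of \<delta> \<alpha> \<beta> t] by (simp only: gderiv_deriv)
  have P: "GDERIV (\<lambda>x::real \<times> real. fst x) x :> (1, 0)" "GDERIV (\<lambda>x::real \<times> real. snd x) x :> (0, 1)"
    by (auto simp: gderiv_def inner_prod_def intro!: derivative_eq_intros)
  from GDERIV_mult[OF GDERIV_DERIV_compose[OF P(1) D[of "fst a" "fst b"]] GDERIV_DERIV_compose[OF P(2) D[of "snd a" "snd b"]]]
  have "grad (box_cutoff \<delta> a b) x = ?f (fst x) *\<^sub>R grad ?g (snd x) *\<^sub>R (0, 1) + ?g (snd x) *\<^sub>R grad ?f (fst x) *\<^sub>R (1, 0)"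
    unfolding box_cutoff_prod[abs_def] by (rule grad_eqI)
  also have "norm \<dots> \<le> \<bar>?f (fst x)\<bar> * \<bar>grad ?g (snd x)\<bar> + \<bar>?g (snd x)\<bar> * \<bar>grad ?f (fst x)\<bar>"
    by (rule order_trans[OF norm_triangle_ineq]) (simp add: norm_prod_def abs_mult)
  also have "\<dots> \<le> 1 * (2 * M / \<delta>) + 1 * (2 * M / \<delta>)"
    using interval_cutoff_bounds interval_cutoff_deriv_le[OF M d] by (intro add_mono mult_mono) auto
  finally show ?thesis by simp
qed

lemma box_cutoff_grad_eq_0:
  assumes d: "0 < \<delta>" and x: "x \<in> box (a + (2 * \<delta>) *\<^sub>R One) (b - (2 * \<delta>) *\<^sub>R One)"
  shows "grad (box_cutoff \<delta> a b) x = 0"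
proof -
  let ?B = "box (a + (2 * \<delta>) *\<^sub>R One) (b - (2 * \<delta>) *\<^sub>R One)"
  have one: "1 = box_cutoff \<delta> a b y" if "y \<in> ?B" for y
    using that d by (intro box_cutoff_eq_1[symmetric]) (auto simp: mem_box inner_simps)
  have "(box_cutoff \<delta> a b has_derivative (\<lambda>h. 0)) (at x)"
    by (rule has_derivative_transform_within_open[OF has_derivative_const[of 1], where s = ?B]) (use x one in auto)
  then have "GDERIV (box_cutoff \<delta> a b) x :> 0" by (simp add: gderiv_def)
  then show ?thesis by (rule grad_eqI)
qed

definition square_cutoff :: "real \<Rightarrow> real \<times> real \<Rightarrow> real \<Rightarrow> real \<times> real \<Rightarrow> real" where
  "square_cutoff H c \<delta> = box_cutoff \<delta> c (c + (H, H))"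

lemma One_prod_real: "(One :: real \<times> real) = (1, 1)"
  by (simp add: Basis_prod_def prod_eq_iff fst_sum snd_sum sum.union_disjoint sum.reindex inj_on_def)

lemma square_cutoff_inside:
  assumes "0 < \<delta>" "x \<in> box c (c + (H, H)) - square_frame H c (3 * \<delta>)"
  shows "square_cutoff H c \<delta> x = 1" "grad (square_cutoff H c \<delta>) x = 0"
proof -
  obtain p q where c: "c = (p, q)" by force
  obtain s t where x: "x = (s, t)" by force
  have *: "(s, t) \<in> box (c + (2 * \<delta>) *\<^sub>R One) (c + (H, H) - (2 * \<delta>) *\<^sub>R One)"
    using assms unfolding One_prod_real square_frame_def c x by (auto simp: box_real_Pair cbox_Pair_eq)
  then show "grad (square_cutoff H c \<delta>) x = 0"
    unfolding square_cutoff_def x using assms(1) by (intro box_cutoff_grad_eq_0)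
  show "square_cutoff H c \<delta> x = 1"
    unfolding square_cutoff_def x using * assms(1) by (intro box_cutoff_eq_1) (auto simp: mem_box inner_simps)
qed

lemma square_frame_measurable [simp]: "square_frame H c d \<in> sets lebesgue"
  and square_frame_subset: "square_frame H c d \<subseteq> box c (c + (H, H))"
  by (auto simp: square_frame_def)

text \<open>Multiplication by the cutoff changes \<open>\<eta>\<close> only in the frame of width \<open>3 * \<delta>\<close>, and there the gradient of
  the cutoff is of size \<open>1 / \<delta>\<close>. The dangerous term is \<open>\<eta>\<close> times this gradient: by the bound for frames its
  squared norm is of order $\delta^{-2}(\delta H \tau + \delta^2 \|\nabla\eta\|^2)$, with the gradient
  measured on the frame. It becomes small when the frame shrinks, provided that \<open>\<tau>\<close>, the size of \<open>\<eta>\<close> on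
  the edges, is small compared with \<open>\<delta>\<close>. The constant depends on the shape of the cutoff only.\<close>

lemma cutoff_estimate:
  obtains K where "0 < K"
    "\<And>H c \<delta> \<eta> \<tau>. \<lbrakk>\<And>k. Ck k \<eta>; 0 < \<delta>; 3 * \<delta> \<le> H;
        \<And>p q. (p, q) \<in> edges H c \<Longrightarrow> (L2_norm {0..1} (\<eta> \<circ> linepath p q))\<^sup>2 \<le> \<tau>\<rbrakk> \<Longrightarrow>
      (L2_norm (box c (c + (H, H))) (\<lambda>x. square_cutoff H c \<delta> x * \<eta> x - \<eta> x))\<^sup>2
        \<le> (L2_norm (square_frame H c (3 * \<delta>)) \<eta>)\<^sup>2 \<and>
      (L2_norm (box c (c + (H, H))) (\<lambda>x. grad (\<lambda>x. square_cutoff H c \<delta> x * \<eta> x) x - grad \<eta> x))\<^sup>2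
        \<le> K * ((L2_norm (square_frame H c (3 * \<delta>)) (grad \<eta>))\<^sup>2 + H * \<tau> / \<delta>)"
proof -
  obtain M where M: "\<forall>t. \<bar>grad smooth_step t\<bar> \<le> M" using smooth_step_deriv_bounded by blast
  define B where "B = 4 * M"
  define K where "K = 2 + 144 * B\<^sup>2"
  have K: "0 < K" by (simp add: K_def add_pos_nonneg)
  show thesis
  proof (rule that[OF K])
    fix H c \<delta> and \<eta> :: "real \<times> real \<Rightarrow> real" and \<tau>
    assume eta: "\<And>k. Ck k \<eta>" and d: "0 < \<delta>" "3 * \<delta> \<le> H"
      and \<tau>: "\<And>p q. (p, q) \<in> edges H c \<Longrightarrow> (L2_norm {0..1} (\<eta> \<circ> linepath p q))\<^sup>2 \<le> \<tau>"
    let ?D = "box c (c + (H, H))" and ?F = "square_frame H c (3 * \<delta>)"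
    let ?\<chi> = "square_cutoff H c \<delta>"
    interpret C1_plane \<eta> "grad \<eta>" by (rule C1_plane_smooth[OF eta])
    have chi: "Ck k ?\<chi>" for k unfolding square_cutoff_def by (rule Ck_box_cutoff)
    have cont: "continuous_on UNIV \<eta>" "continuous_on UNIV ?\<chi>" "continuous_on UNIV (grad \<eta>)" "continuous_on UNIV (grad ?\<chi>)"
      using eta[of 0] chi[of 0] continuous_grad[OF eta] continuous_grad[OF chi] by simp_all
    have b01: "norm (?\<chi> x - 1) \<le> 1" for x
      using box_cutoff_bounds[of \<delta> c "c + (H, H)" x] by (simp add: square_cutoff_def)
    have bF: "bounded ?F" using square_frame_subset by (rule bounded_subset[OF bounded_box])
    have sq: "sq_integrable T f" if "continuous_on UNIV f" "T = ?D \<or> T = ?F" for f :: "real \<times> real \<Rightarrow> 'b::euclidean_space" and T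
      using that bF by (intro sq_integrable_continuous) auto
    have supp: "L2_norm ?D f = L2_norm ?F f" if "\<And>x. x \<in> ?D - ?F \<Longrightarrow> f x = 0" for f :: "real \<times> real \<Rightarrow> 'b::euclidean_space"
      using that square_frame_subset by (intro L2_norm_support) auto
    have 0: "(L2_norm ?D (\<lambda>x. (?\<chi> x - 1) *\<^sub>R f x))\<^sup>2 \<le> (L2_norm ?F f)\<^sup>2"
      if f: "continuous_on UNIV f" for f :: "real \<times> real \<Rightarrow> 'b::euclidean_space"
    proof -
      have "L2_norm ?D (\<lambda>x. (?\<chi> x - 1) *\<^sub>R f x) = L2_norm ?F (\<lambda>x. (?\<chi> x - 1) *\<^sub>R f x)"
        by (rule supp) (simp add: square_cutoff_inside(1)[OF d(1)])
      also have "\<dots>\<^sup>2 \<le> (L2_norm ?F f)\<^sup>2"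
        using b01 cont f by (intro L2_norm_mono sq) (auto intro!: continuous_intros mult_left_le_one_le)
      finally show ?thesis .
    qed
    have "(L2_norm ?D (\<lambda>x. \<eta> x *\<^sub>R grad ?\<chi> x))\<^sup>2 = (L2_norm ?F (\<lambda>x. \<eta> x *\<^sub>R grad ?\<chi> x))\<^sup>2"
      using supp[of "\<lambda>x. \<eta> x *\<^sub>R grad ?\<chi> x"] square_cutoff_inside(2)[OF d(1)] by simp
    also have "\<dots> \<le> (L2_norm ?F (\<lambda>x. (B / \<delta>) *\<^sub>R \<eta> x))\<^sup>2"
    proof (intro L2_norm_mono sq)
      fix x
      have "norm (grad ?\<chi> x) \<le> B / \<delta>" unfolding square_cutoff_def B_def by (rule box_cutoff_grad_le[OF M d(1)])
      then have "norm (\<eta> x *\<^sub>R grad ?\<chi> x) \<le> norm (\<eta> x) * (B / \<delta>)"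
        by (simp only: norm_scaleR real_norm_def mult_left_mono[OF _ abs_ge_zero])
      also have "\<dots> \<le> norm ((B / \<delta>) *\<^sub>R \<eta> x)"
        unfolding norm_scaleR mult.commute[of "norm (\<eta> x)"] by (intro mult_right_mono abs_ge_self norm_ge_zero)
      finally show "norm (\<eta> x *\<^sub>R grad ?\<chi> x) \<le> norm ((B / \<delta>) *\<^sub>R \<eta> x)" .
    qed (use cont d in \<open>auto intro!: continuous_intros\<close>)
    also have "\<dots> = (B / \<delta>)\<^sup>2 * (L2_norm ?F \<eta>)\<^sup>2"
      using cont by (intro sq_integrable_scaleR(2) sq) auto
    also have "\<dots> \<le> (B / \<delta>)\<^sup>2 * (8 * (3 * \<delta>) * H * \<tau> + 8 * (3 * \<delta>)\<^sup>2 * (L2_norm ?F (grad \<eta>))\<^sup>2)"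
      using frame_L2_norm_le[of "3 * \<delta>" H c \<tau>] d \<tau> by (intro mult_left_mono) auto
    also have "\<dots> = B\<^sup>2 * (24 * (H * \<tau> / \<delta>) + 72 * (L2_norm ?F (grad \<eta>))\<^sup>2)"
      using d(1) by (simp add: field_simps power2_eq_square)
    finally have 1: "(L2_norm ?D (\<lambda>x. \<eta> x *\<^sub>R grad ?\<chi> x))\<^sup>2 \<le> B\<^sup>2 * (24 * (H * \<tau> / \<delta>) + 72 * (L2_norm ?F (grad \<eta>))\<^sup>2)" .
    have eq: "grad (\<lambda>x. ?\<chi> x * \<eta> x) x - grad \<eta> x = (?\<chi> x - 1) *\<^sub>R grad \<eta> x + \<eta> x *\<^sub>R grad ?\<chi> x" for x
      unfolding grad_mult[OF chi eta] by (simp add: scaleR_diff_left)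
    have "(c, c + (H, 0)) \<in> edges H c" by (simp add: edges_def)
    then have \<tau>0: "0 \<le> \<tau>" using \<tau> zero_le_power2 order_trans by blast
    have "(L2_norm ?D (\<lambda>x. grad (\<lambda>x. ?\<chi> x * \<eta> x) x - grad \<eta> x))\<^sup>2
        \<le> 2 * (L2_norm ?D (\<lambda>x. (?\<chi> x - 1) *\<^sub>R grad \<eta> x))\<^sup>2 + 2 * (L2_norm ?D (\<lambda>x. \<eta> x *\<^sub>R grad ?\<chi> x))\<^sup>2"
      unfolding eq using cont by (intro sq_integrable_add sq) (auto intro!: continuous_intros)
    also have "\<dots> \<le> 2 * (L2_norm ?F (grad \<eta>))\<^sup>2 + 2 * (B\<^sup>2 * (24 * (H * \<tau> / \<delta>) + 72 * (L2_norm ?F (grad \<eta>))\<^sup>2))"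
      using 0[OF cont(3)] 1 by linarith
    also have "\<dots> \<le> K * ((L2_norm ?F (grad \<eta>))\<^sup>2 + H * \<tau> / \<delta>)"
    proof -
      define X where "X = H * \<tau> / \<delta>"
      have "0 \<le> X" "0 \<le> B\<^sup>2 * X" using d \<tau>0 by (auto simp: X_def)
      then show ?thesis unfolding X_def[symmetric] by (simp add: K_def algebra_simps)
    qed
    finally show "(L2_norm ?D (\<lambda>x. ?\<chi> x * \<eta> x - \<eta> x))\<^sup>2 \<le> (L2_norm ?F \<eta>)\<^sup>2 \<and>
      (L2_norm ?D (\<lambda>x. grad (\<lambda>x. ?\<chi> x * \<eta> x) x - grad \<eta> x))\<^sup>2 \<le> K * ((L2_norm ?F (grad \<eta>))\<^sup>2 + H * \<tau> / \<delta>)"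
      using 0[OF cont(1)] by (simp add: left_diff_distrib)
  qed
qed

text \<open>The left side of the square, where \<open>v\<close> vanishes, serves as the reference line.\<close>

lemma test_function_Poincare:
  assumes v: "test_function (box c (c + (H, H))) v" and H: "0 < H"
  shows "(L2_norm (box c (c + (H, H))) v)\<^sup>2 \<le> 2 * H\<^sup>2 * (L2_norm (box c (c + (H, H))) (grad v))\<^sup>2"
proof -
  obtain x y where c: "c = (x, y)" by force
  interpret C1_plane v "grad v" by (rule C1_plane_smooth[OF test_functionD(5)[OF v]])
  have "v (x, t) = 0" for t using test_functionD(4)[OF v, of "(x, t)"] by (simp add: c box_real_Pair)
  then have "integral {y..y + H} (\<lambda>t. (v (x, t))\<^sup>2) = 0" by simp
  then show ?thesis using strip_L2_norm_le[of x x "x + H" y "y + H"] H by (simp add: c)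
qed

text \<open>A test function of the unit square vanishes on the coordinate axes, and every edge is joined to the
  parallel axis by lines of length at most one inside the square.\<close>

lemma test_function_edge_le:
  assumes v: "test_function unit_square v" and H: "0 < H" and sub: "cbox c (c + (H, H)) \<subseteq> cbox (0, 0) (1, 1)"
    and e: "(p, q) \<in> edges H c"
  shows "H * (L2_norm {0..1} (v \<circ> linepath p q))\<^sup>2 \<le> (L2_norm unit_square (grad v))\<^sup>2"
proof -
  obtain x y where c: "c = (x, y)" by force
  interpret C1_plane v "grad v" by (rule C1_plane_smooth[OF test_functionD(5)[OF v]])
  have "(x, y) \<in> cbox c (c + (H, H))" "(x + H, y + H) \<in> cbox c (c + (H, H))"
    using H by (simp_all add: c cbox_Pair_eq)
  from this[THEN subsetD[OF sub]] have xy: "0 \<le> x" "0 \<le> y" "x + H \<le> 1" "y + H \<le> 1" by (auto simp: cbox_Pair_eq)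
  have z: "v (0, t) = 0" "v (t, 0) = 0" for t
    using test_functionD(4)[OF v] by (auto simp: unit_square_def box_real_Pair)
  have L: "(L2_norm T (grad v))\<^sup>2 \<le> (L2_norm unit_square (grad v))\<^sup>2" if "T \<subseteq> unit_square" "T \<in> sets lebesgue" for T
    using that by (intro sq_integrable_subset(2) sq_integrable_fun(2)) (auto simp: unit_square_def)
  have "box (0, y) (1, y + H) \<subseteq> unit_square" "box (x, 0) (x + H, 1) \<subseteq> unit_square"
    using xy by (auto simp: unit_square_def box_real_Pair)
  from this[THEN L] have V: "(L2_norm (box (0, y) (1, y + H)) (grad v))\<^sup>2 \<le> (L2_norm unit_square (grad v))\<^sup>2"
    "(L2_norm (box (x, 0) (x + H, 1)) (grad v))\<^sup>2 \<le> (L2_norm unit_square (grad v))\<^sup>2"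
    by auto
  have ve: "H * (L2_norm {0..1} (v \<circ> linepath (s, y) (s, y + H)))\<^sup>2 \<le> (L2_norm unit_square (grad v))\<^sup>2" if "s \<in> {0..1}" for s
    using vertical_edge_diff[OF H that, of 0 y] z V(1) by simp
  have he: "H * (L2_norm {0..1} (v \<circ> linepath (x, s) (x + H, s)))\<^sup>2 \<le> (L2_norm unit_square (grad v))\<^sup>2" if "s \<in> {0..1}" for s
    using horizontal_edge_diff[OF H that, of 0 x] z V(2) by simp
  show ?thesis
    using e ve[of x] ve[of "x + H"] he[of y] he[of "y + H"] xy H unfolding c edges_Pair by auto
qed


section \<open>Limits of square-integrable functions\<close>

text \<open>The proof of the Riesz-Fischer theorem: under a geometric rate the increments are summable in
  $L^1$, so the sequence converges almost everywhere, and Fatou's lemma bounds the distance to the limit.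
  The limit is the pointwise one. Hence the limits on different, possibly overlapping, edges are
  restrictions of a single function on the plane.\<close>

lemma L2_Cauchy_imp_tendsto_lim:
  fixes f :: "nat \<Rightarrow> 'a::euclidean_space \<Rightarrow> real"
  assumes S: "bounded S" "S \<in> sets lebesgue" and f: "\<And>l. sq_integrable S (f l)"
    and cauchy: "\<And>l m. (L2_norm S (\<lambda>x. f l x - f m x))\<^sup>2 \<le> K * ((1/4)^l + (1/4)^m)"
  defines "G \<equiv> \<lambda>x. lim (\<lambda>l. f l x)"
  shows "sq_integrable S G" and "(\<lambda>l. (L2_norm S (\<lambda>x. f l x - G x))\<^sup>2) \<longlonglongrightarrow> 0"
proof -
  let ?M = "lebesgue_on S"
  have fm [measurable]: "f l \<in> borel_measurable ?M" for l using f by (simp add: sq_integrable_def)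
  have Gm [measurable]: "G \<in> borel_measurable ?M" unfolding G_def by measurable
  have K: "0 \<le> K" using order_trans[OF zero_le_power2 cauchy[of 0 0]] by simp
  have one: "sq_integrable S (\<lambda>x. 1::real)" using S by (intro sq_integrable_continuous) auto
  define d where "d l x = \<bar>f (Suc l) x - f l x\<bar>" for l x
  have d_nonneg: "0 \<le> d l x" for l x by (simp add: d_def)
  have sqd: "sq_integrable S (d l)" "(L2_norm S (d l))\<^sup>2 \<le> 2 * K * (1/4)^l" for l
  proof -
    have "sq_integrable S (\<lambda>x. f (Suc l) x - f l x)" using f by (intro sq_integrable_diff)
    then show "sq_integrable S (d l)" by (auto simp: sq_integrable_def d_def[abs_def])
    have "L2_norm S (d l) = L2_norm S (\<lambda>x. f (Suc l) x - f l x)" by (simp add: L2_norm_def d_def)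
    then have "(L2_norm S (d l))\<^sup>2 \<le> K * ((1/4)^Suc l + (1/4)^l)" by (simp only: cauchy)
    also have "\<dots> \<le> K * (2 * (1/4)^l)" using K by (intro mult_left_mono) auto
    finally show "(L2_norm S (d l))\<^sup>2 \<le> 2 * K * (1/4)^l" by simp
  qed
  define V where "V = (L2_norm S (\<lambda>x. 1::real))\<^sup>2"
  have int_d: "integrable ?M (d l)" for l using sqd(1) S by (rule sq_integrable_imp_integrable)
  have L1: "(\<integral>x. d l x \<partial>?M) \<le> (K + V) * (1/2)^l" for l
  proof -
    \<comment> \<open>the weight \<open>2 ^ l\<close> balances the decay \<open>(1/4) ^ l\<close> against the measure of \<open>S\<close>\<close>
    have "2 * (\<integral>x. d l x \<bullet> 1 \<partial>?M) \<le> 2^l * (L2_norm S (d l))\<^sup>2 + V / 2^l"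
      unfolding V_def by (rule integral_two_inner_le[OF sqd(1) one]) simp
    also have "\<dots> \<le> 2^l * (2 * K * (1/4)^l) + V / 2^l" using sqd(2) by (intro add_mono mult_left_mono) auto
    also have "\<dots> = (2 * K + V) * (1/2)^l"
      by (simp add: power_divide field_simps flip: power_mult_distrib)
    also have "\<dots> \<le> 2 * ((K + V) * (1/2)^l)" by (simp add: V_def algebra_simps)
    finally show ?thesis by simp
  qed
  have "(\<integral>\<^sup>+x. (\<Sum>l. ennreal (d l x)) \<partial>?M) = (\<Sum>l. \<integral>\<^sup>+x. ennreal (d l x) \<partial>?M)"
    using int_d by (intro nn_integral_suminf) auto
  also have "\<dots> = (\<Sum>l. ennreal (\<integral>x. d l x \<partial>?M))"
    using int_d by (intro arg_cong[where f = suminf] ext nn_integral_eq_integral) (auto simp: d_nonneg)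
  also have "\<dots> \<le> (\<Sum>l. ennreal ((K + V) * (1/2)^l))"
    using L1 by (intro suminf_le) (auto intro: ennreal_leI)
  also have "\<dots> < \<infinity>"
    using K by (subst suminf_ennreal2) (auto simp: V_def intro!: summable_mult summable_geometric)
  finally have "AE x in ?M. (\<Sum>l. ennreal (d l x)) \<noteq> \<infinity>"
    using int_d by (intro nn_integral_PInf_AE) auto
  then have lim: "AE x in ?M. (\<lambda>l. f l x) \<longlonglongrightarrow> G x"
  proof eventually_elim
    case (elim x)
    have "summable (\<lambda>l. d l x)"
      using elim by (intro summable_suminf_not_top) (auto simp: d_def)
    then have "summable (\<lambda>l. f (Suc l) x - f l x)"
      unfolding d_def by (rule summable_rabs_cancel)
    then have "convergent (\<lambda>n. \<Sum>l<n. f (Suc l) x - f l x)" by (simp add: summable_iff_convergent)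
    then have "convergent (\<lambda>n. f n x - f 0 x)"
      unfolding sum_lessThan_telescope[of "\<lambda>l. f l x"] .
    then have "convergent (\<lambda>n. (f n x - f 0 x) + f 0 x)" by (intro convergent_add convergent_const)
    then show ?case by (simp add: G_def convergent_LIMSEQ_iff)
  qed
  have fatou: "(\<integral>\<^sup>+x. ennreal ((norm (f l x - G x))\<^sup>2) \<partial>?M) \<le> ennreal (2 * K * (1/4)^l)" for l
  proof -
    have sql: "integrable ?M (\<lambda>x. (norm (f l x - f m x))\<^sup>2)" for m
      using sq_integrable_diff(1)[OF f f, of l m] by (simp add: sq_integrable_def)
    have "(\<integral>\<^sup>+x. ennreal ((norm (f l x - G x))\<^sup>2) \<partial>?M) = (\<integral>\<^sup>+x. liminf (\<lambda>m. ennreal ((norm (f l x - f m x))\<^sup>2)) \<partial>?M)"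
      using lim
    proof (intro nn_integral_cong_AE, eventually_elim)
      case (elim x)
      have "(\<lambda>m. ennreal ((norm (f l x - f m x))\<^sup>2)) \<longlonglongrightarrow> ennreal ((norm (f l x - G x))\<^sup>2)"
        by (intro tendsto_ennrealI tendsto_intros elim)
      then show ?case by (intro lim_imp_Liminf[symmetric]) auto
    qed
    also have "\<dots> \<le> liminf (\<lambda>m. \<integral>\<^sup>+x. ennreal ((norm (f l x - f m x))\<^sup>2) \<partial>?M)"
      by (rule nn_integral_liminf) measurable
    also have "\<dots> \<le> limsup (\<lambda>m. \<integral>\<^sup>+x. ennreal ((norm (f l x - f m x))\<^sup>2) \<partial>?M)"
      by (rule Liminf_le_Limsup) simp
    also have "\<dots> \<le> ennreal (2 * K * (1/4)^l)"
    proof (rule Limsup_bounded)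
      show "\<forall>\<^sub>F m in sequentially. (\<integral>\<^sup>+x. ennreal ((norm (f l x - f m x))\<^sup>2) \<partial>?M) \<le> ennreal (2 * K * (1/4)^l)"
        using eventually_ge_at_top[of l]
      proof eventually_elim
        case (elim m)
        have "(\<integral>\<^sup>+x. ennreal ((norm (f l x - f m x))\<^sup>2) \<partial>?M) = ennreal ((L2_norm S (\<lambda>x. f l x - f m x))\<^sup>2)"
          using sql unfolding L2_norm_sq by (intro nn_integral_eq_integral) auto
        moreover have "(1/4::real)^m \<le> (1/4)^l" using elim by (intro power_decreasing) auto
        then have "K * ((1/4)^l + (1/4)^m) \<le> K * (2 * (1/4)^l)" using K by (intro mult_left_mono) auto
        then have "(L2_norm S (\<lambda>x. f l x - f m x))\<^sup>2 \<le> 2 * K * (1/4)^l"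
          using cauchy[of l m] by simp
        ultimately show ?case by (simp add: ennreal_leI)
      qed
    qed
    finally show ?thesis .
  qed
  have sqG: "sq_integrable S (\<lambda>x. f l x - G x)" for l
  proof -
    have "integrable ?M (\<lambda>x. (norm (f l x - G x))\<^sup>2)"
    proof (rule integrableI_nonneg)
      show "(\<integral>\<^sup>+x. ennreal ((norm (f l x - G x))\<^sup>2) \<partial>?M) < \<infinity>"
        using fatou[of l] by (rule order_le_less_trans) simp
    qed auto
    then show ?thesis by (simp add: sq_integrable_def)
  qed
  have "sq_integrable S (\<lambda>x. f 0 x - (f 0 x - G x))" by (intro sq_integrable_diff f sqG)
  then show "sq_integrable S G" by simp
  have "(L2_norm S (\<lambda>x. f l x - G x))\<^sup>2 \<le> 2 * K * (1/4)^l" for l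
  proof -
    have "(\<integral>\<^sup>+x. ennreal ((norm (f l x - G x))\<^sup>2) \<partial>?M) = ennreal ((L2_norm S (\<lambda>x. f l x - G x))\<^sup>2)"
      unfolding L2_norm_sq using sqG[of l] by (intro nn_integral_eq_integral) (auto simp: sq_integrable_def)
    then show ?thesis using fatou[of l] K by simp
  qed
  note le = this
  have "(\<lambda>l. (1/4::real)^l) \<longlonglongrightarrow> 0" by (rule LIMSEQ_power_zero) simp
  then have "(\<lambda>l. 2 * K * (1/4)^l) \<longlonglongrightarrow> 0" by (rule tendsto_mult_right_zero)
  then show "(\<lambda>l. (L2_norm S (\<lambda>x. f l x - G x))\<^sup>2) \<longlonglongrightarrow> 0"
    by (rule tendsto_sandwich[OF _ _ tendsto_const, rotated 2]) (auto intro!: always_eventually le)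
qed


section \<open>Functions with zero boundary values\<close>

lemma tendsto_0_of_nonneg_sum:
  fixes a b :: "nat \<Rightarrow> real"
  assumes "\<And>k. 0 \<le> a k" "\<And>k. 0 \<le> b k"
  shows "(\<lambda>k. a k + b k) \<longlonglongrightarrow> 0 \<longleftrightarrow> a \<longlonglongrightarrow> 0 \<and> b \<longlonglongrightarrow> 0"
proof
  assume l: "(\<lambda>k. a k + b k) \<longlonglongrightarrow> 0"
  show "a \<longlonglongrightarrow> 0 \<and> b \<longlonglongrightarrow> 0"
    using assms by (auto intro!: tendsto_sandwich[OF _ _ tendsto_const l] always_eventually)
qed (use tendsto_add[of a 0 sequentially b 0] in simp)

lemma L2_norm_tendsto_add:
  assumes "\<And>k. sq_integrable S (f k)" "\<And>k. sq_integrable S (g k)"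
    and "(\<lambda>k. (L2_norm S (f k))\<^sup>2) \<longlonglongrightarrow> 0" "(\<lambda>k. (L2_norm S (g k))\<^sup>2) \<longlonglongrightarrow> 0"
  shows "(\<lambda>k. (L2_norm S (\<lambda>x. f k x + g k x))\<^sup>2) \<longlonglongrightarrow> 0"
proof (rule tendsto_sandwich[OF _ _ tendsto_const])
  show "(\<lambda>k. 2 * (L2_norm S (f k))\<^sup>2 + 2 * (L2_norm S (g k))\<^sup>2) \<longlonglongrightarrow> 0"
    using tendsto_add[OF tendsto_mult_right_zero[OF assms(3)] tendsto_mult_right_zero[OF assms(4)]] by simp
  show "\<forall>\<^sub>F k in sequentially. (L2_norm S (\<lambda>x. f k x + g k x))\<^sup>2 \<le> 2 * (L2_norm S (f k))\<^sup>2 + 2 * (L2_norm S (g k))\<^sup>2"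
    by (intro always_eventually allI sq_integrable_add(2) assms)
qed simp

lemma L2_norm_tendsto_scale:
  assumes "\<And>k. sq_integrable S (f k)" "(\<lambda>k. (L2_norm S (f k))\<^sup>2) \<longlonglongrightarrow> 0"
  shows "(\<lambda>k. (L2_norm S (\<lambda>x. r *\<^sub>R f k x))\<^sup>2) \<longlonglongrightarrow> 0"
  using tendsto_mult_right_zero[OF assms(2), of "r\<^sup>2"] by (simp add: sq_integrable_scaleR(2)[OF assms(1)])

lemma L2_norm_zero [simp]: "L2_norm S (\<lambda>x. 0) = 0"
  by (simp add: L2_norm_def)

context bounded_open
begin

lemma H1_approxD:
  assumes "H1_approx S \<phi> u" "H1_gradient S u g"
  shows "\<And>k. test_function S (\<phi> k)"
    "\<And>k. sq_integrable S (\<lambda>x. \<phi> k x - u x)" "\<And>k. sq_integrable S (\<lambda>x. grad (\<phi> k) x - g x)"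
    "(\<lambda>k. (L2_norm S (\<lambda>x. \<phi> k x - u x))\<^sup>2) \<longlonglongrightarrow> 0"
    "(\<lambda>k. (L2_norm S (\<lambda>x. grad (\<phi> k) x - g x))\<^sup>2) \<longlonglongrightarrow> 0"
proof -
  show t: "test_function S (\<phi> k)" for k using assms(1) by (simp add: H1_approx_def)
  show "sq_integrable S (\<lambda>x. \<phi> k x - u x)" "sq_integrable S (\<lambda>x. grad (\<phi> k) x - g x)" for k
    using assms(2) sq_integrable_test_function[OF t bounded_S S_lebesgue]
    by (auto simp: H1_gradient_def intro!: sq_integrable_diff)
  show "(\<lambda>k. (L2_norm S (\<lambda>x. \<phi> k x - u x))\<^sup>2) \<longlonglongrightarrow> 0"
    "(\<lambda>k. (L2_norm S (\<lambda>x. grad (\<phi> k) x - g x))\<^sup>2) \<longlonglongrightarrow> 0"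
    using assms(1) unfolding H1_approx_iff[OF assms(2)] by (simp_all add: tendsto_0_of_nonneg_sum)
qed

lemma H1_approxI:
  assumes "H1_gradient S u g" "\<And>k. test_function S (\<phi> k)"
    "(\<lambda>k. (L2_norm S (\<lambda>x. \<phi> k x - u x))\<^sup>2) \<longlonglongrightarrow> 0"
    "(\<lambda>k. (L2_norm S (\<lambda>x. grad (\<phi> k) x - g x))\<^sup>2) \<longlonglongrightarrow> 0"
  shows "H1_approx S \<phi> u"
  unfolding H1_approx_iff[OF assms(1)] using assms by (simp add: tendsto_0_of_nonneg_sum)

lemma H1_approx_add:
  assumes u: "H1_gradient S u g" "H1_approx S \<phi> u" and v: "H1_gradient S v h" "H1_approx S \<psi> v"
  shows "H1_approx S (\<lambda>k x. \<phi> k x + \<psi> k x) (\<lambda>x. u x + v x)"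
proof (rule H1_approxI[OF H1_gradient_add[OF u(1) v(1)]])
  note U = H1_approxD[OF u(2,1)] and V = H1_approxD[OF v(2,1)]
  show "test_function S (\<lambda>x. \<phi> k x + \<psi> k x)" for k using U V by (intro test_function_add)
  have "(\<lambda>k. (L2_norm S (\<lambda>x. (\<phi> k x - u x) + (\<psi> k x - v x)))\<^sup>2) \<longlonglongrightarrow> 0"
    by (intro L2_norm_tendsto_add U V)
  then show "(\<lambda>k. (L2_norm S (\<lambda>x. \<phi> k x + \<psi> k x - (u x + v x)))\<^sup>2) \<longlonglongrightarrow> 0"
    by (simp add: algebra_simps)
  have "(\<lambda>k. (L2_norm S (\<lambda>x. (grad (\<phi> k) x - g x) + (grad (\<psi> k) x - h x)))\<^sup>2) \<longlonglongrightarrow> 0"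
    by (intro L2_norm_tendsto_add U V)
  then show "(\<lambda>k. (L2_norm S (\<lambda>x. grad (\<lambda>x. \<phi> k x + \<psi> k x) x - (g x + h x)))\<^sup>2) \<longlonglongrightarrow> 0"
    by (simp add: algebra_simps grad_add[OF test_functionD(5)[OF U(1)] test_functionD(5)[OF V(1)]])
qed

lemma H1_approx_scale:
  assumes u: "H1_gradient S u g" "H1_approx S \<phi> u"
  shows "H1_approx S (\<lambda>k x. r * \<phi> k x) (\<lambda>x. r * u x)"
proof (rule H1_approxI[OF H1_gradient_scale[OF u(1)]])
  note U = H1_approxD[OF u(2,1)]
  show "test_function S (\<lambda>x. r * \<phi> k x)" for k using U by (intro test_function_cmult)
  show "(\<lambda>k. (L2_norm S (\<lambda>x. r * \<phi> k x - r * u x))\<^sup>2) \<longlonglongrightarrow> 0"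
    using L2_norm_tendsto_scale[OF U(2,4), of r] by (simp add: right_diff_distrib)
  show "(\<lambda>k. (L2_norm S (\<lambda>x. grad (\<lambda>x. r * \<phi> k x) x - r *\<^sub>R g x))\<^sup>2) \<longlonglongrightarrow> 0"
    using L2_norm_tendsto_scale[OF U(3,5), of r]
    by (simp add: scaleR_diff_right grad_cmult[OF test_functionD(5)[OF U(1)]])
qed

lemma H1_approx_zero: "H1_approx S (\<lambda>k x. 0) (\<lambda>x. 0)"
  by (rule H1_approxI[OF H1_gradient_smooth[OF Ck_const]]) (auto intro: test_function_zero)

lemma H10_gradient: "u \<in> H10 S \<Longrightarrow> H1_gradient S u (weak_grad S u)"
  by (auto simp: H10_def intro: H1_gradient_weak_grad)

lemma H10_I: "H1_gradient S u g \<Longrightarrow> H1_approx S \<phi> u \<Longrightarrow> u \<in> H10 S"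
  by (auto simp: H10_def intro: H1_gradient_imp_H1)

lemma H10_add: "u \<in> H10 S \<Longrightarrow> v \<in> H10 S \<Longrightarrow> (\<lambda>x. u x + v x) \<in> H10 S"
  using H1_gradient_add[OF H10_gradient H10_gradient] H1_approx_add[OF H10_gradient _ H10_gradient]
  unfolding H10_def[of S] by (blast intro: H1_gradient_imp_H1)

lemma H10_scale: "u \<in> H10 S \<Longrightarrow> (\<lambda>x. r * u x) \<in> H10 S"
  using H1_gradient_scale[OF H10_gradient] H1_approx_scale[OF H10_gradient]
  unfolding H10_def[of S] by (blast intro: H1_gradient_imp_H1)

lemma H10_diff: "u \<in> H10 S \<Longrightarrow> v \<in> H10 S \<Longrightarrow> (\<lambda>x. u x - v x) \<in> H10 S"
  using H10_add[OF _ H10_scale[of v "-1"], of u] by simp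

lemma H10_zero: "(\<lambda>x. 0) \<in> H10 S"
  by (rule H10_I[OF H1_gradient_smooth[OF Ck_const] H1_approx_zero])

lemma H10_lincomb: "(\<And>i. i < (n::nat) \<Longrightarrow> \<phi> i \<in> H10 S) \<Longrightarrow> (\<lambda>x. \<Sum>i<n. \<alpha> i * \<phi> i x) \<in> H10 S"
proof (induction n)
  case (Suc n)
  then show ?case by (simp add: H10_add[OF Suc.IH H10_scale])
qed (simp add: H10_zero)

end

lemma bounded_open_box: "bounded_open (box a b)"
  by standard (auto intro: open_box bounded_box)

interpretation square: bounded_open unit_square
  unfolding unit_square_def by (rule bounded_open_box)

section \<open>Traces on the skeleton\<close>

lemma finite_edges [simp]: "finite (edges H c)"
  by (simp add: edges_def)

lemma finite_skeleton: "finite (skeleton H N c)"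
  by (simp add: skeleton_def)

lemma edges_nondegenerate: "0 < H \<Longrightarrow> (p, q) \<in> edges H c \<Longrightarrow> p \<noteq> q"
  by (cases c) (auto simp: edges_Pair)

lemma skel_L2_norm_tendsto_iff:
  assumes E: "finite E" "\<And>p q. (p, q) \<in> E \<Longrightarrow> p \<noteq> q"
  shows "(\<lambda>k. skel_L2_norm E (F k)) \<longlonglongrightarrow> 0 \<longleftrightarrow>
    (\<forall>(p, q)\<in>E. (\<lambda>k. (L2_norm {0..1} (F k \<circ> linepath p q))\<^sup>2) \<longlonglongrightarrow> 0)"
proof -
  define T where "T k e = dist (fst e) (snd e) * (L2_norm {0..1} (F k \<circ> linepath (fst e) (snd e)))\<^sup>2" for k and e :: "(real \<times> real) \<times> (real \<times> real)"
  have nn: "0 \<le> T k e" for k e by (simp add: T_def)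
  have sq: "(skel_L2_norm E (F k))\<^sup>2 = (\<Sum>e\<in>E. T k e)" for k
    using nn by (auto simp: skel_L2_norm_def T_def case_prod_unfold intro!: real_sqrt_pow2 sum_nonneg)
  have 1: "(\<lambda>k. skel_L2_norm E (F k)) \<longlonglongrightarrow> 0 \<longleftrightarrow> (\<lambda>k. \<Sum>e\<in>E. T k e) \<longlonglongrightarrow> 0"
    unfolding sq[symmetric] by simp
  have 2: "(\<lambda>k. \<Sum>e\<in>E. T k e) \<longlonglongrightarrow> 0 \<longleftrightarrow> (\<forall>e\<in>E. (\<lambda>k. T k e) \<longlonglongrightarrow> 0)"
  proof safe
    fix e assume l: "(\<lambda>k. \<Sum>e\<in>E. T k e) \<longlonglongrightarrow> 0" and e: "e \<in> E"
    show "(\<lambda>k. T k e) \<longlonglongrightarrow> 0"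
      by (rule tendsto_sandwich[OF _ _ tendsto_const l])
         (use nn E(1) e in \<open>auto intro!: always_eventually member_le_sum\<close>)
  qed (auto intro: tendsto_null_sum)
  have 3: "(\<lambda>k. T k e) \<longlonglongrightarrow> 0 \<longleftrightarrow> (\<lambda>k. (L2_norm {0..1} (F k \<circ> linepath (fst e) (snd e)))\<^sup>2) \<longlonglongrightarrow> 0"
    if "e \<in> E" for e
    using E(2)[of "fst e" "snd e"] that
      tendsto_mult_left_iff[of "dist (fst e) (snd e)" "\<lambda>k. (L2_norm {0..1} (F k \<circ> linepath (fst e) (snd e)))\<^sup>2" 0 sequentially]
    by (simp add: T_def)
  show ?thesis unfolding 1 2 using 3 by (auto simp: case_prod_unfold)
qed

lemma sq_integrable_edge:
  fixes \<phi> :: "real \<times> real \<Rightarrow> real"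
  assumes "continuous_on UNIV \<phi>"
  shows "sq_integrable {0..1} (\<phi> \<circ> linepath p q)"
proof -
  have "continuous_on UNIV (\<phi> \<circ> linepath p q)"
    unfolding linepath_def o_def by (intro continuous_on_compose2[OF assms] continuous_intros) auto
  then show ?thesis by (intro sq_integrable_continuous) auto
qed


text \<open>A degenerate edge has weight zero in \<open>skel_L2_norm\<close>, which then says nothing about the trace there.\<close>

definition edge_set :: "((real \<times> real) \<times> (real \<times> real)) set \<Rightarrow> bool" where
  "edge_set E \<longleftrightarrow> finite E \<and> (\<forall>(p, q)\<in>E. p \<noteq> q)"

lemma edge_set_skeleton:
  assumes "0 < H"
  shows "edge_set (skeleton H N c)"
  unfolding edge_set_def
proof (intro conjI finite_skeleton ballI, clarify)
  fix a b assume "((a, b), (a, b)) \<in> skeleton H N c"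
  then obtain j where "((a, b), (a, b)) \<in> edges H (c j)" by (auto simp: skeleton_def)
  from edges_nondegenerate[OF assms this] show False by simp
qed

text \<open>Makes the approximating sequence explicit, so that sums of functions can be paired with the sums of
  their sequences.\<close>

definition trace_approx ::
    "((real \<times> real) \<times> (real \<times> real)) set \<Rightarrow> (nat \<Rightarrow> real \<times> real \<Rightarrow> real) \<Rightarrow>
     (real \<times> real \<Rightarrow> real) \<Rightarrow> (real \<times> real \<Rightarrow> real) \<Rightarrow> bool" where
  "trace_approx E \<phi> w g \<longleftrightarrow> H1_approx unit_square \<phi> w \<and>
    (\<forall>(p, q)\<in>E. sq_integrable {0..1} (g \<circ> linepath p q) \<and>
      (\<lambda>k. (L2_norm {0..1} (\<lambda>t. \<phi> k (linepath p q t) - g (linepath p q t)))\<^sup>2) \<longlonglongrightarrow> 0)"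

lemma is_trace_iff:
  assumes "edge_set E"
  shows "is_trace E w g \<longleftrightarrow> (\<exists>\<phi>. trace_approx E \<phi> w g)"
proof -
  have E: "finite E" "\<And>p q. (p, q) \<in> E \<Longrightarrow> p \<noteq> q" using assms by (auto simp: edge_set_def)
  have "(\<lambda>k. skel_L2_norm E (\<lambda>x. \<phi> k x - g x)) \<longlonglongrightarrow> 0 \<longleftrightarrow>
      (\<forall>(p, q)\<in>E. (\<lambda>k. (L2_norm {0..1} (\<lambda>t. \<phi> k (linepath p q t) - g (linepath p q t)))\<^sup>2) \<longlonglongrightarrow> 0)"
    for \<phi> :: "nat \<Rightarrow> real \<times> real \<Rightarrow> real"
    using skel_L2_norm_tendsto_iff[OF E, of "\<lambda>k x. \<phi> k x - g x"] by (simp only: o_def)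
  then show ?thesis
    unfolding is_trace_def trace_approx_def skel_sq_integrable_def by blast
qed

lemma trace_approxD:
  assumes "trace_approx E \<phi> w g" "(p, q) \<in> E"
  shows "sq_integrable {0..1} (\<lambda>t. g (linepath p q t))"
    "\<And>k. sq_integrable {0..1} (\<lambda>t. \<phi> k (linepath p q t) - g (linepath p q t))"
    "(\<lambda>k. (L2_norm {0..1} (\<lambda>t. \<phi> k (linepath p q t) - g (linepath p q t)))\<^sup>2) \<longlonglongrightarrow> 0"
proof -
  show g: "sq_integrable {0..1} (\<lambda>t. g (linepath p q t))"
    and "(\<lambda>k. (L2_norm {0..1} (\<lambda>t. \<phi> k (linepath p q t) - g (linepath p q t)))\<^sup>2) \<longlonglongrightarrow> 0"
    using assms unfolding trace_approx_def o_def by blast+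
  have "test_function unit_square (\<phi> k)" for k
    using assms by (simp add: trace_approx_def H1_approx_def)
  from sq_integrable_edge[OF test_functionD(3)[OF this], of _ p q]
  show "sq_integrable {0..1} (\<lambda>t. \<phi> k (linepath p q t) - g (linepath p q t))" for k
    by (intro sq_integrable_diff g) (simp add: o_def)
qed

lemma trace_approx_add:
  assumes "u \<in> H10 unit_square" "v \<in> H10 unit_square" "trace_approx E \<phi> u g" "trace_approx E \<psi> v h"
  shows "trace_approx E (\<lambda>k x. \<phi> k x + \<psi> k x) (\<lambda>x. u x + v x) (\<lambda>x. g x + h x)"
  unfolding trace_approx_def
proof safe
  show "H1_approx unit_square (\<lambda>k x. \<phi> k x + \<psi> k x) (\<lambda>x. u x + v x)"
    using assms unfolding trace_approx_def by (blast intro: square.H1_approx_add square.H10_gradient)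
next
  fix a b c d assume e: "((a, b), (c, d)) \<in> E"
  note G = trace_approxD[OF assms(3) e] and H = trace_approxD[OF assms(4) e]
  let ?l = "linepath (a, b) (c, d)"
  show "sq_integrable {0..1} ((\<lambda>x. g x + h x) \<circ> ?l)"
    using sq_integrable_add(1)[OF G(1) H(1)] by (simp add: o_def)
  have "(\<lambda>k. (L2_norm {0..1} (\<lambda>t. (\<phi> k (?l t) - g (?l t)) + (\<psi> k (?l t) - h (?l t))))\<^sup>2) \<longlonglongrightarrow> 0"
    by (rule L2_norm_tendsto_add[OF G(2) H(2) G(3) H(3)])
  then show "(\<lambda>k. (L2_norm {0..1} (\<lambda>t. \<phi> k (?l t) + \<psi> k (?l t) - (g (?l t) + h (?l t))))\<^sup>2) \<longlonglongrightarrow> 0"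
    by (simp add: algebra_simps)
qed

lemma trace_approx_scale:
  assumes "u \<in> H10 unit_square" "trace_approx E \<phi> u g"
  shows "trace_approx E (\<lambda>k x. r * \<phi> k x) (\<lambda>x. r * u x) (\<lambda>x. r * g x)"
  unfolding trace_approx_def
proof safe
  show "H1_approx unit_square (\<lambda>k x. r * \<phi> k x) (\<lambda>x. r * u x)"
    using assms unfolding trace_approx_def by (blast intro: square.H1_approx_scale square.H10_gradient)
next
  fix a b c d assume e: "((a, b), (c, d)) \<in> E"
  note G = trace_approxD[OF assms(2) e]
  let ?l = "linepath (a, b) (c, d)"
  show "sq_integrable {0..1} ((\<lambda>x. r * g x) \<circ> ?l)"
    using sq_integrable_scaleR(1)[OF G(1), of r] by (simp add: o_def)
  show "(\<lambda>k. (L2_norm {0..1} (\<lambda>t. r * \<phi> k (?l t) - r * g (?l t)))\<^sup>2) \<longlonglongrightarrow> 0"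
    using L2_norm_tendsto_scale[OF G(2,3), of r] by (simp add: right_diff_distrib)
qed

lemma trace_approx_zero: "trace_approx E (\<lambda>k x. 0) (\<lambda>x. 0) (\<lambda>x. 0)"
  by (auto simp: trace_approx_def square.H1_approx_zero o_def intro: sq_integrable_continuous)

lemma is_trace_lincomb:
  assumes "edge_set E"
  shows "(\<And>i. i < (n::nat) \<Longrightarrow> \<phi> i \<in> H10 unit_square \<and> is_trace E (\<phi> i) (g i)) \<Longrightarrow>
    is_trace E (\<lambda>x. \<Sum>i<n. \<alpha> i * \<phi> i x) (\<lambda>x. \<Sum>i<n. \<alpha> i * g i x)"
proof (induction n)
  case 0
  then show ?case using trace_approx_zero by (auto simp: is_trace_iff[OF assms])
next
  case (Suc n)
  then obtain \<psi> where "trace_approx E \<psi> (\<lambda>x. \<Sum>i<n. \<alpha> i * \<phi> i x) (\<lambda>x. \<Sum>i<n. \<alpha> i * g i x)"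
    unfolding is_trace_iff[OF assms] by auto
  moreover obtain \<eta> where "trace_approx E \<eta> (\<phi> n) (g n)"
    using Suc.prems[of n] unfolding is_trace_iff[OF assms] by auto
  ultimately have "trace_approx E (\<lambda>k x. \<psi> k x + \<alpha> n * \<eta> k x)
      (\<lambda>x. (\<Sum>i<n. \<alpha> i * \<phi> i x) + \<alpha> n * \<phi> n x) (\<lambda>x. (\<Sum>i<n. \<alpha> i * g i x) + \<alpha> n * g n x)"
    using Suc.prems by (intro trace_approx_add trace_approx_scale square.H10_lincomb square.H10_scale) auto
  then show ?case unfolding is_trace_iff[OF assms] by auto
qed

lemma is_trace_diff:
  assumes "edge_set E" "u \<in> H10 unit_square" "v \<in> H10 unit_square" "is_trace E u g" "is_trace E v h"
  shows "is_trace E (\<lambda>x. u x - v x) (\<lambda>x. g x - h x)"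
proof -
  obtain \<phi> \<psi> where "trace_approx E \<phi> u g" "trace_approx E \<psi> v h"
    using assms(4,5) unfolding is_trace_iff[OF assms(1)] by blast
  then have "trace_approx E (\<lambda>k x. \<phi> k x + (-1) * \<psi> k x) (\<lambda>x. u x + (-1) * v x) (\<lambda>x. g x + (-1) * h x)"
    using assms(2,3) by (intro trace_approx_add trace_approx_scale square.H10_scale)
  then show ?thesis unfolding is_trace_iff[OF assms(1)] by auto
qed

lemma coarse_square_box: "coarse_square H c = cbox c (c + (H, H))" "interior (coarse_square H c) = box c (c + (H, H))"
  by (simp_all add: coarse_square_def interior_cbox)

lemma closure_unit_square: "closure unit_square = cbox (0, 0) (1, 1)"
  unfolding unit_square_def by (rule closure_box) (simp add: box_real_Pair)

lemma coarse_mesh_subset: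
  assumes "coarse_mesh H N c" "j < N"
  shows "cbox (c j) (c j + (H, H)) \<subseteq> cbox (0, 0) (1, 1)" "box (c j) (c j + (H, H)) \<subseteq> unit_square"
proof -
  show *: "cbox (c j) (c j + (H, H)) \<subseteq> cbox (0, 0) (1, 1)"
    using assms unfolding coarse_mesh_def closure_unit_square coarse_square_box by blast
  from interior_mono[OF *] show "box (c j) (c j + (H, H)) \<subseteq> unit_square"
    by (simp add: interior_cbox unit_square_def)
qed

text \<open>By the edge estimate a sequence of test functions that converges quickly in $H^1$ is a Cauchy sequence
  on every edge with a geometric rate, and its pointwise limit is a trace.\<close>

lemma is_trace_exists:
  assumes mesh: "coarse_mesh H N c" and w: "w \<in> H10 unit_square"
  shows "\<exists>g. is_trace (skeleton H N c) w g"
proof -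
  have H: "0 < H" using mesh by (simp add: coarse_mesh_def)
  obtain \<phi> where \<phi>: "H1_approx unit_square \<phi> w" using w by (auto simp: H10_def)
  let ?Q = unit_square
  define G where "G = weak_grad ?Q w"
  have wG: "H1_gradient ?Q w G" unfolding G_def by (rule square.H10_gradient[OF w])
  note A = square.H1_approxD[OF \<phi> wG]
  have "\<forall>l::nat. \<exists>k. (L2_norm ?Q (\<lambda>x. \<phi> k x - w x))\<^sup>2 < (1/4)^l \<and> (L2_norm ?Q (\<lambda>x. grad (\<phi> k) x - G x))\<^sup>2 < (1/4)^l"
  proof
    fix l :: nat
    have "0 < (1/4::real)^l" by simp
    from order_tendstoD(2)[OF A(4) this] order_tendstoD(2)[OF A(5) this]
    have "\<forall>\<^sub>F k in sequentially. (L2_norm ?Q (\<lambda>x. \<phi> k x - w x))\<^sup>2 < (1/4)^l \<and> (L2_norm ?Q (\<lambda>x. grad (\<phi> k) x - G x))\<^sup>2 < (1/4)^l"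
      by (rule eventually_conj)
    then show "\<exists>k. (L2_norm ?Q (\<lambda>x. \<phi> k x - w x))\<^sup>2 < (1/4)^l \<and> (L2_norm ?Q (\<lambda>x. grad (\<phi> k) x - G x))\<^sup>2 < (1/4)^l"
      by (auto simp: eventually_sequentially)
  qed
  from choice[OF this] obtain r where r: "\<And>l. (L2_norm ?Q (\<lambda>x. \<phi> (r l) x - w x))\<^sup>2 < (1/4)^l"
      "\<And>l. (L2_norm ?Q (\<lambda>x. grad (\<phi> (r l)) x - G x))\<^sup>2 < (1/4)^l" by blast
  have q: "(\<lambda>l. (1/4::real)^l) \<longlonglongrightarrow> 0" by (rule LIMSEQ_power_zero) simp
  have app: "H1_approx ?Q (\<lambda>l. \<phi> (r l)) w"
  proof (rule square.H1_approxI[OF wG A(1)])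
    show "(\<lambda>l. (L2_norm ?Q (\<lambda>x. \<phi> (r l) x - w x))\<^sup>2) \<longlonglongrightarrow> 0"
      by (rule tendsto_sandwich[OF _ _ tendsto_const q]) (auto intro!: always_eventually less_imp_le[OF r(1)])
    show "(\<lambda>l. (L2_norm ?Q (\<lambda>x. grad (\<phi> (r l)) x - G x))\<^sup>2) \<longlonglongrightarrow> 0"
      by (rule tendsto_sandwich[OF _ _ tendsto_const q]) (auto intro!: always_eventually less_imp_le[OF r(2)])
  qed
  \<comment> \<open>\<open>lim\<close> is unspecified where the sequence diverges, which on each edge is a null set\<close>
  define g where "g x = lim (\<lambda>l. \<phi> (r l) x)" for x
  have "trace_approx (skeleton H N c) (\<lambda>l. \<phi> (r l)) w g"
    unfolding trace_approx_def
  proof (intro conjI app ballI, clarify)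
    fix a b a' b' assume "((a, b), (a', b')) \<in> skeleton H N c"
    then obtain j where j: "j < N" "((a, b), (a', b')) \<in> edges H (c j)" by (auto simp: skeleton_def)
    let ?l = "linepath (a, b) (a', b')"
    have sq: "sq_integrable {0..1} (\<lambda>t. \<phi> (r l) (?l t))" for l
      using sq_integrable_edge[OF test_functionD(3)[OF A(1)], of "r l"] by (simp add: o_def)
    have "(L2_norm {0..1} (\<lambda>t. \<phi> (r l) (?l t) - \<phi> (r m) (?l t)))\<^sup>2 \<le> (2 / H) * ((1/4)^l + (1/4)^m)" for l m
    proof -
      let ?v = "\<lambda>x. \<phi> (r l) x + (-1) * \<phi> (r m) x"
      have gv: "grad ?v x = (grad (\<phi> (r l)) x - G x) - (grad (\<phi> (r m)) x - G x)" for x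
        using test_functionD(5)[OF A(1)] test_functionD(5)[OF test_function_cmult[OF A(1)]]
        by (simp only: grad_add grad_cmult) simp
      have "H * (L2_norm {0..1} (?v \<circ> ?l))\<^sup>2 \<le> (L2_norm ?Q (grad ?v))\<^sup>2"
        by (intro test_function_edge_le[OF _ H coarse_mesh_subset(1)[OF mesh j(1)] j(2)] test_function_add test_function_cmult A(1))
      also have "\<dots> = (L2_norm ?Q (\<lambda>x. (grad (\<phi> (r l)) x - G x) - (grad (\<phi> (r m)) x - G x)))\<^sup>2"
        by (simp only: L2_norm_sq gv)
      also have "\<dots> \<le> 2 * (L2_norm ?Q (\<lambda>x. grad (\<phi> (r l)) x - G x))\<^sup>2 + 2 * (L2_norm ?Q (\<lambda>x. grad (\<phi> (r m)) x - G x))\<^sup>2"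
        by (rule sq_integrable_diff(2)[OF A(3) A(3)])
      also have "\<dots> \<le> 2 * ((1/4)^l + (1/4)^m)"
        using r(2)[of l] r(2)[of m] by simp
      finally show ?thesis using H by (simp add: o_def field_simps)
    qed
    note L = L2_Cauchy_imp_tendsto_lim[OF _ _ sq this]
    show "sq_integrable {0..1} (g \<circ> ?l) \<and> (\<lambda>k. (L2_norm {0..1} (\<lambda>t. \<phi> (r k) (?l t) - g (?l t)))\<^sup>2) \<longlonglongrightarrow> 0"
      unfolding g_def o_def by (intro conjI L) auto
  qed
  then show ?thesis using is_trace_iff[OF edge_set_skeleton[OF H]] by blast
qed

lemma is_trace_skel_trace:
  assumes "coarse_mesh H N c" "w \<in> H10 unit_square"
  shows "is_trace (skeleton H N c) w (skel_trace (skeleton H N c) w)"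
  unfolding skel_trace_def by (rule someI_ex[OF is_trace_exists[OF assms]])

text \<open>The frames decrease to the empty set.\<close>

lemma frame_L2_norm_tendsto_0:
  assumes f: "sq_integrable (box c (c + (H, H))) f"
  shows "(\<lambda>n. (L2_norm (square_frame H c (H / real (Suc n))) f)\<^sup>2) \<longlonglongrightarrow> 0"
proof -
  let ?D = "box c (c + (H, H))" and ?F = "\<lambda>n. square_frame H c (H / real (Suc n))"
  have eq: "(L2_norm (?F n) f)\<^sup>2 = (\<integral>x. (if x \<in> ?F n then (norm (f x))\<^sup>2 else 0) \<partial>lebesgue_on ?D)" for n
    unfolding L2_norm_sq by (intro integral_restrict[symmetric] square_frame_subset) auto
  have m [measurable]: "f \<in> borel_measurable (lebesgue_on ?D)" using f by (simp add: sq_integrable_def)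
  have "(\<lambda>n. \<integral>x. (if x \<in> ?F n then (norm (f x))\<^sup>2 else 0) \<partial>lebesgue_on ?D) \<longlonglongrightarrow> (\<integral>x. 0 \<partial>lebesgue_on ?D)"
  proof (rule integral_dominated_convergence[where w = "\<lambda>x. (norm (f x))\<^sup>2"])
    show "integrable (lebesgue_on ?D) (\<lambda>x. (norm (f x))\<^sup>2)" using f by (simp add: sq_integrable_def)
    show "(\<lambda>x. if x \<in> ?F n then (norm (f x))\<^sup>2 else 0) \<in> borel_measurable (lebesgue_on ?D)" for n
    proof -
      have "?F n \<inter> space (lebesgue_on ?D) \<in> sets (lebesgue_on ?D)"
        unfolding space_lebesgue_on Int_absorb2[OF square_frame_subset]
        using square_frame_subset by (subst sets_restrict_space_iff) auto
      then show ?thesis by (rule measurable_If_set[rotated 2]) measurable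
    qed
    show "AE x in lebesgue_on ?D. norm (if x \<in> ?F n then (norm (f x))\<^sup>2 else 0) \<le> (norm (f x))\<^sup>2" for n by simp
    show "AE x in lebesgue_on ?D. (\<lambda>n. if x \<in> ?F n then (norm (f x))\<^sup>2 else 0) \<longlonglongrightarrow> 0"
    proof (rule AE_I2)
      fix z assume "z \<in> space (lebesgue_on ?D)"
      then have z: "z \<in> ?D" by simp
      obtain x y where c: "c = (x, y)" by force
      obtain s t where st: "z = (s, t)" by force
      have b: "0 < s - x" "0 < x + H - s" "0 < t - y" "0 < y + H - t"
        using z by (auto simp: c st box_real_Pair)
      have lim: "(\<lambda>n. H / real (Suc n)) \<longlonglongrightarrow> 0"
        using tendsto_mult_right_zero[OF LIMSEQ_inverse_real_of_nat, of H] by (simp add: divide_inverse)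
      have "\<forall>\<^sub>F n in sequentially. (if z \<in> ?F n then (norm (f z))\<^sup>2 else 0) = 0"
        using order_tendstoD(2)[OF lim b(1)] order_tendstoD(2)[OF lim b(2)]
          order_tendstoD(2)[OF lim b(3)] order_tendstoD(2)[OF lim b(4)]
      proof eventually_elim
        case (elim n)
        then show ?case by (simp add: square_frame_def c st cbox_Pair_eq)
      qed
      then show "(\<lambda>n. if z \<in> ?F n then (norm (f z))\<^sup>2 else 0) \<longlonglongrightarrow> 0" by (rule tendsto_eventually)
    qed
  qed simp
  then show ?thesis unfolding eq by simp
qed


text \<open>Test functions of the unit square that approximate \<open>w\<close> and become small on the edges are cut off near
  the boundary of the mesh square. The order of the choices matters: the width of the frame is fixed
  first, so that \<open>w\<close> and its gradient are small on it, and then the index of the sequence, so that the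
  values on the edges are small relative to this width.\<close>

section \<open>Zero trace on the skeleton\<close>

lemma zero_trace_imp_H10:
  assumes mesh: "coarse_mesh H N c" "j < N" and w: "w \<in> H10 unit_square"
    and tr: "is_trace (skeleton H N c) w g" "skel_AE_eq (skeleton H N c) g (\<lambda>x. 0)"
  shows "w \<in> H10 (box (c j) (c j + (H, H)))"
proof -
  let ?Q = unit_square and ?D = "box (c j) (c j + (H, H))"
  have H: "0 < H" using mesh by (simp add: coarse_mesh_def)
  interpret D: bounded_open ?D by (rule bounded_open_box)
  note DQ = coarse_mesh_subset(2)[OF mesh]
  define G where "G = weak_grad ?Q w"
  have wG: "H1_gradient ?Q w G" unfolding G_def by (rule square.H10_gradient[OF w])
  have wD: "H1_gradient ?D w G" by (rule square.H1_gradient_restrict[OF DQ open_box wG])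
  have sqw: "sq_integrable ?D w" "sq_integrable ?D G" using wD by (simp_all add: H1_gradient_def)
  obtain \<eta> where eta: "trace_approx (skeleton H N c) \<eta> w g"
    using tr(1) is_trace_iff[OF edge_set_skeleton[OF H]] by blast
  have app: "H1_approx ?Q \<eta> w" using eta by (simp add: trace_approx_def)
  note A = square.H1_approxD[OF app wG]
  note C = test_functionD(5)[OF A(1)]
  define \<tau> where "\<tau> k = (\<Sum>(p, q)\<in>edges H (c j). (L2_norm {0..1} (\<eta> k \<circ> linepath p q))\<^sup>2)" for k
  have \<tau>_le: "(L2_norm {0..1} (\<eta> k \<circ> linepath p q))\<^sup>2 \<le> \<tau> k" if "(p, q) \<in> edges H (c j)" for k p q
    unfolding \<tau>_def
    using member_le_sum[OF that, of "\<lambda>(p, q). (L2_norm {0..1} (\<eta> k \<circ> linepath p q))\<^sup>2"] by auto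
  have "\<tau> \<longlonglongrightarrow> 0"
    unfolding \<tau>_def[abs_def]
  proof (rule tendsto_null_sum, clarify)
    fix a b a' b' assume "((a, b), (a', b')) \<in> edges H (c j)"
    then have e: "((a, b), (a', b')) \<in> skeleton H N c" using mesh(2) by (auto simp: skeleton_def)
    let ?l = "linepath (a, b) (a', b')"
    note T = trace_approxD[OF eta e]
    have "AE t in lebesgue_on {0..1}. g (?l t) = 0" using tr(2) e by (auto simp: skel_AE_eq_def)
    then have "AE t in lebesgue_on {0..1}. \<eta> k (?l t) - g (?l t) = (\<eta> k \<circ> ?l) t" for k
      by eventually_elim simp
    then have "L2_norm {0..1} (\<lambda>t. \<eta> k (?l t) - g (?l t)) = L2_norm {0..1} (\<eta> k \<circ> ?l)" for k
      using T(2) sq_integrable_edge[OF test_functionD(3)[OF A(1)]] by (rule L2_norm_cong_AE)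
    then show "(\<lambda>k. (L2_norm {0..1} (\<eta> k \<circ> ?l))\<^sup>2) \<longlonglongrightarrow> 0" using T(3) by simp
  qed
  note \<tau>_lim = this
  obtain K where K: "0 < K"
    "\<And>H c \<delta> \<eta> \<tau>. \<lbrakk>\<And>k. Ck k \<eta>; 0 < \<delta>; 3 * \<delta> \<le> H;
        \<And>p q. (p, q) \<in> edges H c \<Longrightarrow> (L2_norm {0..1} (\<eta> \<circ> linepath p q))\<^sup>2 \<le> \<tau>\<rbrakk> \<Longrightarrow>
      (L2_norm (box c (c + (H, H))) (\<lambda>x. square_cutoff H c \<delta> x * \<eta> x - \<eta> x))\<^sup>2
        \<le> (L2_norm (square_frame H c (3 * \<delta>)) \<eta>)\<^sup>2 \<and>
      (L2_norm (box c (c + (H, H))) (\<lambda>x. grad (\<lambda>x. square_cutoff H c \<delta> x * \<eta> x) x - grad \<eta> x))\<^sup>2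
        \<le> K * ((L2_norm (square_frame H c (3 * \<delta>)) (grad \<eta>))\<^sup>2 + H * \<tau> / \<delta>)"
    by (rule cutoff_estimate) blast
  have step: "\<exists>v. test_function ?D v \<and> (L2_norm ?D (\<lambda>x. v x - w x))\<^sup>2 \<le> 10 * e
      \<and> (L2_norm ?D (\<lambda>x. grad v x - G x))\<^sup>2 \<le> (10 * K + 2) * e" if e: "0 < e" for e
  proof -
    have "\<forall>\<^sub>F n in sequentially. (L2_norm (square_frame H (c j) (H / real (Suc n))) w)\<^sup>2 < e
        \<and> (L2_norm (square_frame H (c j) (H / real (Suc n))) G)\<^sup>2 < e"
      by (intro eventually_conj order_tendstoD(2)[OF frame_L2_norm_tendsto_0] sqw e)
    then obtain n where n: "(L2_norm (square_frame H (c j) (H / real (Suc n))) w)\<^sup>2 < e"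
        "(L2_norm (square_frame H (c j) (H / real (Suc n))) G)\<^sup>2 < e"
      by (auto simp: eventually_sequentially)
    \<comment> \<open>the cutoff with parameter \<open>d\<close> acts in the frame of width \<open>3 * d\<close>\<close>
    define d where "d = H / real (Suc n) / 3"
    have "3 * (x / 3) = x" for x :: real by simp
    from this[of "H / real (Suc n)"] have d3: "3 * d = H / real (Suc n)" by (simp only: d_def)
    have d: "0 < d" "3 * d \<le> H"
      using H unfolding d3 by (auto simp: d_def divide_le_eq mult_le_cancel_left1)
    let ?F = "square_frame H (c j) (3 * d)"
    have "(\<lambda>k. H * \<tau> k / d) \<longlonglongrightarrow> 0"
      using tendsto_mult_right_zero[OF \<tau>_lim, of "H / d"] by simp
    then have "\<forall>\<^sub>F k in sequentially. (L2_norm ?Q (\<lambda>x. \<eta> k x - w x))\<^sup>2 < e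
        \<and> (L2_norm ?Q (\<lambda>x. grad (\<eta> k) x - G x))\<^sup>2 < e \<and> H * \<tau> k / d < e"
      using A(4,5) e by (intro eventually_conj order_tendstoD(2))
    then obtain k where k: "(L2_norm ?Q (\<lambda>x. \<eta> k x - w x))\<^sup>2 < e"
        "(L2_norm ?Q (\<lambda>x. grad (\<eta> k) x - G x))\<^sup>2 < e" "H * \<tau> k / d < e"
      by (auto simp: eventually_sequentially)
    define v where "v x = square_cutoff H (c j) d x * \<eta> k x" for x
    have est: "(L2_norm ?D (\<lambda>x. v x - \<eta> k x))\<^sup>2 \<le> (L2_norm ?F (\<eta> k))\<^sup>2"
      "(L2_norm ?D (\<lambda>x. grad v x - grad (\<eta> k) x))\<^sup>2 \<le> K * ((L2_norm ?F (grad (\<eta> k)))\<^sup>2 + H * \<tau> k / d)"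
    proof -
      have Ck: "Ck i (\<eta> k)" for i by (rule C)
      show "(L2_norm ?D (\<lambda>x. v x - \<eta> k x))\<^sup>2 \<le> (L2_norm ?F (\<eta> k))\<^sup>2"
        "(L2_norm ?D (\<lambda>x. grad v x - grad (\<eta> k) x))\<^sup>2 \<le> K * ((L2_norm ?F (grad (\<eta> k)))\<^sup>2 + H * \<tau> k / d)"
        using K(2)[OF Ck d \<tau>_le] unfolding v_def[abs_def] by blast+
    qed
    have v: "test_function ?D v"
      using test_function_mult[OF test_function_box_cutoff[OF d(1)] C] unfolding v_def[abs_def] square_cutoff_def .
    have FQ: "?F \<subseteq> ?Q" using square_frame_subset DQ by blast
    have FD: "?F \<subseteq> ?D" by (rule square_frame_subset)
    have sub: "(L2_norm T f)\<^sup>2 < e" if "(L2_norm ?Q f)\<^sup>2 < e" "sq_integrable ?Q f" "T = ?D \<or> T = ?F"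
      for T and f :: "real \<times> real \<Rightarrow> 'z::euclidean_space"
      using that(3) sq_integrable_subset(2)[OF that(2), of T] that(1) FQ DQ square.S_lebesgue by force
    have \<open>(L2_norm ?F (\<lambda>x. (\<eta> k x - w x) + w x))\<^sup>2 \<le> 2 * (L2_norm ?F (\<lambda>x. \<eta> k x - w x))\<^sup>2 + 2 * (L2_norm ?F w)\<^sup>2\<close>
      by (intro sq_integrable_add(2) sq_integrable_subset(1)[OF A(2) FQ] sq_integrable_subset(1)[OF sqw(1) FD]) (auto simp: square.S_lebesgue)
    then have f1: "(L2_norm ?F (\<eta> k))\<^sup>2 \<le> 4 * e"
      using sub[OF k(1) A(2), of ?F] n(1) unfolding d3 by simp
    have \<open>(L2_norm ?F (\<lambda>x. (grad (\<eta> k) x - G x) + G x))\<^sup>2 \<le> 2 * (L2_norm ?F (\<lambda>x. grad (\<eta> k) x - G x))\<^sup>2 + 2 * (L2_norm ?F G)\<^sup>2\<close>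
      by (intro sq_integrable_add(2) sq_integrable_subset(1)[OF A(3) FQ] sq_integrable_subset(1)[OF sqw(2) FD]) (auto simp: square.S_lebesgue)
    then have f2: "(L2_norm ?F (grad (\<eta> k)))\<^sup>2 \<le> 4 * e"
      using sub[OF k(2) A(3), of ?F] n(2) unfolding d3 by simp
    note sq = sq_integrable_test_function[OF v bounded_box D.S_lebesgue] sq_integrable_test_function[OF A(1)[of k] bounded_box D.S_lebesgue]
    have "(L2_norm ?D (\<lambda>x. (v x - \<eta> k x) + (\<eta> k x - w x)))\<^sup>2
        \<le> 2 * (L2_norm ?D (\<lambda>x. v x - \<eta> k x))\<^sup>2 + 2 * (L2_norm ?D (\<lambda>x. \<eta> k x - w x))\<^sup>2"
      using sq sqw by (intro sq_integrable_add(2) sq_integrable_diff(1))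
    then have g1: "(L2_norm ?D (\<lambda>x. v x - w x))\<^sup>2 \<le> 10 * e"
      using est(1) f1 sub[OF k(1) A(2), of ?D] by simp
    have "(L2_norm ?D (\<lambda>x. (grad v x - grad (\<eta> k) x) + (grad (\<eta> k) x - G x)))\<^sup>2
        \<le> 2 * (L2_norm ?D (\<lambda>x. grad v x - grad (\<eta> k) x))\<^sup>2 + 2 * (L2_norm ?D (\<lambda>x. grad (\<eta> k) x - G x))\<^sup>2"
      using sq sqw by (intro sq_integrable_add(2) sq_integrable_diff(1))
    moreover have "K * ((L2_norm ?F (grad (\<eta> k)))\<^sup>2 + H * \<tau> k / d) \<le> K * (5 * e)"
      using K(1) f2 k(3) by (intro mult_left_mono) auto
    ultimately have g2: "(L2_norm ?D (\<lambda>x. grad v x - G x))\<^sup>2 \<le> (10 * K + 2) * e"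
      using est(2) sub[OF k(2) A(3), of ?D] by (simp add: algebra_simps)
    show ?thesis using v g1 g2 by blast
  qed
  have "\<forall>n. \<exists>v. test_function ?D v \<and> (L2_norm ?D (\<lambda>x. v x - w x))\<^sup>2 \<le> 10 * inverse (real (Suc n))
      \<and> (L2_norm ?D (\<lambda>x. grad v x - G x))\<^sup>2 \<le> (10 * K + 2) * inverse (real (Suc n))"
    by (intro allI step) simp
  from choice[OF this] obtain v where v: "\<And>n. test_function ?D (v n)"
    "\<And>n. (L2_norm ?D (\<lambda>x. v n x - w x))\<^sup>2 \<le> 10 * inverse (real (Suc n))"
    "\<And>n. (L2_norm ?D (\<lambda>x. grad (v n) x - G x))\<^sup>2 \<le> (10 * K + 2) * inverse (real (Suc n))" by blast
  have lim: "(\<lambda>n. r * inverse (real (Suc n))) \<longlonglongrightarrow> 0" for r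
    by (rule tendsto_mult_right_zero[OF LIMSEQ_inverse_real_of_nat])
  have "H1_approx ?D v w"
  proof (rule D.H1_approxI[OF wD v(1)])
    show "(\<lambda>k. (L2_norm ?D (\<lambda>x. v k x - w x))\<^sup>2) \<longlonglongrightarrow> 0"
      by (rule tendsto_sandwich[OF _ _ tendsto_const lim[of 10]]) (intro always_eventually allI zero_le_power2 v(2))+
    show "(\<lambda>k. (L2_norm ?D (\<lambda>x. grad (v k) x - G x))\<^sup>2) \<longlonglongrightarrow> 0"
      by (rule tendsto_sandwich[OF _ _ tendsto_const lim[of "10 * K + 2"]]) (intro always_eventually allI zero_le_power2 v(3))+
  qed
  then show ?thesis by (rule D.H10_I[OF wD])
qed

text \<open>The inequality for test functions passes to the limit; the constant grows from \<open>2\<close> to \<open>8\<close> because the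
  squared triangle inequality is applied to \<open>w\<close> and to its gradient.\<close>

lemma H10_Poincare:
  assumes w: "w \<in> H10 (box c (c + (H, H)))" and G: "H1_gradient (box c (c + (H, H))) w G" and H: "0 < H"
  shows "(L2_norm (box c (c + (H, H))) w)\<^sup>2 \<le> 8 * H\<^sup>2 * (L2_norm (box c (c + (H, H))) G)\<^sup>2"
proof -
  let ?D = "box c (c + (H, H))"
  interpret bounded_open ?D by (rule bounded_open_box)
  obtain v where v: "H1_approx ?D v w" using w by (auto simp: H10_def)
  note A = H1_approxD[OF v G]
  have sq: "sq_integrable ?D w" "sq_integrable ?D G" using G by (simp_all add: H1_gradient_def)
  have "(L2_norm ?D w)\<^sup>2 \<le> 8 * H\<^sup>2 * (L2_norm ?D G)\<^sup>2
      + (2 * (L2_norm ?D (\<lambda>x. v k x - w x))\<^sup>2 + 8 * H\<^sup>2 * (L2_norm ?D (\<lambda>x. grad (v k) x - G x))\<^sup>2)" for k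
  proof -
    note t = sq_integrable_test_function[OF A(1)[of k] bounded_S S_lebesgue]
    have 1: "(L2_norm ?D (\<lambda>x. v k x - (v k x - w x)))\<^sup>2 \<le> 2 * (L2_norm ?D (v k))\<^sup>2 + 2 * (L2_norm ?D (\<lambda>x. v k x - w x))\<^sup>2"
      by (intro sq_integrable_diff(2) t A)
    have 2: "(L2_norm ?D (\<lambda>x. (grad (v k) x - G x) + G x))\<^sup>2
        \<le> 2 * (L2_norm ?D (\<lambda>x. grad (v k) x - G x))\<^sup>2 + 2 * (L2_norm ?D G)\<^sup>2"
      by (intro sq_integrable_add(2) sq A)
    have 3: "(L2_norm ?D (v k))\<^sup>2 \<le> 2 * H\<^sup>2 * (L2_norm ?D (grad (v k)))\<^sup>2"
      by (rule test_function_Poincare[OF A(1) H])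
    also have "\<dots> \<le> 2 * H\<^sup>2 * (2 * (L2_norm ?D (\<lambda>x. grad (v k) x - G x))\<^sup>2 + 2 * (L2_norm ?D G)\<^sup>2)"
      using 2 by (intro mult_left_mono) auto
    finally show ?thesis using 1 by (simp add: algebra_simps)
  qed
  moreover have "(\<lambda>k. 8 * H\<^sup>2 * (L2_norm ?D G)\<^sup>2
      + (2 * (L2_norm ?D (\<lambda>x. v k x - w x))\<^sup>2 + 8 * H\<^sup>2 * (L2_norm ?D (\<lambda>x. grad (v k) x - G x))\<^sup>2))
      \<longlonglongrightarrow> 8 * H\<^sup>2 * (L2_norm ?D G)\<^sup>2 + (2 * 0 + 8 * H\<^sup>2 * 0)"
    by (intro tendsto_intros A(4,5))
  ultimately show ?thesis by (intro LIMSEQ_le_const) auto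
qed

section \<open>The energy form\<close>

locale elliptic = bounded_open S for S :: "'a::euclidean_space set" +
  fixes a :: "'a \<Rightarrow> real" and l L :: real
  assumes a_measurable: "a \<in> borel_measurable (lebesgue_on S)"
    and a_bounds: "AE x in lebesgue_on S. l \<le> a x \<and> a x \<le> L" and l_pos: "0 < l"
begin

lemma weighted_L2:
  assumes "sq_integrable S g"
  shows "sq_integrable S (\<lambda>x. a x *\<^sub>R g x)"
proof (rule sq_integrable_bounded_scaleR(1)[OF assms a_measurable])
  show "AE x in lebesgue_on S. \<bar>a x\<bar> \<le> L"
    using a_bounds by eventually_elim (use l_pos in auto)
qed

lemma integrable_energy_density:
  assumes "H1_gradient S u g" "H1_gradient S v h"
  shows "integrable (lebesgue_on S) (\<lambda>x. g x \<bullet> (a x *\<^sub>R h x))"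
  using assms by (intro integrable_inner_L2 weighted_L2) (auto simp: H1_gradient_def)

lemma bilin_eq:
  assumes "H1_gradient S u g" "H1_gradient S v h"
  shows "bilin a S u v = (\<integral>x. g x \<bullet> (a x *\<^sub>R h x) \<partial>lebesgue_on S)"
  unfolding bilin_def
proof (rule integral_cong_AE)
  note W = H1_gradient_weak_grad[OF H1_gradient_imp_H1[OF assms(1)]] H1_gradient_weak_grad[OF H1_gradient_imp_H1[OF assms(2)]]
  show "(\<lambda>x. weak_grad S u x \<bullet> (a x *\<^sub>R weak_grad S v x)) \<in> borel_measurable (lebesgue_on S)"
    by (rule borel_measurable_integrable[OF integrable_energy_density[OF W]])
  show "(\<lambda>x. g x \<bullet> (a x *\<^sub>R h x)) \<in> borel_measurable (lebesgue_on S)"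
    by (rule borel_measurable_integrable[OF integrable_energy_density[OF assms]])
  show "AE x in lebesgue_on S. weak_grad S u x \<bullet> (a x *\<^sub>R weak_grad S v x) = g x \<bullet> (a x *\<^sub>R h x)"
    using weak_grad_AE_eq[OF assms(1)] weak_grad_AE_eq[OF assms(2)] by eventually_elim simp
qed

lemma bilin_commute: "bilin a S u v = bilin a S v u"
  unfolding bilin_def by (simp add: inner_commute)

lemma bilin_add_left:
  assumes "u \<in> H1 S" "v \<in> H1 S" "w \<in> H1 S"
  shows "bilin a S (\<lambda>x. u x + v x) w = bilin a S u w + bilin a S v w"
proof -
  note W = assms[THEN H1_gradient_weak_grad]
  show ?thesis
    unfolding bilin_eq[OF H1_gradient_add[OF W(1,2)] W(3)]
    using integrable_energy_density[OF W(1,3)] integrable_energy_density[OF W(2,3)]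
    by (simp add: inner_add_left bilin_def del: inner_scaleR_right)
qed

lemma bilin_scale_left:
  assumes "u \<in> H1 S" "w \<in> H1 S"
  shows "bilin a S (\<lambda>x. r * u x) w = r * bilin a S u w"
proof -
  note W = assms[THEN H1_gradient_weak_grad]
  show ?thesis
    unfolding bilin_eq[OF H1_gradient_scale[OF W(1)] W(2)]
    by (simp add: bilin_def del: inner_scaleR_right)
qed

lemma H1_add: "u \<in> H1 S \<Longrightarrow> v \<in> H1 S \<Longrightarrow> (\<lambda>x. u x + v x) \<in> H1 S"
  by (rule H1_gradient_imp_H1[OF H1_gradient_add[OF H1_gradient_weak_grad H1_gradient_weak_grad]])

lemma H1_scale: "u \<in> H1 S \<Longrightarrow> (\<lambda>x. r * u x) \<in> H1 S"
  by (rule H1_gradient_imp_H1[OF H1_gradient_scale[OF H1_gradient_weak_grad]])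

lemma H1_zero: "(\<lambda>x. 0) \<in> H1 S"
  by (rule H1_gradient_imp_H1[OF H1_gradient_smooth[OF Ck_const]])

lemma bilin_diff_left:
  assumes "u \<in> H1 S" "v \<in> H1 S" "w \<in> H1 S"
  shows "bilin a S (\<lambda>x. u x - v x) w = bilin a S u w - bilin a S v w"
  using bilin_add_left[OF assms(1) H1_scale[OF assms(2), of "-1"] assms(3)] bilin_scale_left[OF assms(2,3), of "-1"] by simp

lemma bilin_lincomb_left:
  assumes "\<And>i. i < (n::nat) \<Longrightarrow> \<phi> i \<in> H1 S" "w \<in> H1 S"
  shows "(\<lambda>x. \<Sum>i<n. \<beta> i * \<phi> i x) \<in> H1 S \<and>
    bilin a S (\<lambda>x. \<Sum>i<n. \<beta> i * \<phi> i x) w = (\<Sum>i<n. \<beta> i * bilin a S (\<phi> i) w)"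
  using assms(1)
proof (induction n)
  case 0
  then show ?case using bilin_scale_left[OF assms(2,2), of 0] by (simp add: H1_zero)
next
  case (Suc n)
  then show ?case
    using assms(2) by (simp add: H1_add H1_scale bilin_add_left bilin_scale_left)
qed

lemma bilin_sum_square:
  assumes "e \<in> H1 S" "w \<in> H1 S"
  shows "bilin a S (\<lambda>x. e x + w x) (\<lambda>x. e x + w x) = bilin a S e e + 2 * bilin a S e w + bilin a S w w"
  using assms by (simp add: bilin_add_left H1_add bilin_commute[of e "\<lambda>x. e x + w x"] bilin_commute[of w "\<lambda>x. e x + w x"] bilin_commute[of w e])

lemma bilin_coercive:
  assumes "H1_gradient S u g"
  shows "l * (L2_norm S g)\<^sup>2 \<le> bilin a S u u"
proof -
  have i: "integrable (lebesgue_on S) (\<lambda>x. l * (norm (g x))\<^sup>2)"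
    using assms by (simp add: H1_gradient_def sq_integrable_def)
  have "(\<integral>x. l * (norm (g x))\<^sup>2 \<partial>lebesgue_on S) \<le> (\<integral>x. g x \<bullet> (a x *\<^sub>R g x) \<partial>lebesgue_on S)"
    using a_bounds
    by (intro integral_mono_AE i integrable_energy_density[OF assms assms], eventually_elim)
       (simp add: dot_square_norm mult_right_mono)
  then show ?thesis by (simp add: L2_norm_sq bilin_eq[OF assms assms])
qed

lemma energy_norm_sq: "u \<in> H1 S \<Longrightarrow> (energy_norm a S u)\<^sup>2 = bilin a S u u"
  using bilin_coercive[OF H1_gradient_weak_grad, of u] l_pos
  unfolding energy_norm_def by (intro real_sqrt_pow2) (auto intro: order_trans[rotated])

lemma elliptic_subset:
  assumes "open T" "T \<subseteq> S"
  shows "elliptic T a l L"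
proof -
  have T: "T \<in> sets lebesgue" by (rule open_in_sets_lebesgue[OF assms(1)])
  show ?thesis
  proof
    show "bounded T" by (rule bounded_subset[OF bounded_S assms(2)])
    show "a \<in> borel_measurable (lebesgue_on T)" by (rule measurable_restrict_mono[OF a_measurable assms(2)])
    show "AE x in lebesgue_on T. l \<le> a x \<and> a x \<le> L"
      by (rule AE_lebesgue_on_subset[OF a_bounds assms(2) S_lebesgue T])
  qed (use assms l_pos in auto)
qed

end

lemma elliptic_coefficient: "coefficient l L a \<Longrightarrow> 0 < l \<Longrightarrow> elliptic unit_square a l L"
  by (intro elliptic.intro elliptic_axioms.intro square.bounded_open_axioms) (auto simp: coefficient_def)

section \<open>The multiscale estimate\<close>

text \<open>The open squares are disjoint, and what they leave uncovered lies in the union of their boundaries, a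
  null set.\<close>

lemma integral_coarse_mesh:
  fixes F :: "real \<times> real \<Rightarrow> real"
  assumes mesh: "coarse_mesh H N c" and F: "integrable (lebesgue_on unit_square) F"
  shows "(\<integral>x. F x \<partial>lebesgue_on unit_square) = (\<Sum>j<N. \<integral>x. F x \<partial>lebesgue_on (box (c j) (c j + (H, H))))"
proof -
  let ?D = "\<lambda>j. box (c j) (c j + (H, H))"
  define F' where "F' j x = (if x \<in> ?D j then F x else 0)" for j x
  note sub = coarse_mesh_subset(2)[OF mesh]
  have i: "integrable (lebesgue_on unit_square) (F' j)" if "j < N" for j
  proof -
    have "integrable (lebesgue_on unit_square) (\<lambda>x. indicator (?D j) x *\<^sub>R F x)"
      using sub[OF that] by (intro integrable_mult_indicator F) (subst sets_restrict_space_iff, auto simp: square.S_lebesgue)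
    then show ?thesis by (simp only: F'_def[abs_def] indicator_scaleR_eq_if)
  qed
  define Z where "Z = (\<Union>j<N. cbox (c j) (c j + (H, H)) - ?D j)"
  have "negligible Z" unfolding Z_def by (intro negligible_Union) (auto intro: negligible_frontier_interval)
  then have "AE x in lebesgue. x \<notin> Z" by (intro AE_not_in) (simp add: negligible_iff_null_sets)
  then have Z: "AE x in lebesgue_on unit_square. x \<notin> Z"
    using AE_restrict_space_iff[of unit_square lebesgue] square.S_lebesgue by auto
  have eq: "F x = (\<Sum>j<N. F' j x)" if x: "x \<in> unit_square" "x \<notin> Z" for x
  proof -
    have "x \<in> (\<Union>j<N. coarse_square H (c j))"
      using mesh x(1) closure_subset[of unit_square] unfolding coarse_mesh_def by auto
    then obtain j where j: "j < N" "x \<in> ?D j"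
      using x(2) unfolding Z_def coarse_square_box by blast
    have "F' i x = 0" if "i < N" "i \<noteq> j" for i
    proof -
      have "\<forall>i<N. \<forall>j<N. i \<noteq> j \<longrightarrow> ?D i \<inter> ?D j = {}"
        using mesh by (simp add: coarse_mesh_def coarse_square_box)
      then have "?D i \<inter> ?D j = {}" using that j(1) by simp
      then have "x \<notin> ?D i" using j(2) by blast
      then show ?thesis by (simp add: F'_def)
    qed
    then have "(\<Sum>i<N. F' i x) = (\<Sum>i\<in>{j}. F' i x)"
      using j by (intro sum.mono_neutral_right) auto
    then show ?thesis using j by (simp add: F'_def)
  qed
  have "(\<integral>x. F x \<partial>lebesgue_on unit_square) = (\<integral>x. (\<Sum>j<N. F' j x) \<partial>lebesgue_on unit_square)"
  proof (rule integral_cong_AE)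
    show "AE x in lebesgue_on unit_square. F x = (\<Sum>j<N. F' j x)"
      using Z by (rule lebesgue_on_mono) (rule eq)
  qed (use F i in \<open>auto intro!: borel_measurable_sum borel_measurable_integrable\<close>)
  also have "\<dots> = (\<Sum>j<N. \<integral>x. F' j x \<partial>lebesgue_on unit_square)"
    by (intro Bochner_Integration.integral_sum i) auto
  also have "\<dots> = (\<Sum>j<N. \<integral>x. F x \<partial>lebesgue_on (?D j))"
    unfolding F'_def using sub by (intro sum.cong integral_restrict) (auto simp: square.S_lebesgue)
  finally show ?thesis .
qed

lemma lin_span_diff:
  assumes "u \<in> lin_span n \<phi>" "v \<in> lin_span n \<phi>"
  shows "(\<lambda>x. u x - v x) \<in> lin_span n \<phi>"
proof -
  obtain \<alpha> \<beta> where "u = (\<lambda>x. \<Sum>i<n. \<alpha> i * \<phi> i x)" "v = (\<lambda>x. \<Sum>i<n. \<beta> i * \<phi> i x)"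
    using assms by (auto simp: lin_span_def)
  then have "(\<lambda>x. u x - v x) = (\<lambda>x. \<Sum>i<n. (\<alpha> i - \<beta> i) * \<phi> i x)"
    by (simp add: sum_subtractf left_diff_distrib)
  then show ?thesis unfolding lin_span_def by (intro CollectI exI[of _ "\<lambda>i. \<alpha> i - \<beta> i"] conjI) simp_all
qed

lemma lin_span_H10: "(\<And>i. i < n \<Longrightarrow> \<phi> i \<in> H10 unit_square) \<Longrightarrow> u \<in> lin_span n \<phi> \<Longrightarrow> u \<in> H10 unit_square"
  using square.H10_lincomb[of n \<phi>] by (auto simp: lin_span_def)


text \<open>The energy product is the sum of its contributions from the mesh squares, and on each of them \<open>w\<close> is
  admissible in the weak form of the equation that the multiscale functions solve.\<close>

lemma multiscale_orthogonal:
  assumes ell: "elliptic unit_square a l L" and mesh: "coarse_mesh H N c" and ms: "multiscale_basis a H N c n \<phi>"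
    and p: "p \<in> lin_span n \<phi>" and w: "w \<in> H10 unit_square"
    and wD: "\<And>j. j < N \<Longrightarrow> w \<in> H10 (box (c j) (c j + (H, H)))"
  shows "bilin a unit_square p w = 0"
proof -
  interpret elliptic unit_square a l L by (rule ell)
  obtain \<beta> where p_eq: "p = (\<lambda>x. \<Sum>i<n. \<beta> i * \<phi> i x)" using p by (auto simp: lin_span_def)
  have W: "H1_gradient unit_square w (weak_grad unit_square w)" by (rule square.H10_gradient[OF w])
  have "bilin a unit_square (\<phi> i) w = 0" if i: "i < n" for i
  proof -
    have phi: "\<phi> i \<in> H10 unit_square" using ms i by (simp add: multiscale_basis_def)
    have P: "H1_gradient unit_square (\<phi> i) (weak_grad unit_square (\<phi> i))" by (rule square.H10_gradient[OF phi])
    have "bilin a unit_square (\<phi> i) w = (\<Sum>j<N. bilin a (box (c j) (c j + (H, H))) (\<phi> i) w)"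
      unfolding bilin_eq[OF P W] integral_coarse_mesh[OF mesh integrable_energy_density[OF P W]]
    proof (intro sum.cong refl)
      fix j assume "j \<in> {..<N}"
      then have sub: "box (c j) (c j + (H, H)) \<subseteq> unit_square" using coarse_mesh_subset(2)[OF mesh] by simp
      interpret D: elliptic "box (c j) (c j + (H, H))" a l L by (rule elliptic_subset[OF open_box sub])
      show "(\<integral>x. weak_grad unit_square (\<phi> i) x \<bullet> (a x *\<^sub>R weak_grad unit_square w x) \<partial>lebesgue_on (box (c j) (c j + (H, H))))
          = bilin a (box (c j) (c j + (H, H))) (\<phi> i) w"
        by (rule D.bilin_eq[symmetric]) (intro square.H1_gradient_restrict[OF sub open_box] P W)+
    qed
    also have "\<dots> = 0"
    proof (intro sum.neutral ballI)
      fix j assume "j \<in> {..<N}"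
      then have "weakly_solves a (box (c j) (c j + (H, H))) (\<lambda>_. 0) (\<phi> i)" "w \<in> H10 (box (c j) (c j + (H, H)))"
        using ms i wD by (auto simp: multiscale_basis_def coarse_square_box)
      then show "bilin a (box (c j) (c j + (H, H))) (\<phi> i) w = 0" by (simp add: weakly_solves_def)
    qed
    finally show ?thesis .
  qed
  moreover have "bilin a unit_square p w = (\<Sum>i<n. \<beta> i * bilin a unit_square (\<phi> i) w)"
    unfolding p_eq using ms H1_gradient_imp_H1[OF W]
    by (intro bilin_lincomb_left[THEN conjunct2]) (auto simp: multiscale_basis_def H10_def)
  ultimately show ?thesis by simp
qed

text \<open>The factor is the square of the mesh size rather than of the size of the domain, since \<open>w\<close> vanishes on
  the boundary of every mesh square.\<close>

lemma mesh_Poincare: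
  assumes mesh: "coarse_mesh H N c" and G: "H1_gradient unit_square w G"
    and wD: "\<And>j. j < N \<Longrightarrow> w \<in> H10 (box (c j) (c j + (H, H)))"
  shows "(L2_norm unit_square w)\<^sup>2 \<le> 8 * H\<^sup>2 * (L2_norm unit_square G)\<^sup>2"
proof -
  have H: "0 < H" using mesh by (simp add: coarse_mesh_def)
  have split: "(L2_norm unit_square w)\<^sup>2 = (\<Sum>j<N. (L2_norm (box (c j) (c j + (H, H))) w)\<^sup>2)"
    "(L2_norm unit_square G)\<^sup>2 = (\<Sum>j<N. (L2_norm (box (c j) (c j + (H, H))) G)\<^sup>2)"
    using G unfolding L2_norm_sq by (intro integral_coarse_mesh[OF mesh]; simp add: H1_gradient_def sq_integrable_def)+
  show ?thesis
    unfolding split sum_distrib_left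
  proof (rule sum_mono)
    fix j assume "j \<in> {..<N}"
    then have j: "j < N" by simp
    show "(L2_norm (box (c j) (c j + (H, H))) w)\<^sup>2 \<le> 8 * H\<^sup>2 * (L2_norm (box (c j) (c j + (H, H))) G)\<^sup>2"
      by (rule H10_Poincare[OF wD[OF j] square.H1_gradient_restrict[OF coarse_mesh_subset(2)[OF mesh j] open_box G] H])
  qed
qed

text \<open>Equality of the trace spans provides coefficients for which \<open>u\<close> and the combination \<open>p\<close> have the same
  trace; the difference then has trace zero.\<close>

lemma exists_equal_trace:
  assumes mesh: "coarse_mesh H N c"
    and psi: "\<And>i. i < m \<Longrightarrow> \<psi> i \<in> H10 unit_square" and phi: "\<And>i. i < n \<Longrightarrow> \<phi> i \<in> H10 unit_square"
    and span: "trace_span (skeleton H N c) n \<phi> = trace_span (skeleton H N c) m \<psi>"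
    and u: "u \<in> lin_span m \<psi>"
  obtains p where "p \<in> lin_span n \<phi>" "\<And>j. j < N \<Longrightarrow> (\<lambda>x. u x - p x) \<in> H10 (box (c j) (c j + (H, H)))"
proof -
  let ?E = "skeleton H N c"
  have H: "0 < H" using mesh by (simp add: coarse_mesh_def)
  note E = edge_set_skeleton[OF H, of N c]
  obtain \<alpha> where u_eq: "u = (\<lambda>x. \<Sum>i<m. \<alpha> i * \<psi> i x)" using u by (auto simp: lin_span_def)
  define g where "g x = (\<Sum>i<m. \<alpha> i * skel_trace ?E (\<psi> i) x)" for x
  have "g \<in> trace_span ?E m \<psi>"
    unfolding trace_span_def
  proof (intro CollectI bexI[of _ g])
    show "skel_AE_eq ?E g g" by (auto simp: skel_AE_eq_def)
    show "g \<in> lin_span m (\<lambda>i. skel_trace ?E (\<psi> i))" unfolding lin_span_def g_def[abs_def] by blast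
  qed
  then obtain h where h: "h \<in> lin_span n (\<lambda>i. skel_trace ?E (\<phi> i))" "skel_AE_eq ?E g h"
    unfolding span[symmetric] by (auto simp: trace_span_def)
  then obtain \<beta> where h_eq: "h = (\<lambda>x. \<Sum>i<n. \<beta> i * skel_trace ?E (\<phi> i) x)" by (auto simp: lin_span_def)
  define p where "p = (\<lambda>x. \<Sum>i<n. \<beta> i * \<phi> i x)"
  have p: "p \<in> lin_span n \<phi>" unfolding p_def lin_span_def by blast
  have "is_trace ?E u g" "is_trace ?E p h"
    unfolding u_eq g_def[abs_def] p_def h_eq using is_trace_skel_trace[OF mesh] psi phi
    by (intro is_trace_lincomb[OF E]; simp)+
  then have tr: "is_trace ?E (\<lambda>x. u x - p x) (\<lambda>x. g x - h x)"
    using lin_span_H10[OF psi u] lin_span_H10[OF phi p] by (intro is_trace_diff[OF E])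
  have "skel_AE_eq ?E (\<lambda>x. g x - h x) (\<lambda>x. 0)" using h(2) by (auto simp: skel_AE_eq_def)
  from zero_trace_imp_H10[OF mesh _ square.H10_diff[OF lin_span_H10[OF psi u] lin_span_H10[OF phi p]] tr this]
  show thesis using that[OF p] by blast
qed

text \<open>Cea's lemma in the energy norm: the error is orthogonal to the subspace, so Pythagoras applies.\<close>

lemma galerkin_optimal:
  assumes ell: "elliptic unit_square a l L" and V: "\<And>v. v \<in> lin_span n \<phi> \<Longrightarrow> v \<in> H10 unit_square"
    and u: "u \<in> H10 unit_square" "weakly_solves a unit_square f u"
    and uV: "galerkin_solution a unit_square f (lin_span n \<phi>) w" and p: "p \<in> lin_span n \<phi>"
  shows "(energy_norm a unit_square (\<lambda>x. u x - w x))\<^sup>2 \<le> (energy_norm a unit_square (\<lambda>x. u x - p x))\<^sup>2"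
proof -
  interpret elliptic unit_square a l L by (rule ell)
  have H1: "v \<in> H1 unit_square" if "v \<in> H10 unit_square" for v using that by (simp add: H10_def)
  have w: "w \<in> lin_span n \<phi>" using uV by (simp add: galerkin_solution_def)
  define d where "d x = w x - p x" for x
  define e where "e x = u x - w x" for x
  have d: "d \<in> lin_span n \<phi>" unfolding d_def[abs_def] by (rule lin_span_diff[OF w p])
  have e: "e \<in> H10 unit_square" unfolding e_def[abs_def] by (rule square.H10_diff[OF u(1) V[OF w]])
  have "bilin a unit_square e d = bilin a unit_square u d - bilin a unit_square w d"
    unfolding e_def[abs_def] using u(1) V[OF w] V[OF d] by (intro bilin_diff_left H1)
  also have "\<dots> = 0"
    using u(2) uV d V[OF d] by (simp add: weakly_solves_def galerkin_solution_def)
  finally have orth: "bilin a unit_square e d = 0" .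
  have "(\<lambda>x. u x - p x) = (\<lambda>x. e x + d x)" by (simp add: e_def d_def)
  then have "(energy_norm a unit_square (\<lambda>x. u x - p x))\<^sup>2
      = bilin a unit_square e e + 2 * bilin a unit_square e d + bilin a unit_square d d"
    using bilin_sum_square[OF H1[OF e] H1[OF V[OF d]]] energy_norm_sq[OF H1_add[OF H1[OF e] H1[OF V[OF d]]]] by simp
  also have "\<dots> \<ge> bilin a unit_square e e"
    using orth zero_le_power2[of "energy_norm a unit_square d"] unfolding energy_norm_sq[OF H1[OF V[OF d]]] by simp
  finally show ?thesis using energy_norm_sq[OF H1[OF e]] by (simp add: e_def[abs_def])
qed

theorem proposition3p1:
  fixes l\<^sub>m\<^sub>i\<^sub>n l\<^sub>m\<^sub>a\<^sub>x :: real
  assumes "0 < l\<^sub>m\<^sub>i\<^sub>n" and "l\<^sub>m\<^sub>i\<^sub>n \<le> l\<^sub>m\<^sub>a\<^sub>x"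
  shows "\<exists>C::real. \<forall>a H N c m \<psi> n \<phi> f u u\<^sub>h u\<^sub>M\<^sub>S.
    coefficient l\<^sub>m\<^sub>i\<^sub>n l\<^sub>m\<^sub>a\<^sub>x a \<longrightarrow>
    coarse_mesh H N c \<longrightarrow>
    (\<forall>i<m. \<psi> i \<in> H10 unit_square) \<longrightarrow>
    multiscale_basis a H N c n \<phi> \<longrightarrow>
    sq_integrable unit_square f \<longrightarrow>
    u \<in> H10 unit_square \<longrightarrow>
    weakly_solves a unit_square f u \<longrightarrow>
    galerkin_solution a unit_square f (lin_span m \<psi>) u\<^sub>h \<longrightarrow>
    galerkin_solution a unit_square f (lin_span n \<phi>) u\<^sub>M\<^sub>S \<longrightarrow>
    trace_span (skeleton H N c) n \<phi> = trace_span (skeleton H N c) m \<psi> \<longrightarrow>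
    (energy_norm a unit_square (\<lambda>x. u x - u\<^sub>M\<^sub>S x))\<^sup>2
      \<le> (energy_norm a unit_square (\<lambda>x. u x - u\<^sub>h x))\<^sup>2
         + C * (L2_norm unit_square f)\<^sup>2 * H\<^sup>2"
proof (rule exI[of _ "8 / l\<^sub>m\<^sub>i\<^sub>n"], intro allI impI)
  fix a :: "real \<times> real \<Rightarrow> real" and H N c m and \<psi> :: "nat \<Rightarrow> real \<times> real \<Rightarrow> real" and n and \<phi> :: "nat \<Rightarrow> real \<times> real \<Rightarrow> real"
    and f u u\<^sub>h u\<^sub>M\<^sub>S :: "real \<times> real \<Rightarrow> real"
  assume co: "coefficient l\<^sub>m\<^sub>i\<^sub>n l\<^sub>m\<^sub>a\<^sub>x a" and mesh: "coarse_mesh H N c"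
    and psi: "\<forall>i<m. \<psi> i \<in> H10 unit_square" and ms: "multiscale_basis a H N c n \<phi>"
    and f: "sq_integrable unit_square f" and u: "u \<in> H10 unit_square" "weakly_solves a unit_square f u"
    and uh: "galerkin_solution a unit_square f (lin_span m \<psi>) u\<^sub>h"
    and ums: "galerkin_solution a unit_square f (lin_span n \<phi>) u\<^sub>M\<^sub>S"
    and span: "trace_span (skeleton H N c) n \<phi> = trace_span (skeleton H N c) m \<psi>"
  let ?Q = unit_square and ?l = "l\<^sub>m\<^sub>i\<^sub>n"
  have H: "0 < H" using mesh by (simp add: coarse_mesh_def)
  have ell: "elliptic ?Q a ?l l\<^sub>m\<^sub>a\<^sub>x" by (rule elliptic_coefficient[OF co assms(1)])
  interpret elliptic ?Q a ?l l\<^sub>m\<^sub>a\<^sub>x by (rule ell)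
  have H1: "v \<in> H1 ?Q" if "v \<in> H10 ?Q" for v using that by (simp add: H10_def)
  have phi: "\<phi> i \<in> H10 ?Q" if "i < n" for i using ms that by (simp add: multiscale_basis_def)
  have uhV: "u\<^sub>h \<in> lin_span m \<psi>" using uh by (simp add: galerkin_solution_def)
  have uh0: "u\<^sub>h \<in> H10 ?Q" using lin_span_H10[OF _ uhV] psi by blast
  obtain p where p: "p \<in> lin_span n \<phi>" and wD: "\<And>j. j < N \<Longrightarrow> (\<lambda>x. u\<^sub>h x - p x) \<in> H10 (box (c j) (c j + (H, H)))"
    using exists_equal_trace[OF mesh _ phi span uhV] psi by blast
  have p0: "p \<in> H10 ?Q" by (rule lin_span_H10[OF phi p])
  define w where "w x = u\<^sub>h x - p x" for x
  define e where "e x = u x - u\<^sub>h x" for x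
  have w0: "w \<in> H10 ?Q" unfolding w_def[abs_def] by (rule square.H10_diff[OF uh0 p0])
  have e0: "e \<in> H10 ?Q" unfolding e_def[abs_def] by (rule square.H10_diff[OF u(1) uh0])
  note wD = wD[folded w_def[abs_def]]
  define G where "G = weak_grad ?Q w"
  have wG: "H1_gradient ?Q w G" unfolding G_def by (rule square.H10_gradient[OF w0])
  have pw: "bilin a ?Q p w = 0" by (rule multiscale_orthogonal[OF ell mesh ms p w0 wD])
  have "u\<^sub>h = (\<lambda>x. p x + w x)" by (simp add: w_def)
  then have "bilin a ?Q u\<^sub>h w = bilin a ?Q w w"
    using bilin_add_left[OF H1[OF p0] H1[OF w0] H1[OF w0]] pw by simp
  moreover have "bilin a ?Q u w = (\<integral>x. f x * w x \<partial>lebesgue_on ?Q)" using u(2) w0 by (simp add: weakly_solves_def)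
  ultimately have ew: "bilin a ?Q e w = (\<integral>x. f x \<bullet> w x \<partial>lebesgue_on ?Q) - bilin a ?Q w w"
    unfolding e_def[abs_def] using bilin_diff_left[OF H1[OF u(1)] H1[OF uh0] H1[OF w0]] by simp
  \<comment> \<open>the weight in Young's inequality is the Poincare constant over the ellipticity constant, so the
    last term is at most the energy of \<open>w\<close>\<close>
  have "2 * (\<integral>x. f x \<bullet> w x \<partial>lebesgue_on ?Q) \<le> (8 * H\<^sup>2 / ?l) * (L2_norm ?Q f)\<^sup>2 + (L2_norm ?Q w)\<^sup>2 / (8 * H\<^sup>2 / ?l)"
    using wG f H assms(1) by (intro integral_two_inner_le) (auto simp: H1_gradient_def)
  also have "(L2_norm ?Q w)\<^sup>2 / (8 * H\<^sup>2 / ?l) \<le> ?l * (L2_norm ?Q G)\<^sup>2"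
    using mesh_Poincare[OF mesh wG wD] H assms(1) by (simp add: field_simps)
  also have "\<dots> \<le> bilin a ?Q w w" by (rule bilin_coercive[OF wG])
  finally have fw: "2 * (\<integral>x. f x \<bullet> w x \<partial>lebesgue_on ?Q) \<le> (8 * H\<^sup>2 / ?l) * (L2_norm ?Q f)\<^sup>2 + bilin a ?Q w w" by simp
  have "(energy_norm a ?Q (\<lambda>x. u x - u\<^sub>M\<^sub>S x))\<^sup>2 \<le> (energy_norm a ?Q (\<lambda>x. u x - p x))\<^sup>2"
    by (rule galerkin_optimal[OF ell lin_span_H10[OF phi] u ums p])
  also have "(\<lambda>x. u x - p x) = (\<lambda>x. e x + w x)" by (simp add: e_def w_def)
  also have "(energy_norm a ?Q (\<lambda>x. e x + w x))\<^sup>2 = bilin a ?Q e e + 2 * bilin a ?Q e w + bilin a ?Q w w"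
    using energy_norm_sq[OF H1_add[OF H1[OF e0] H1[OF w0]]] bilin_sum_square[OF H1[OF e0] H1[OF w0]] by simp
  also have "\<dots> \<le> bilin a ?Q e e + (8 * H\<^sup>2 / ?l) * (L2_norm ?Q f)\<^sup>2"
    using ew fw by simp
  also have "bilin a ?Q e e = (energy_norm a ?Q (\<lambda>x. u x - u\<^sub>h x))\<^sup>2"
    using energy_norm_sq[OF H1[OF e0]] by (simp add: e_def[abs_def])
  also have "(8 * H\<^sup>2 / ?l) * (L2_norm ?Q f)\<^sup>2 = 8 / ?l * (L2_norm ?Q f)\<^sup>2 * H\<^sup>2" by simp
  finally show "(energy_norm a ?Q (\<lambda>x. u x - u\<^sub>M\<^sub>S x))\<^sup>2
      \<le> (energy_norm a ?Q (\<lambda>x. u x - u\<^sub>h x))\<^sup>2 + 8 / ?l * (L2_norm ?Q f)\<^sup>2 * H\<^sup>2" .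
qed

end
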